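(* Let $D$ be the disc. Then \[ \mathrm{TC}(C(D,3))=3. \]
   Context: The disc $D$ is the sphere with one point removed (i.e. $D$ is homeomorphic to $\mathbb{R}^2$). For a space $X$, the ordered configuration space is $F(X,n)=\{(x_1,\ldots,x_n)\in X^n \mid x_i\neq x_j \text{ for } i\neq j\}$, with the subspace topology. The symmetric group $\mathfrak{S}_n$ acts on it by permuting the labels, and the unordered configuration space is the orbit space $C(X,n)=F(X,n)/\mathfrak{S}_n$. For a path-connected space $X$, let $p_X\colon X^I\to X\times X$, $p_X(\gamma)=(\gamma(0),\gamma(1))$, be the free path fibration, where $I=[0,1]$ and $X^I$ is the space of continuous paths in $X$ with the compact-open topology. The (reduced) topological complexity $\mathrm{TC}(X)$ is the minimal $k$ such that $X\times X$ admits a cover by $k+1$ open sets $U_0,\dots,U_k$, on each of which there is a continuous local section $s_i\colon U_i\to X^I$ of $p_X$, i.e. $p_X\circ s_i$ equals the inclusion $U_i\hookrightarrow X\times X$. *)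

theory Defs
  imports "HOL-Analysis.Analysis"
begin

section \<open>The disc\<close>

definition is_disc :: "'a topology \<Rightarrow> bool" where
  "is_disc D \<longleftrightarrow>
     (\<exists>p \<in> sphere (0 :: real^3) 1. D homeomorphic_space top_of_set (sphere (0 :: real^3) 1 - {p}))"


section \<open>Quotient topology\<close>

definition quotient_topology :: "'a topology \<Rightarrow> ('a \<Rightarrow> 'b) \<Rightarrow> 'b topology" where
  "quotient_topology X q =
     topology (\<lambda>U. U \<subseteq> q ` topspace X \<and> openin X {x \<in> topspace X. q x \<in> U})"

lemma openin_quotient_topology:
  "openin (quotient_topology X q) U \<longleftrightarrow>
     U \<subseteq> q ` topspace X \<and> openin X {x \<in> topspace X. q x \<in> U}"
proof -
  have "istopology (\<lambda>U. U \<subseteq> q ` topspace X \<and> openin X {x \<in> topspace X. q x \<in> U})"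
    unfolding istopology_def
  proof (intro conjI allI impI)
    fix S T
    assume S: "S \<subseteq> q ` topspace X \<and> openin X {x \<in> topspace X. q x \<in> S}"
      and T: "T \<subseteq> q ` topspace X \<and> openin X {x \<in> topspace X. q x \<in> T}"
    have "{x \<in> topspace X. q x \<in> S \<inter> T} = {x \<in> topspace X. q x \<in> S} \<inter> {x \<in> topspace X. q x \<in> T}"
      by blast
    then show "openin X {x \<in> topspace X. q x \<in> S \<inter> T}"
      using S T by (simp only: openin_Int)
    show "S \<inter> T \<subseteq> q ` topspace X" using S by blast
  next
    fix K
    assume K: "\<forall>S\<in>K. S \<subseteq> q ` topspace X \<and> openin X {x \<in> topspace X. q x \<in> S}"
    have "{x \<in> topspace X. q x \<in> \<Union>K} = (\<Union>S\<in>K. {x \<in> topspace X. q x \<in> S})"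
      by blast
    moreover have "openin X (\<Union>S\<in>K. {x \<in> topspace X. q x \<in> S})"
      using K by (intro openin_Union) auto
    ultimately show "openin X {x \<in> topspace X. q x \<in> \<Union>K}" by simp
    show "\<Union>K \<subseteq> q ` topspace X" using K by blast
  qed
  then show ?thesis
    by (simp add: quotient_topology_def topology_inverse')
qed

lemma topspace_quotient_topology [simp]: "topspace (quotient_topology X q) = q ` topspace X"
proof
  show "topspace (quotient_topology X q) \<subseteq> q ` topspace X"
    using openin_topspace[of "quotient_topology X q"] unfolding openin_quotient_topology by blast
  have "{x \<in> topspace X. q x \<in> q ` topspace X} = topspace X"
    by blast
  then have "openin (quotient_topology X q) (q ` topspace X)"
    by (simp add: openin_quotient_topology)
  then show "q ` topspace X \<subseteq> topspace (quotient_topology X q)"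
    by (rule openin_subset)
qed

lemma quotient_map_quotient_topology: "quotient_map X (quotient_topology X q) q"
  by (auto simp: quotient_map_def openin_quotient_topology)


section \<open>Configuration spaces\<close>

text \<open>
  The labels are \<open>0, \<dots>, n - 1\<close>. Points of \<open>X\<^sup>n\<close> are functions that are \<^term>\<open>undefined\<close> outside
  \<open>{..<n}\<close>, and composition with a permutation of \<open>{..<n}\<close> preserves this.
\<close>

definition ordered_config :: "'a topology \<Rightarrow> nat \<Rightarrow> (nat \<Rightarrow> 'a) topology" where
  "ordered_config X n =
     subtopology (product_topology (\<lambda>_. X) {..<n})
       {x. \<forall>i<n. \<forall>j<n. i \<noteq> j \<longrightarrow> x i \<noteq> x j}"

definition relabel_orbit :: "nat \<Rightarrow> (nat \<Rightarrow> 'a) \<Rightarrow> (nat \<Rightarrow> 'a) set" where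
  "relabel_orbit n x = {x \<circ> \<sigma> | \<sigma>. \<sigma> permutes {..<n}}"

definition unordered_config :: "'a topology \<Rightarrow> nat \<Rightarrow> (nat \<Rightarrow> 'a) set topology" where
  "unordered_config X n = quotient_topology (ordered_config X n) (relabel_orbit n)"


section \<open>Path spaces and topological complexity\<close>

text \<open>
  Maps out of \<open>X\<close> are represented by functions that are \<^term>\<open>undefined\<close> outside
  \<^term>\<open>topspace X\<close>, so that distinct functions are distinct maps.
\<close>

definition maps_between :: "'a topology \<Rightarrow> 'b topology \<Rightarrow> ('a \<Rightarrow> 'b) set" where
  "maps_between X Y = {f \<in> extensional (topspace X). continuous_map X Y f}"

definition compact_open_topology :: "'a topology \<Rightarrow> 'b topology \<Rightarrow> ('a \<Rightarrow> 'b) topology" where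
  "compact_open_topology X Y =
     topology_generated_by
       {{f \<in> maps_between X Y. f ` K \<subseteq> U} | K U. compactin X K \<and> openin Y U}"

lemma topspace_compact_open_topology [simp]:
  "topspace (compact_open_topology X Y) = maps_between X Y"
proof -
  have "{f \<in> maps_between X Y. f ` {} \<subseteq> {}}
          \<in> {{f \<in> maps_between X Y. f ` K \<subseteq> U} | K U. compactin X K \<and> openin Y U}"
    by (rule CollectI, rule exI[of _ "{}"], rule exI[of _ "{}"]) simp
  then show ?thesis
    unfolding compact_open_topology_def topology_generated_by_topspace by auto
qed

definition path_space :: "'a topology \<Rightarrow> (real \<Rightarrow> 'a) topology" where
  "path_space X = compact_open_topology (top_of_set {0..1}) X"

definition path_ends :: "(real \<Rightarrow> 'a) \<Rightarrow> 'a \<times> 'a" where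
  "path_ends \<gamma> = (\<gamma> 0, \<gamma> 1)"

definition has_path_section :: "'a topology \<Rightarrow> ('a \<times> 'a) set \<Rightarrow> bool" where
  "has_path_section X U \<longleftrightarrow>
     (\<exists>s. continuous_map (subtopology (prod_topology X X) U) (path_space X) s \<and>
          (\<forall>z\<in>U. path_ends (s z) = z))"

text \<open>The value is \<open>\<infinity>\<close> if there is no finite cover with the required property.\<close>

definition TC :: "'a topology \<Rightarrow> enat" where
  "TC X = Inf {enat k | k.
     \<exists>U :: nat \<Rightarrow> ('a \<times> 'a) set.
       (\<forall>i\<le>k. openin (prod_topology X X) (U i) \<and> has_path_section X (U i)) \<and>
       (\<Union>i\<le>k. U i) = topspace (prod_topology X X)}"

end

theory Submission
  imports Defs "HOL-Computational_Algebra.Fundamental_Theorem_Algebra"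
begin

text \<open>
  A section of the path fibration over \<open>U\<close> is a homotopy between the two projections
  \<open>U \<rightarrow> X\<close>. Passing from three points of the plane to the monic cubic with these roots identifies
  \<open>C(D, 3)\<close> with the space of separable cubics \<open>(z - m)\<^sup>3 + 3 p (z - m) + 2 q\<close>, that is with
  \<open>p\<^sup>3 + q\<^sup>2 \<noteq> 0\<close>.

  Lower bound. Two commuting loops \<open>\<alpha>\<close>, \<open>\<beta>\<close> (a full rotation and a motion of one point) and a loop
  \<open>\<gamma>\<close> (a full twist of two points) define a map of the 3-torus to \<open>X \<times> X\<close>. No nontrivial element of
  \<open>\<langle>\<alpha>, \<beta>\<rangle>\<close> is conjugate to a power of \<open>\<gamma>\<close> in the braid group. Hence, if \<open>K\<close> is a compact part of the
  torus with a path section, the connected subsets of its preimage in \<open>\<real>\<^sup>3\<close> are uniformly bounded: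
  the section lifts to continuous logarithms of \<open>z\<^sub>2 - z\<^sub>1\<close>, \<open>w\<close> and \<open>(w - 1) / (w + 1)\<close>, where
  \<open>w\<^sup>2 = (z\<^sub>3 - z\<^sub>1) / (z\<^sub>2 - z\<^sub>1)\<close>. By the Poincare-Miranda theorem three closed sets of this kind cannot
  cover \<open>\<real>\<^sup>3\<close>.

  Upper bound. The circle acts by \<open>(p, q) \<mapsto> (w\<^sup>2 p, w\<^sup>3 q)\<close>, and up to homotopy the orbit space is an
  interval whose ends are the exceptional orbits \<open>p = 0\<close> and \<open>q = 0\<close>. Stratify \<open>X \<times> X\<close> by the number of
  points near an exceptional orbit, plus one if the quotient of the two discriminants is positive.
  On each stratum there is a motion planner, after rotating the first point by \<open>\<pi> / 6\<close> if
  necessary, and the strata of level 0, 1, 2, 3 yield four open sets.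
\<close>


section \<open>Path sections as homotopies\<close>

text \<open>Why these loops: a section over a loop of the torus makes its two end loops conjugate,
  and non-conjugacy is read off from winding numbers. If \<alpha> and \<beta> are run x and y times,
  the differences \<open>b - a\<close>, \<open>c - a\<close>, \<open>c - b\<close> of the strands
  wind x, x + 2y and x + y times, whereas \<gamma> run t times winds a single pair, t times. Any two
  of these linear forms are independent, so two vanishing ones force x = y = 0 and then t = 0. This
  is why the moving point passes round one point twice and round the other once: encircling one or
  both of them just once would make two forms equal. The pieces of a cover need not contain loops,
  so windings become oscillations of logarithms along connected sets. Why the discriminant governs
  the planners: \<open>p^3\<close> and \<open>q^2\<close> both have weight 6 under the rotation. A
  segment between two normalized values fails only if their quotient is a nonpositive real k. The
  quotient of the discriminants is then an even power of k (2 or 6) or an odd one (1 or 3), and this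
  parity decides for which sign the first point must be rotated.\<close>

lemma has_path_section_iff_homotopic:
  assumes U: "U \<subseteq> topspace (prod_topology X X)"
  shows "has_path_section X U \<longleftrightarrow>
         homotopic_with (\<lambda>_. True) (subtopology (prod_topology X X) U) X fst snd"
proof -
  define Z where "Z = subtopology (prod_topology X X) U"
  have topZ: "topspace Z = U"
    using U by (auto simp: Z_def topspace_subtopology)
  let ?I = "top_of_set {0..1::real}"
  have "has_path_section X U \<longleftrightarrow>
     (\<exists>h. continuous_map (prod_topology ?I Z) X h \<and> (\<forall>z\<in>U. h (0, z) = fst z) \<and> (\<forall>z\<in>U. h (1, z) = snd z))"
  proof
    assume "has_path_section X U"
    then obtain s where s: "continuous_map Z (path_space X) s" and ends: "\<And>z. z \<in> U \<Longrightarrow> path_ends (s z) = z"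
      by (auto simp: has_path_section_def Z_def)
    have smap: "continuous_map ?I X (s z)" if "z \<in> U" for z
      using continuous_map_funspace[OF s] that by (auto simp: topZ path_space_def maps_between_def)
    have open_s: "openin Z {z \<in> U. s z ` K \<subseteq> V}" if "compactin ?I K" "openin X V" for K V
    proof -
      have "openin (path_space X) {f \<in> maps_between ?I X. f ` K \<subseteq> V}"
        unfolding path_space_def compact_open_topology_def
        using that by (intro topology_generated_by_Basis) blast
      from openin_continuous_map_preimage[OF s this]
      have "openin Z {z \<in> U. s z \<in> maps_between ?I X \<and> s z ` K \<subseteq> V}"
        by (simp add: topZ)
      moreover have "{z \<in> U. s z \<in> maps_between ?I X \<and> s z ` K \<subseteq> V} = {z \<in> U. s z ` K \<subseteq> V}"
        using continuous_map_funspace[OF s] by (auto simp: topZ path_space_def)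
      ultimately show ?thesis by simp
    qed
    define h where "h = (\<lambda>(t, z). s z t)"
    have "continuous_map (prod_topology ?I Z) X h"
      unfolding continuous_map_def
    proof (intro conjI allI impI)
      show "h \<in> topspace (prod_topology ?I Z) \<rightarrow> topspace X"
        using smap by (auto simp: h_def topZ continuous_map_def)
    next
      fix V assume V: "openin X V"
      show "openin (prod_topology ?I Z) {x \<in> topspace (prod_topology ?I Z). h x \<in> V}"
        unfolding openin_prod_topology_alt
      proof (intro allI impI)
        fix t z
        assume "(t, z) \<in> {x \<in> topspace (prod_topology ?I Z). h x \<in> V}"
        then have t: "t \<in> {0..1}" and z: "z \<in> U" and tz: "s z t \<in> V"
          by (auto simp: h_def topZ)
        have "openin ?I {r \<in> {0..1}. s z r \<in> V}"
          using openin_continuous_map_preimage[OF smap[OF z] V] by simp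
        moreover have "t \<in> {r \<in> {0..1}. s z r \<in> V}"
          using t tz by simp
        ultimately obtain e where "e > 0" and e: "\<And>r. r \<in> {0..1} \<Longrightarrow> dist r t < e \<Longrightarrow> s z r \<in> V"
          unfolding openin_euclidean_subtopology_iff by (metis (no_types, lifting) mem_Collect_eq)
        \<comment> \<open>A compact neighbourhood of \<open>t\<close> on which \<open>s z\<close>
          stays in \<open>V\<close>; the halved radius keeps it inside the \<open>e\<close>-ball. It
          turns the pointwise condition into a subbasic one, which is open in
          \<open>z\<close>.\<close>
        define K where "K = {0..1} \<inter> cball t (e/2)"
        have K: "compactin ?I K"
          by (auto simp: compactin_subtopology K_def intro: closed_Int_compact)
        have "z \<in> {z \<in> U. s z ` K \<subseteq> V}"
          using z e \<open>e > 0\<close> by (auto simp: K_def dist_commute)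
        moreover have "openin ?I ({0..1} \<inter> ball t (e/2))"
          by (simp add: openin_open_Int)
        moreover have "t \<in> {0..1} \<inter> ball t (e/2)"
          using t \<open>e > 0\<close> by auto
        moreover have "({0..1} \<inter> ball t (e/2)) \<times> {z \<in> U. s z ` K \<subseteq> V}
            \<subseteq> {x \<in> topspace (prod_topology ?I Z). h x \<in> V}"
          by (auto simp: h_def topZ K_def)
        ultimately show "\<exists>U' V'. openin ?I U' \<and> openin Z V' \<and> t \<in> U' \<and> z \<in> V' \<and>
            U' \<times> V' \<subseteq> {x \<in> topspace (prod_topology ?I Z). h x \<in> V}"
          by (intro exI[of _ "{0..1} \<inter> ball t (e/2)"] exI[of _ "{z \<in> U. s z ` K \<subseteq> V}"] conjI open_s[OF K V])
      qed
    qed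
    moreover have "\<forall>z\<in>U. h (0, z) = fst z" "\<forall>z\<in>U. h (1, z) = snd z"
      using ends by (auto simp: h_def path_ends_def prod_eq_iff)
    ultimately show "\<exists>h. continuous_map (prod_topology ?I Z) X h \<and> (\<forall>z\<in>U. h (0, z) = fst z) \<and> (\<forall>z\<in>U. h (1, z) = snd z)"
      by blast
  next
    assume "\<exists>h. continuous_map (prod_topology ?I Z) X h \<and> (\<forall>z\<in>U. h (0, z) = fst z) \<and> (\<forall>z\<in>U. h (1, z) = snd z)"
    then obtain h where h: "continuous_map (prod_topology ?I Z) X h"
      and h0: "\<And>z. z \<in> U \<Longrightarrow> h (0, z) = fst z" and h1: "\<And>z. z \<in> U \<Longrightarrow> h (1, z) = snd z"
      by blast
    define s where "s = (\<lambda>z. restrict (\<lambda>t. h (t, z)) {0..1})"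
    have smap: "s z \<in> maps_between ?I X" if "z \<in> U" for z
    proof -
      have "continuous_map ?I (prod_topology ?I Z) (\<lambda>t. (t, z))"
        using that by (auto simp: continuous_map_pairwise o_def topZ)
      from continuous_map_compose[OF this h] have "continuous_map ?I X (\<lambda>t. h (t, z))"
        by (simp add: o_def)
      then have "continuous_map ?I X (s z)"
        by (rule continuous_map_eq) (auto simp: s_def)
      then show ?thesis
        by (auto simp: maps_between_def s_def)
    qed
    have "continuous_map Z (path_space X) s"
      unfolding path_space_def compact_open_topology_def
    proof (rule continuous_on_generated_topo)
      fix A assume "A \<in> {{f \<in> maps_between ?I X. f ` K \<subseteq> V} |K V. compactin ?I K \<and> openin X V}"
      then obtain K V where K: "compactin ?I K" and V: "openin X V"
        and A: "A = {f \<in> maps_between ?I X. f ` K \<subseteq> V}" by blast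
      have K01: "K \<subseteq> {0..1}"
        using compactin_subset_topspace[OF K] by simp
      have "s -` A \<inter> topspace Z = {z \<in> U. s z ` K \<subseteq> V}"
        using smap by (auto simp: A topZ)
      moreover have "openin Z {z \<in> U. s z ` K \<subseteq> V}"
      proof (subst openin_subopen, safe)
        fix a b assume ab: "(a, b) \<in> U" and sub: "s (a, b) ` K \<subseteq> V"
        let ?W = "{x \<in> topspace (prod_topology ?I Z). h x \<in> V}"
        have "openin (prod_topology ?I Z) ?W"
          by (rule openin_continuous_map_preimage[OF h V])
        moreover have "K \<times> {(a, b)} \<subseteq> ?W"
          using K01 ab sub by (auto simp: s_def topZ subset_iff image_subset_iff)
        \<comment> \<open>Compactness of \<open>K\<close> yields one neighbourhood of the base point
          that serves all times in \<open>K\<close>.\<close>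
        ultimately have "\<exists>P Q. openin ?I P \<and> openin Z Q \<and> K \<subseteq> P \<and> (a, b) \<in> Q \<and> P \<times> Q \<subseteq> ?W"
          using K ab by (intro tube_lemma_left) (auto simp: topZ)
        then obtain P Q where PQ: "openin Z Q" "K \<subseteq> P" "(a, b) \<in> Q" "P \<times> Q \<subseteq> ?W"
          by blast
        have "Q \<subseteq> {z \<in> U. s z ` K \<subseteq> V}"
          using PQ K01 openin_subset[OF PQ(1)] by (auto simp: s_def topZ subset_iff)
        then show "\<exists>T. openin Z T \<and> (a, b) \<in> T \<and> T \<subseteq> {z \<in> U. s z ` K \<subseteq> V}"
          using PQ by blast
      qed
      ultimately show "openin Z (s -` A \<inter> topspace Z)" by simp
    next
      have "{f \<in> maps_between ?I X. f ` {} \<subseteq> {}} \<in> {{f \<in> maps_between ?I X. f ` K \<subseteq> V} |K V. compactin ?I K \<and> openin X V}"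
        by (rule CollectI, rule exI[of _ "{}"], rule exI[of _ "{}"]) simp
      then show "s ` topspace Z \<subseteq> \<Union> {{f \<in> maps_between ?I X. f ` K \<subseteq> V} |K V. compactin ?I K \<and> openin X V}"
        using smap by (auto simp: topZ)
    qed
    moreover have "\<forall>z\<in>U. path_ends (s z) = z"
      using h0 h1 by (auto simp: path_ends_def s_def prod_eq_iff)
    ultimately show "has_path_section X U"
      by (auto simp: has_path_section_def Z_def)
  qed
  also have "\<dots> \<longleftrightarrow> homotopic_with (\<lambda>_. True) Z X fst snd"
    by (subst homotopic_with) (simp_all add: topZ)
  finally show ?thesis by (simp add: Z_def)
qed

text \<open>The homotopy on \<open>U i\<close> is pulled back along \<open>F\<close> and pushed
  forward by \<open>g\<close>; as \<open>g\<close> undoes \<open>f\<close>, its ends are again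
  \<open>fst\<close> and \<open>snd\<close>.\<close>

lemma TC_le_of_homeomorphic:
  assumes "X homeomorphic_space Y"
  shows "TC X \<le> TC Y"
proof -
  obtain f g where fg: "homeomorphic_maps X Y f g"
    using assms by (auto simp: homeomorphic_space_def)
  have f: "continuous_map X Y f" and g: "continuous_map Y X g"
    and gf: "\<And>x. x \<in> topspace X \<Longrightarrow> g (f x) = x"
    using fg by (auto simp: homeomorphic_maps_def)
  define F where "F = (\<lambda>z. (f (fst z), f (snd z)))"
  have F: "continuous_map (prod_topology X X) (prod_topology Y Y) F"
    unfolding F_def by (intro continuous_map_pairedI continuous_map_compose[OF continuous_map_fst f, unfolded o_def]
        continuous_map_compose[OF continuous_map_snd f, unfolded o_def])
  show ?thesis
    unfolding TC_def
  proof (rule Inf_superset_mono, safe)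
    fix k :: nat and U :: "nat \<Rightarrow> ('b \<times> 'b) set"
    assume U: "\<forall>i\<le>k. openin (prod_topology Y Y) (U i) \<and> has_path_section Y (U i)"
      and cover: "(\<Union>i\<le>k. U i) = topspace (prod_topology Y Y)"
    define W where "W = (\<lambda>i. {z \<in> topspace (prod_topology X X). F z \<in> U i})"
    have "openin (prod_topology X X) (W i) \<and> has_path_section X (W i)" if "i \<le> k" for i
    proof
      show op: "openin (prod_topology X X) (W i)"
        unfolding W_def by (rule openin_continuous_map_preimage[OF F]) (use U that in blast)
      have sub: "U i \<subseteq> topspace (prod_topology Y Y)"
        using U that openin_subset by blast
      let ?XW = "subtopology (prod_topology X X) (W i)"
      let ?YU = "subtopology (prod_topology Y Y) (U i)"
      have "homotopic_with (\<lambda>_. True) ?YU Y fst snd"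
        using U that has_path_section_iff_homotopic[OF sub] by blast
      moreover have "continuous_map ?XW ?YU F"
        using F unfolding W_def
        by (simp add: continuous_map_in_subtopology continuous_map_from_subtopology)
      ultimately have "homotopic_with (\<lambda>_. True) ?XW Y (fst \<circ> F) (snd \<circ> F)"
        by (rule homotopic_with_compose_continuous_map_right) simp
      then have "homotopic_with (\<lambda>_. True) ?XW X (g \<circ> (fst \<circ> F)) (g \<circ> (snd \<circ> F))"
        using g by (rule homotopic_with_compose_continuous_map_left) simp
      then have "homotopic_with (\<lambda>_. True) ?XW X fst snd"
        by (rule homotopic_with_eq) (auto simp: F_def gf topspace_subtopology)
      then show "has_path_section X (W i)"
        using has_path_section_iff_homotopic openin_subset[OF op] by blast
    qed
    moreover have "(\<Union>i\<le>k. W i) = topspace (prod_topology X X)"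
    proof
      show "topspace (prod_topology X X) \<subseteq> (\<Union>i\<le>k. W i)"
      proof
        fix z assume z: "z \<in> topspace (prod_topology X X)"
        then have "F z \<in> (\<Union>i\<le>k. U i)"
          using continuous_map_funspace[OF F] cover by blast
        then show "z \<in> (\<Union>i\<le>k. W i)"
          using z by (auto simp: W_def simp del: topspace_prod_topology)
      qed
    qed (auto simp: W_def)
    ultimately show "\<exists>k'. enat k = enat k' \<and>
          (\<exists>U. (\<forall>i\<le>k'. openin (prod_topology X X) (U i) \<and> has_path_section X (U i)) \<and>
               \<Union> (U ` {..k'}) = topspace (prod_topology X X))"
      by (intro exI[of _ k] conjI refl exI[of _ W]) simp_all
  qed
qed

lemma TC_homeomorphic_space:
  "X homeomorphic_space Y \<Longrightarrow> TC X = TC Y"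
  by (meson antisym TC_le_of_homeomorphic homeomorphic_space_sym)

section \<open>Roots of separable cubics\<close>

text \<open>The points of a finite orbit are separated, and isometries carry the small balls around
  them to one another. As \<open>p\<close> is closed, the values whose whole fibre lies in these
  balls form an open set; freeness makes \<open>p\<close> injective on each sheet.\<close>

lemma covering_space_isometry_orbits:
  fixes C :: "'a::metric_space set" and p :: "'a \<Rightarrow> 'b::topological_space"
  assumes p: "continuous_on C p" and surj: "p ` C = S"
    and closed_p: "\<And>K. closedin (top_of_set C) K \<Longrightarrow> closedin (top_of_set S) (p ` K)"
    and G: "finite G" "id \<in> G"
    and maps: "\<And>g x. g \<in> G \<Longrightarrow> x \<in> C \<Longrightarrow> g x \<in> C"
    and isom: "\<And>g x y. g \<in> G \<Longrightarrow> dist (g x) (g y) = dist x y"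
    and free: "\<And>g x. g \<in> G \<Longrightarrow> x \<in> C \<Longrightarrow> g x = x \<Longrightarrow> g = id"
    and fibre: "\<And>x y. x \<in> C \<Longrightarrow> y \<in> C \<Longrightarrow> p x = p y \<longleftrightarrow> (\<exists>g\<in>G. y = g x)"
  shows "covering_space C p S"
proof
  have inv: "p (g x) = p x" if "g \<in> G" "x \<in> C" for g x
    using fibre[OF that(2) maps[OF that]] that by metis
  fix s assume "s \<in> S"
  then obtain z where z: "z \<in> C" and s: "s = p z"
    using surj by blast
  define A where "A = (\<lambda>g. g z) ` G"
  have A: "finite A" "A \<subseteq> C" "z \<in> A"
    using G maps z by (auto simp: A_def image_iff intro: bexI[of _ id])
  have pA: "p a = s" if "a \<in> A" for a
    using that inv z by (auto simp: A_def s)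
  have orbit: "w \<in> A" if "w \<in> C" "p w = s" for w
    using that fibre[OF z, of w] by (auto simp: A_def s)
  obtain e where "e > 0" and e: "\<And>a b. a \<in> A \<Longrightarrow> b \<in> A \<Longrightarrow> a \<noteq> b \<Longrightarrow> 2 * e \<le> dist a b"
  proof -
    define D where "D = {dist a b | a b. a \<in> A \<and> b \<in> A \<and> a \<noteq> b}"
    have "finite D"
      using finite_subset[of D "(\<lambda>(a, b). dist a b) ` (A \<times> A)"] A by (auto simp: D_def)
    moreover have "\<forall>d\<in>D. d > 0" by (auto simp: D_def)
    \<comment> \<open>The 1 keeps the set nonempty when the orbit is a single point; half of the
      minimum serves as \<open>e\<close>.\<close>
    ultimately have "Min (insert 1 D) > 0" "\<And>d. d \<in> D \<Longrightarrow> Min (insert 1 D) \<le> d"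
      by auto
    then show ?thesis
      using that[of "Min (insert 1 D) / 2"] by (force simp: D_def)
  qed
  have same: "a = b" if "a \<in> A" "b \<in> A" "w \<in> ball a e" "w \<in> ball b e" for a b w
    using e[OF that(1,2)] that(3,4) dist_triangle2[of a b w] by (force simp: dist_commute)
  define Q where "Q = (\<Union>a\<in>A. C \<inter> ball a e)"
  define T where "T = S - p ` (C - Q)"
  define u where "u = (\<lambda>a. C \<inter> p -` T \<inter> ball a e)"
  have Tcover: "w \<in> Q" if "w \<in> C" "p w \<in> T" for w
    using that by (auto simp: T_def)
  have "closedin (top_of_set C) (C - Q)"
    by (intro closedin_diff) (auto simp: Q_def intro: openin_open_Int)
  then have opT: "openin (top_of_set S) T"
    unfolding T_def using closed_p by (intro openin_diff) auto
  have sT: "s \<in> T"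
    using \<open>s \<in> S\<close> orbit \<open>e > 0\<close> by (force simp: T_def Q_def)
  have opCT: "openin (top_of_set C) (C \<inter> p -` T)"
    by (rule continuous_openin_preimage[OF p _ opT]) (use surj in auto)
  have opu: "openin (top_of_set C) (u a)" for a
    unfolding u_def by (rule openin_Int_open[OF opCT]) simp
  have Un: "\<Union>(u ` A) = C \<inter> p -` T"
    using Tcover by (auto simp: u_def Q_def)
  have "pairwise disjnt (u ` A)"
    using same by (auto simp: pairwise_def disjnt_def u_def) blast+
  moreover have "\<exists>q. homeomorphism (u a) T p q" if a: "a \<in> A" for a
  proof -
    have cont: "continuous_on (u a) p"
      using p by (rule continuous_on_subset) (auto simp: u_def)
    have onto: "p ` u a = T"
    proof (intro equalityI subsetI)
      fix t assume t: "t \<in> T"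
      then obtain w where w: "w \<in> C" "p w = t"
        using surj by (auto simp: T_def)
      then obtain b where b: "b \<in> A" "w \<in> ball b e"
        using Tcover t by (auto simp: Q_def)
      obtain k where k: "k \<in> G" "a = k b"
        using fibre[of b a] a b A pA by auto
      have "k w \<in> u a"
        using k w b t isom[OF k(1), of b w] maps[OF k(1) w(1)] inv[OF k(1) w(1)]
        by (auto simp: u_def)
      moreover have "p (k w) = t"
        using inv k w by auto
      ultimately show "t \<in> p ` u a" by blast
    qed (auto simp: u_def)
    have inj: "inj_on p (u a)"
    proof (rule inj_onI)
      fix v w assume v: "v \<in> u a" and w: "w \<in> u a" and "p v = p w"
      then obtain k where k: "k \<in> G" "w = k v"
        using fibre[of v w] by (auto simp: u_def)
      have aC: "a \<in> C" using a A by auto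
      have "p (k a) = s"
        using inv[OF k(1) aC] pA[OF a] by simp
      then have "k a \<in> A"
        using orbit maps[OF k(1) aC] by blast
      moreover have "w \<in> ball (k a) e"
        using v k isom[OF k(1), of a v] by (auto simp: u_def)
      \<comment> \<open>\<open>w\<close> lies in the balls around \<open>a\<close> and around
        \<open>k a\<close>, which are disjoint for different centres.\<close>
      ultimately have "k a = a"
        using same[OF _ a] w by (auto simp: u_def)
      then have "k = id"
        using free k aC by blast
      then show "v = w" using k by simp
    qed
    have "closedin (top_of_set T) (p ` K)" if K: "closedin (top_of_set (u a)) K" for K
    proof -
      \<comment> \<open>Being the complement of the other open sheets, \<open>u a\<close> is closed
        in the preimage of \<open>T\<close>, so \<open>p\<close> stays a closed map on it.\<close>
      have "u a = C \<inter> p -` T - \<Union>(u ` (A - {a}))"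
        using same a Un by (auto simp: u_def)
      moreover have "openin (top_of_set (C \<inter> p -` T)) (\<Union>(u ` (A - {a})))"
        by (rule openin_subset_trans[of C]) (use opu in blast, auto simp: u_def)
      ultimately have "closedin (top_of_set (C \<inter> p -` T)) (u a)"
        by (metis closedin_diff closedin_subtopology_refl topspace_euclidean_subtopology closedin_topspace)
      then have "closedin (top_of_set (C \<inter> p -` T)) K"
        using K closedin_trans by blast
      then obtain L where L: "closed L" "K = (C \<inter> p -` T) \<inter> L"
        by (auto simp: closedin_closed)
      have "p ` K = T \<inter> p ` (C \<inter> L)"
        using L by auto
      moreover have "closedin (top_of_set S) (p ` (C \<inter> L))"
        using L by (intro closed_p) (auto simp: closedin_closed)
      ultimately show ?thesis
        using closedin_closed_subset[of S "p ` (C \<inter> L)" T "p ` K"] openin_imp_subset[OF opT]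
        by (simp add: inf_commute)
    qed
    from homeomorphism_injective_closed_map[OF cont onto inj this] show ?thesis
      by blast
  qed
  ultimately show "\<exists>T. s \<in> T \<and> openin (top_of_set S) T \<and>
       (\<exists>v. \<Union>v = C \<inter> p -` T \<and> (\<forall>u\<in>v. openin (top_of_set C) u) \<and>
            pairwise disjnt v \<and> (\<forall>u\<in>v. \<exists>q. homeomorphism u T p q))"
    using sT opT Un opu by (intro exI[of _ T] conjI exI[of _ "u ` A"]) auto
qed (use p surj in auto)

section \<open>The Vieta map from roots to coefficients\<close>

definition distinct_triples :: "(complex \<times> complex \<times> complex) set" where
  "distinct_triples = {(a, b, c). a \<noteq> b \<and> b \<noteq> c \<and> a \<noteq> c}"

text \<open>
  The triple \<open>(m, p, q)\<close> stands for the cubic \<open>(z - m)\<^sup>3 + 3 p (z - m) + 2 q\<close>, of discriminant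
  \<open>- 108 (p\<^sup>3 + q\<^sup>2)\<close>.
\<close>

definition separable_cubics :: "(complex \<times> complex \<times> complex) set" where
  "separable_cubics = {(m, p, q). p ^ 3 + q ^ 2 \<noteq> 0}"

definition vieta :: "complex \<times> complex \<times> complex \<Rightarrow> complex \<times> complex \<times> complex" where
  "vieta = (\<lambda>(a, b, c). let m = (a + b + c) / 3 in
     (m, ((a - m) * (b - m) + (b - m) * (c - m) + (a - m) * (c - m)) / 3,
      - ((a - m) * (b - m) * (c - m)) / 2))"

definition triple_perms :: "(complex \<times> complex \<times> complex \<Rightarrow> complex \<times> complex \<times> complex) set" where
  "triple_perms = {id, \<lambda>(a, b, c). (a, c, b), \<lambda>(a, b, c). (b, a, c), \<lambda>(a, b, c). (b, c, a),
     \<lambda>(a, b, c). (c, a, b), \<lambda>(a, b, c). (c, b, a)}"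

lemma vieta_factor:
  assumes "vieta (a, b, c) = (m, p, q)"
  shows "(z - m) ^ 3 + 3 * p * (z - m) + 2 * q = (z - a) * (z - b) * (z - c)"
proof -
  have m: "a + b + c = 3 * m" and p: "3 * p = (a - m) * (b - m) + (b - m) * (c - m) + (a - m) * (c - m)"
    and q: "2 * q = - ((a - m) * (b - m) * (c - m))"
    using assms by (auto simp: vieta_def Let_def)
  have m: "c = 3 * m - a - b"
    using m by algebra
  show ?thesis
    unfolding p q by (simp add: m) algebra
qed

lemma vieta_discriminant:
  assumes "vieta (a, b, c) = (m, p, q)"
  shows "108 * (p ^ 3 + q ^ 2) = - (((a - b) * (b - c) * (a - c)) ^ 2)"
proof -
  define y z where "y = a - m" and "z = b - m"
  have "a + b + c = 3 * m" and p: "3 * p = y * z + z * (c - m) + y * (c - m)"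
    and q: "2 * q = - (y * z * (c - m))"
    using assms by (auto simp: vieta_def Let_def y_def z_def)
  then have m: "c - m = - y - z"
    unfolding y_def z_def by algebra
  \<comment> \<open>The discriminant of \<open>t^3 + P t + Q\<close> is
    \<open>- 4 P^3 - 27 Q^2\<close>, here with \<open>P = 3 p\<close> and \<open>Q = 2 q\<close>;
    the shifted roots are \<open>y\<close>, \<open>z\<close> and \<open>- y - z\<close>.\<close>
  have "108 * (p ^ 3 + q ^ 2) = 4 * (3 * p) ^ 3 + 27 * (2 * q) ^ 2"
    by (simp add: power_mult_distrib)
  also have "\<dots> = - (((y - z) * (z - (- y - z)) * (y - (- y - z))) ^ 2)"
    unfolding p q m by algebra
  also have "\<dots> = - (((a - b) * (b - c) * (a - c)) ^ 2)"
  proof -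
    have "y - z = a - b" "z - (- y - z) = b - c" "y - (- y - z) = a - c"
      unfolding m[symmetric] by (simp_all add: y_def z_def)
    then show ?thesis by simp
  qed
  finally show ?thesis .
qed

lemma vieta_in_separable_cubics_iff: "vieta x \<in> separable_cubics \<longleftrightarrow> x \<in> distinct_triples"
proof (cases x)
  case (fields a b c)
  obtain m p q where v: "vieta (a, b, c) = (m, p, q)"
    by (metis prod_cases3)
  have "p ^ 3 + q ^ 2 = 0 \<longleftrightarrow> 108 * (p ^ 3 + q ^ 2) = 0"
    by (simp only: mult_eq_0_iff) simp
  also have "\<dots> \<longleftrightarrow> (a - b) * (b - c) * (a - c) = 0"
    unfolding vieta_discriminant[OF v] by simp
  finally have "p ^ 3 + q ^ 2 = 0 \<longleftrightarrow> (a - b) * (b - c) * (a - c) = 0" .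
  then show ?thesis
    by (auto simp: fields v separable_cubics_def distinct_triples_def)
qed

lemma vieta_perm: "g \<in> triple_perms \<Longrightarrow> vieta (g x) = vieta x"
  by (cases x) (auto simp: triple_perms_def vieta_def Let_def algebra_simps)

text \<open>Evaluating the common polynomial at the roots of one triple puts them among the roots of
  the other; since they are distinct, the triples differ by a permutation.\<close>

lemma vieta_eq_iff:
  assumes x: "x \<in> distinct_triples" and y: "y \<in> distinct_triples"
  shows "vieta x = vieta y \<longleftrightarrow> (\<exists>g\<in>triple_perms. y = g x)"
proof
  assume eq: "vieta x = vieta y"
  obtain a b c where xa: "x = (a, b, c)" by (metis prod_cases3)
  obtain a' b' c' where ya: "y = (a', b', c')" by (metis prod_cases3)
  obtain m p q where v: "vieta (a, b, c) = (m, p, q)" by (metis prod_cases3)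
  have v': "vieta (a', b', c') = (m, p, q)" using eq v xa ya by simp
  have "(z - a) * (z - b) * (z - c) = (z - a') * (z - b') * (z - c')" for z
    using vieta_factor[OF v, of z] vieta_factor[OF v', of z] by simp
  from this[of a'] this[of b'] this[of c']
  have "a' \<in> {a, b, c}" "b' \<in> {a, b, c}" "c' \<in> {a, b, c}" by auto
  then show "\<exists>g\<in>triple_perms. y = g x"
    using y by (auto simp: xa ya triple_perms_def distinct_triples_def)
qed (auto simp: vieta_perm)

lemma continuous_on_vieta: "continuous_on A vieta"
  unfolding vieta_def Let_def case_prod_beta by (intro continuous_intros) auto

lemma vieta_surj: "surj vieta"
  unfolding surj_def
proof
  fix x :: "complex \<times> complex \<times> complex"
  obtain m p q where x: "x = (m, p, q)" by (metis prod_cases3)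
  have "\<not> constant (poly [:2 * q, 3 * p, 0, 1:])"
    by (simp add: constant_degree)
  then obtain y where "poly [:2 * q, 3 * p, 0, 1:] y = 0"
    using fundamental_theorem_of_algebra by blast
  then have y: "2 * q = - (y * (y ^ 2 + 3 * p))"
    by (simp add: algebra_simps power2_eq_square eq_neg_iff_add_eq_0)
  \<comment> \<open>With one root \<open>m + y\<close> at hand, the others \<open>m + u\<close> and
    \<open>m + v\<close> must satisfy \<open>u + v = - y\<close> and \<open>u v = y^2 + 3 p\<close>;
    \<open>s\<close> is \<open>u - v\<close>, a square root of
    \<open>(u + v)^2 - 4 u v\<close>.\<close>
  define s where "s = csqrt (- (3 * y ^ 2) - 12 * p)"
  have s: "s ^ 2 = - (3 * y ^ 2) - 12 * p" by (simp add: s_def)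
  define u v where "u = (- y + s) / 2" and "v = (- y - s) / 2"
  have uv: "u + v = - y" by (simp add: u_def v_def field_simps)
  have "4 * (u * v) = y ^ 2 - s ^ 2"
    by (simp add: u_def v_def field_simps power2_eq_square)
  also have "\<dots> = 4 * (y ^ 2 + 3 * p)"
    by (simp add: s)
  finally have uv2: "u * v = y ^ 2 + 3 * p"
    by (simp only: mult_cancel_left) simp
  have "m + y + (m + u) + (m + v) = 3 * m + y + (u + v)"
    by simp
  then have "(m + y + (m + u) + (m + v)) / 3 = m"
    by (simp add: uv)
  moreover have "(y * u + u * v + y * v) / 3 = p"
  proof -
    have "y * u + u * v + y * v = y * (u + v) + u * v" by algebra
    then show ?thesis by (simp add: uv uv2 power2_eq_square)
  qed
  moreover have "- (y * u * v) / 2 = q"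
  proof -
    have "- (y * u * v) = 2 * q"
      using y uv2 by (simp add: mult.assoc)
    then show ?thesis by simp
  qed
  ultimately have "vieta (m + y, m + u, m + v) = x"
    by (simp add: vieta_def x Let_def)
  then show "\<exists>y. x = vieta y" by metis
qed

lemma vieta_image: "vieta ` distinct_triples = separable_cubics"
proof -
  have "vieta ` distinct_triples = range vieta \<inter> separable_cubics"
    using vieta_in_separable_cubics_iff by blast
  then show ?thesis by (simp add: vieta_surj)
qed

text \<open>Bounded coefficients have bounded roots, which makes \<open>vieta\<close> proper:
  outside the unit disc the two lower terms add up to at most \<open>(3 + 2) * B * norm y\<close>,
  so \<open>norm y ^ 2\<close> is at most \<open>5 * B\<close>.\<close>

lemma norm_root_le:
  fixes y :: complex
  assumes "y ^ 3 + 3 * p * y + 2 * q = 0" "norm p \<le> B" "norm q \<le> B"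
  shows "norm y \<le> 1 + 5 * B"
proof (cases "norm y \<le> 1")
  case False
  then have y1: "norm y \<ge> 1" by simp
  have B: "B \<ge> 0" using assms(2) norm_ge_zero order_trans by blast
  have "y ^ 3 = - (3 * p * y + 2 * q)"
    using assms(1) by (simp add: add_eq_0_iff2 add.assoc)
  then have "norm y ^ 3 = norm (3 * p * y + 2 * q)"
    by (metis norm_minus_cancel norm_power)
  also have "\<dots> \<le> 3 * norm p * norm y + 2 * norm q"
    by (rule norm_triangle_le) (simp add: norm_mult)
  also have "\<dots> \<le> 3 * B * norm y + 2 * B * norm y"
  proof (rule add_mono)
    show "2 * norm q \<le> 2 * B * norm y"
      using assms(3) y1 B mult_mono[of "norm q" B 1 "norm y"] by simp
  qed (use assms(2) in \<open>simp add: mult_right_mono\<close>)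
  finally have "norm y * (norm y ^ 2) \<le> norm y * (5 * B)"
    by (simp add: power3_eq_cube power2_eq_square algebra_simps)
  then have "norm y ^ 2 \<le> 5 * B"
    using y1 by (subst (asm) mult_le_cancel_left_pos) auto
  moreover have "norm y \<le> norm y ^ 2"
    using y1 by (intro self_le_power) auto
  ultimately show ?thesis by linarith
qed (use assms(2) norm_ge_zero[of p] in linarith)

lemma norm_le_of_vieta:
  assumes "norm (vieta x) \<le> B"
  shows "norm x \<le> 3 * (1 + 6 * B)"
proof -
  obtain a b c where x: "x = (a, b, c)" by (metis prod_cases3)
  obtain m p q where v: "vieta (a, b, c) = (m, p, q)" by (metis prod_cases3)
  have "norm m \<le> B" "norm (p, q) \<le> B"
    using assms norm_fst_le[of m "(p, q)"] norm_snd_le[of "(p, q)" m] by (simp_all add: x v)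
  then have mpq: "norm m \<le> B" "norm p \<le> B" "norm q \<le> B"
    using norm_fst_le[of p q] norm_snd_le[of q p] by linarith+
  have "norm z \<le> 1 + 6 * B" if "z \<in> {a, b, c}" for z
  proof -
    have "(z - m) ^ 3 + 3 * p * (z - m) + 2 * q = 0"
      unfolding vieta_factor[OF v] using that by auto
    then have "norm (z - m) \<le> 1 + 5 * B"
      using norm_root_le mpq by blast
    then show ?thesis
      using norm_triangle_sub[of z m] mpq by linarith
  qed
  then have "norm a \<le> 1 + 6 * B" "norm b \<le> 1 + 6 * B" "norm c \<le> 1 + 6 * B" by auto
  then show ?thesis
    using norm_Pair_le[of a "(b, c)"] norm_Pair_le[of b c] by (simp add: x)
qed

text \<open>The roots of a convergent sequence of cubics are bounded, so a subsequence converges,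
  and its limit in \<open>K\<close> is sent to the limit cubic.\<close>

lemma closed_vieta_image:
  assumes "closed K"
  shows "closed (vieta ` K)"
  unfolding closed_sequential_limits
proof (intro allI impI, elim conjE)
  fix y l assume y: "\<forall>n. y n \<in> vieta ` K" and lim: "y \<longlonglongrightarrow> l"
  then have "\<forall>n. \<exists>x. x \<in> K \<and> y n = vieta x"
    by blast
  then obtain x where x: "\<And>n. x n \<in> K" "\<And>n. y n = vieta (x n)"
    using choice[of "\<lambda>n x. x \<in> K \<and> y n = vieta x"] by auto
  obtain B where B: "\<And>n. norm (y n) \<le> B"
    using convergent_imp_bounded[OF lim] by (auto simp: bounded_iff)
  have "norm (x n) \<le> 3 * (1 + 6 * B)" for n
    using norm_le_of_vieta[of "x n" B] B[of n] x(2)[of n] by simp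
  then have "bounded (range x)"
    by (intro boundedI) auto
  then obtain w r where r: "strict_mono r" and w: "(x \<circ> r) \<longlonglongrightarrow> w"
    using bounded_imp_convergent_subsequence[of x] by blast
  have "w \<in> K"
    using closed_sequentially[OF assms _ w] x by simp
  have "(\<lambda>n. vieta ((x \<circ> r) n)) \<longlonglongrightarrow> vieta w"
    by (rule continuous_on_tendsto_compose[OF continuous_on_vieta[of UNIV] w]) auto
  moreover have "(\<lambda>n. vieta ((x \<circ> r) n)) \<longlonglongrightarrow> l"
    using LIMSEQ_subseq_LIMSEQ[OF lim r] x by (simp add: o_def)
  ultimately have "l = vieta w"
    using LIMSEQ_unique by blast
  then show "l \<in> vieta ` K"
    using \<open>w \<in> K\<close> by blast
qed

lemma closedin_vieta_image:
  assumes "closedin (top_of_set distinct_triples) K"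
  shows "closedin (top_of_set separable_cubics) (vieta ` K)"
proof -
  obtain L where L: "closed L" "K = distinct_triples \<inter> L"
    using assms by (auto simp: closedin_closed)
  have "vieta ` K = separable_cubics \<inter> vieta ` L"
    using vieta_in_separable_cubics_iff by (auto simp: L)
  then show ?thesis
    using closed_vieta_image[OF L(1)] by (auto simp: closedin_closed)
qed

text \<open>Permutations of the coordinates are isometries of the product metric, and only the
  identity fixes a triple of distinct points.\<close>

lemma covering_space_vieta: "covering_space distinct_triples vieta separable_cubics"
proof (rule covering_space_isometry_orbits[where G = triple_perms])
  show "dist (g x) (g y) = dist x y" if "g \<in> triple_perms" for g x y
    using that by (cases x; cases y) (auto simp: triple_perms_def dist_Pair_Pair algebra_simps)
  show "g = id" if "g \<in> triple_perms" "x \<in> distinct_triples" "g x = x" for g x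
    using that by (cases x) (auto simp: triple_perms_def distinct_triples_def)
  show "g x \<in> distinct_triples" if "g \<in> triple_perms" "x \<in> distinct_triples" for g x
    using that by (cases x) (auto simp: triple_perms_def distinct_triples_def)
qed (use continuous_on_vieta vieta_image closedin_vieta_image vieta_eq_iff in \<open>auto simp: triple_perms_def\<close>)

section \<open>Configurations of three points as separable cubics\<close>

lemma quotient_maps_same_fibres_homeomorphic:
  assumes p: "quotient_map X Y p" and q: "quotient_map X Z q"
    and eq: "\<And>x y. x \<in> topspace X \<Longrightarrow> y \<in> topspace X \<Longrightarrow> p x = p y \<longleftrightarrow> q x = q y"
  shows "Y homeomorphic_space Z"
proof -
  obtain f where f: "continuous_map Y Z f" "\<And>x. x \<in> topspace X \<Longrightarrow> f (p x) = q x"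
    using quotient_map_lift_exists[OF p quotient_imp_continuous_map[OF q]] eq by metis
  obtain g where g: "continuous_map Z Y g" "\<And>x. x \<in> topspace X \<Longrightarrow> g (q x) = p x"
    using quotient_map_lift_exists[OF q quotient_imp_continuous_map[OF p]] eq by metis
  have "g (f y) = y" if "y \<in> topspace Y" for y
    using that f(2) g(2) unfolding quotient_imp_surjective_map[OF p, symmetric] by auto
  moreover have "f (g z) = z" if "z \<in> topspace Z" for z
    using that f(2) g(2) unfolding quotient_imp_surjective_map[OF q, symmetric] by auto
  ultimately have "homeomorphic_maps Y Z f g"
    unfolding homeomorphic_maps_def using f(1) g(1) by blast
  then show ?thesis
    unfolding homeomorphic_space_def by blast
qed

lemma relabel_orbit_eq_iff:
  assumes x: "x \<in> extensional {..<n}" "inj_on x {..<n}" and y: "y \<in> extensional {..<n}" "inj_on y {..<n}"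
  shows "relabel_orbit n x = relabel_orbit n y \<longleftrightarrow> x ` {..<n} = y ` {..<n}"
proof
  assume "relabel_orbit n x = relabel_orbit n y"
  moreover have "y \<in> relabel_orbit n y"
    unfolding relabel_orbit_def by (auto intro!: exI[of _ id] permutes_id)
  ultimately obtain \<sigma> where "\<sigma> permutes {..<n}" "y = x \<circ> \<sigma>"
    by (auto simp: relabel_orbit_def)
  then show "x ` {..<n} = y ` {..<n}"
    using permutes_image[of \<sigma> "{..<n}"] by (simp only: image_comp[symmetric])
next
  assume im: "x ` {..<n} = y ` {..<n}"
  \<comment> \<open>The permutation is \<open>x\<close> inverse after \<open>y\<close> on the
    labels. Off the labels it is the identity, where \<open>x\<close> and \<open>y\<close> are both
    \<open>undefined\<close>, so that \<open>y = x \<circ> \<sigma>\<close> holds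
    everywhere.\<close>
  define \<sigma> where "\<sigma> = (\<lambda>i. if i \<in> {..<n} then inv_into {..<n} x (y i) else i)"
  have x\<sigma>: "x (\<sigma> i) = y i" "\<sigma> i \<in> {..<n}" if "i \<in> {..<n}" for i
  proof -
    have "y i \<in> x ` {..<n}" using im that by blast
    then show "x (\<sigma> i) = y i" "\<sigma> i \<in> {..<n}"
      using that f_inv_into_f[of "y i" x "{..<n}"] inv_into_into[of "y i" x "{..<n}"] by (simp_all add: \<sigma>_def)
  qed
  have "inj_on \<sigma> {..<n}"
    using x\<sigma> y(2) by (metis (no_types, lifting) inj_on_def)
  moreover have "\<sigma> ` {..<n} \<subseteq> {..<n}"
    using x\<sigma>(2) by blast
  ultimately have "bij_betw \<sigma> {..<n} {..<n}"
    by (simp add: bij_betw_def endo_inj_surj)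
  then have \<sigma>: "\<sigma> permutes {..<n}"
    by (rule bij_imp_permutes) (simp add: \<sigma>_def)
  have y_eq: "y = x \<circ> \<sigma>"
  proof
    fix i show "y i = (x \<circ> \<sigma>) i"
      using x\<sigma>[of i] x(1) y(1) by (cases "i \<in> {..<n}") (auto simp: extensional_def \<sigma>_def)
  qed
  show "relabel_orbit n x = relabel_orbit n y"
    unfolding relabel_orbit_def
  proof safe
    fix \<tau> assume \<tau>: "\<tau> permutes {..<n}"
    have "x \<circ> \<tau> = y \<circ> (inv \<sigma> \<circ> \<tau>)"
      unfolding y_eq using permutes_inv_o(1)[OF \<sigma>] by (simp add: fun_eq_iff o_def)
    then show "\<exists>\<sigma>'. x \<circ> \<tau> = y \<circ> \<sigma>' \<and> \<sigma>' permutes {..<n}"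
      using permutes_compose[OF \<tau> permutes_inv[OF \<sigma>]] by blast
    show "\<exists>\<sigma>'. y \<circ> \<tau> = x \<circ> \<sigma>' \<and> \<sigma>' permutes {..<n}"
      unfolding y_eq using permutes_compose[OF \<tau> \<sigma>] by (metis o_assoc)
  qed
qed

lemma vieta_eq_iff_roots:
  assumes "(a, b, c) \<in> distinct_triples" "(a', b', c') \<in> distinct_triples"
  shows "vieta (a, b, c) = vieta (a', b', c') \<longleftrightarrow> {a, b, c} = {a', b', c'}"
proof
  assume "{a, b, c} = {a', b', c'}"
  then have "a' \<in> {a, b, c}" "b' \<in> {a, b, c}" "c' \<in> {a, b, c}" by auto
  then have "\<exists>g\<in>triple_perms. (a', b', c') = g (a, b, c)"
    using assms(2) by (auto simp: triple_perms_def distinct_triples_def)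
  then show "vieta (a, b, c) = vieta (a', b', c')"
    using vieta_eq_iff[OF assms] by blast
qed (use vieta_eq_iff[OF assms] in \<open>auto simp: triple_perms_def\<close>)

lemma is_disc_imp_homeomorphic_complex:
  assumes "is_disc D"
  shows "D homeomorphic_space (euclidean :: complex topology)"
proof -
  obtain p where p: "p \<in> sphere (0 :: real^3) 1"
    and D: "D homeomorphic_space top_of_set (sphere (0 :: real^3) 1 - {p})"
    using assms by (auto simp: is_disc_def)
  have "(sphere (0 :: real^3) 1 - {p}) homeomorphic (UNIV :: complex set)"
    using p by (intro homeomorphic_punctured_sphere_affine) auto
  then obtain f :: "real^3 \<Rightarrow> complex" and g where "homeomorphism (sphere 0 1 - {p}) UNIV f g"
    unfolding homeomorphic_def by blast
  then have "homeomorphic_maps (top_of_set (sphere (0 :: real^3) 1 - {p})) (euclidean :: complex topology) f g"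
    unfolding homeomorphism_def homeomorphic_maps_def continuous_map_in_subtopology by auto
  then have "top_of_set (sphere (0 :: real^3) 1 - {p}) homeomorphic_space (euclidean :: complex topology)"
    unfolding homeomorphic_space_def by blast
  then show ?thesis
    using D homeomorphic_space_trans by blast
qed

lemma topspace_ordered_config:
  "topspace (ordered_config X n) = {x \<in> {..<n} \<rightarrow>\<^sub>E topspace X. inj_on x {..<n}}"
  by (auto simp: ordered_config_def topspace_subtopology inj_on_def)

lemma ordered_config_3_homeomorphic:
  assumes "homeomorphic_maps D (euclidean :: complex topology) f g"
  shows "homeomorphic_maps (ordered_config D 3) (top_of_set distinct_triples)
    (\<lambda>x. (f (x 0), f (x 1), f (x 2)))
    (\<lambda>(a, b, c). \<lambda>i. if i = 0 then g a else if i = 1 then g b else if i = 2 then g c else undefined)"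
    (is "homeomorphic_maps ?X ?Y ?h ?k")
proof -
  have f: "continuous_map D euclidean f" and g: "continuous_map euclidean D g"
    and gf: "\<And>x. x \<in> topspace D \<Longrightarrow> g (f x) = x" and fg: "\<And>z. f (g z) = z"
    using assms by (auto simp: homeomorphic_maps_def)
  have less3: "i < 3 \<longleftrightarrow> i = 0 \<or> i = 1 \<or> i = (2 :: nat)" for i by auto
  have gD: "g z \<in> topspace D" for z
    using continuous_map_funspace[OF g] by auto
  have finj: "f x = f y \<longleftrightarrow> x = y" if "x \<in> topspace D" "y \<in> topspace D" for x y
    using gf that by metis
  have proj: "continuous_map ?X euclidean (\<lambda>x. f (x i))" if "i < 3" for i
  proof -
    have "continuous_map ?X D (\<lambda>x. x i)"
      unfolding ordered_config_def
      by (intro continuous_map_from_subtopology continuous_map_product_projection) (use that in simp)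
    from continuous_map_compose[OF this f] show ?thesis by (simp add: o_def)
  qed
  have "?h x \<in> distinct_triples" if "x \<in> topspace ?X" for x
  proof -
    have x: "x i \<in> topspace D" if "i < 3" for i
      using that \<open>x \<in> topspace ?X\<close> by (simp add: topspace_ordered_config PiE_iff)
    have "inj_on x {..<3}"
      using that by (simp add: topspace_ordered_config)
    then have "x i \<noteq> x j" if "i < 3" "j < 3" "i \<noteq> j" for i j
      using that by (simp add: inj_on_eq_iff)
    then show ?thesis
      using finj x by (simp add: distinct_triples_def)
  qed
  moreover have "continuous_map ?X euclidean ?h"
    unfolding prod_topology_euclidean[symmetric] by (intro continuous_map_pairedI proj) auto
  ultimately have 1: "continuous_map ?X ?Y ?h"
    by (auto simp: continuous_map_in_subtopology)
  have comp: "continuous_map ?Y D (\<lambda>z. g (p z))" if "continuous_on distinct_triples p" for p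
    using continuous_map_compose[OF _ g, of ?Y p] that by (simp add: o_def)
  have ext: "?k z \<in> extensional {..<3}" for z
    by (cases z) (auto simp: extensional_def)
  have comps: "continuous_map ?Y D (\<lambda>z. ?k z i)" if "i \<in> {..<3}" for i
  proof -
    have "i = 0 \<or> i = 1 \<or> i = 2" using that by auto
    then show ?thesis
      by (elim disjE) (auto simp: case_prod_beta intro!: comp continuous_intros)
  qed
  have "continuous_map ?Y (product_topology (\<lambda>_. D) {..<3}) ?k"
    unfolding continuous_map_componentwise using ext comps by blast
  moreover have "?k z \<in> {x. \<forall>i<3. \<forall>j<3. i \<noteq> j \<longrightarrow> x i \<noteq> x j}" if "z \<in> distinct_triples" for z
    using that fg by (cases z) (auto simp: less3 distinct_triples_def, metis+)
  ultimately have 2: "continuous_map ?Y ?X ?k"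
    unfolding ordered_config_def continuous_map_in_subtopology by auto
  have "?k (?h x) = x" if "x \<in> topspace ?X" for x
  proof
    fix i show "?k (?h x) i = x i"
      using that gf by (auto simp: topspace_ordered_config PiE_iff extensional_def less3)
  qed
  moreover have "?h (?k z) = z" for z
    using fg by (cases z) simp
  ultimately show ?thesis
    using 1 2 unfolding homeomorphic_maps_def by blast
qed

text \<open>The orbit map and \<open>vieta\<close> after the chart given by \<open>f\<close> are
  quotient maps out of the same ordered configuration space. Their fibres agree: both remember
  exactly the set of the three points.\<close>

lemma unordered_config_3_homeomorphic:
  assumes "is_disc D"
  shows "unordered_config D 3 homeomorphic_space top_of_set separable_cubics"
proof -
  obtain f g where fg: "homeomorphic_maps D (euclidean :: complex topology) f g"
    using is_disc_imp_homeomorphic_complex[OF assms] by (auto simp: homeomorphic_space_def)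
  let ?X = "ordered_config D 3" and ?h = "\<lambda>x :: nat \<Rightarrow> 'a. (f (x 0), f (x 1), f (x 2))"
  have finj: "inj_on f (topspace D)"
    using fg unfolding homeomorphic_maps_def by (metis inj_on_def)
  have h: "homeomorphic_map ?X (top_of_set distinct_triples) ?h"
    using ordered_config_3_homeomorphic[OF fg] homeomorphic_maps_imp_map by blast
  have "continuous_map (top_of_set distinct_triples) (top_of_set separable_cubics) vieta"
    using continuous_on_vieta vieta_image by auto
  moreover have "closed_map (top_of_set distinct_triples) (top_of_set separable_cubics) vieta"
    using closedin_vieta_image by (auto simp: closed_map_def)
  ultimately have "quotient_map (top_of_set distinct_triples) (top_of_set separable_cubics) vieta"
    using vieta_image by (intro continuous_closed_imp_quotient_map) auto
  then have q: "quotient_map ?X (top_of_set separable_cubics) (vieta \<circ> ?h)"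
    using h quotient_map_compose unfolding homeomorphic_map_def by blast
  have less3: "{..<3} = {0, 1, 2 :: nat}" by auto
  show ?thesis
    unfolding unordered_config_def
  proof (rule quotient_maps_same_fibres_homeomorphic[OF quotient_map_quotient_topology q])
    fix x y assume x: "x \<in> topspace ?X" and y: "y \<in> topspace ?X"
    have im: "?h z \<in> distinct_triples" if "z \<in> topspace ?X" for z
      using homeomorphic_imp_surjective_map[OF h] that by auto
    have "relabel_orbit 3 x = relabel_orbit 3 y \<longleftrightarrow> x ` {..<3} = y ` {..<3}"
      using x y by (intro relabel_orbit_eq_iff) (auto simp: topspace_ordered_config PiE_iff)
    also have "\<dots> \<longleftrightarrow> f ` (x ` {..<3}) = f ` (y ` {..<3})"
      using x y by (intro inj_on_image_eq_iff[OF finj, symmetric]) (auto simp: topspace_ordered_config PiE_iff)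
    also have "\<dots> \<longleftrightarrow> vieta (?h x) = vieta (?h y)"
      using vieta_eq_iff_roots im[OF x] im[OF y] by (simp add: less3)
    finally show "relabel_orbit 3 x = relabel_orbit 3 y \<longleftrightarrow> (vieta \<circ> ?h) x = (vieta \<circ> ?h) y"
      by simp
  qed
qed

section \<open>Covering a cube by narrow sets\<close>

text \<open>In a compact space a component is an intersection of clopen sets (Sura-Bura), so every
  component meeting \<open>A\<close> has a clopen neighbourhood that misses \<open>B\<close>;
  finitely many of these cover \<open>S \<inter> A\<close>.\<close>

lemma compact_clopen_separation:
  fixes S :: "'a::euclidean_space set"
  assumes S: "compact S" and A: "closed A" and B: "closed B"
    and conn: "\<And>C. connected C \<Longrightarrow> C \<subseteq> S \<Longrightarrow> C \<inter> A = {} \<or> C \<inter> B = {}"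
  obtains P Q where "compact P" "compact Q" "P \<union> Q = S" "P \<inter> Q = {}" "S \<inter> A \<subseteq> P" "S \<inter> B \<subseteq> Q"
proof -
  define \<K> where "\<K> = {P. openin (top_of_set S) P \<and> compact P \<and> P \<inter> B = {}}"
  have cover: "S \<inter> A \<subseteq> \<Union>\<K>"
  proof
    fix a assume a: "a \<in> S \<inter> A"
    define C where "C = connected_component_set S a"
    have C: "C \<in> components S" "a \<in> C"
      using a by (auto simp: C_def components_def)
    have "C \<inter> B = {}"
      using conn[of C] in_components_connected[OF C(1)] in_components_subset[OF C(1)] C a by blast
    then have "C \<subseteq> - B" "open (- B)" using B by auto
    moreover have "compact C"
      using C compact_components[OF S] by blast
    moreover have "locally compact S"
      using S closed_imp_locally_compact compact_imp_closed by blast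
    ultimately obtain K where "openin (top_of_set S) K" "compact K" "C \<subseteq> K" "K \<subseteq> - B"
      using Sura_Bura_clopen_subset[of S C "- B"] C by metis
    then show "a \<in> \<Union>\<K>"
      using C by (auto simp: \<K>_def)
  qed
  have "openin (top_of_set S) (S - A)"
    using A by (simp add: Diff_eq openin_open_Int open_Compl)
  then have "\<forall>c\<in>insert (S - A) \<K>. openin (top_of_set S) c" "S \<subseteq> \<Union>(insert (S - A) \<K>)"
    using cover by (auto simp: \<K>_def)
  then obtain D where D: "D \<subseteq> insert (S - A) \<K>" "finite D" "S \<subseteq> \<Union>D"
    using S unfolding compact_eq_openin_cover by meson
  define P where "P = \<Union>(D - {S - A})"
  have DK: "D - {S - A} \<subseteq> \<K>" using D by blast
  show ?thesis
  proof
    show "compact P"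
      using D DK unfolding P_def by (intro compact_Union) (auto simp: \<K>_def)
    have opP: "openin (top_of_set S) P"
      using DK unfolding P_def by (intro openin_Union) (auto simp: \<K>_def)
    then have "closedin (top_of_set S) (S - P)"
      by (simp add: closedin_diff)
    then show "compact (S - P)"
      using S closedin_compact by blast
    show "P \<union> (S - P) = S"
      using openin_imp_subset[OF opP] by blast
    show "S \<inter> A \<subseteq> P"
      using D by (auto simp: P_def)
    show "S \<inter> B \<subseteq> S - P"
      using DK by (auto simp: P_def \<K>_def)
  qed auto
qed

text \<open>Brouwer's theorem for \<open>x + c - f x\<close> clamped to the cube. At a fixed point
  no coordinate can be 0 or \<open>N\<close>, since there the sign conditions push it inwards; so
  the clamping is inactive and \<open>f i x = c\<close>.\<close>

lemma poincare_miranda: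
  fixes f :: "'n::finite \<Rightarrow> real^'n \<Rightarrow> real" and N :: real
  assumes N: "N > 0" and f: "\<And>i. continuous_on (cbox 0 (vec N)) (f i)"
    and f0: "\<And>i x. x \<in> cbox 0 (vec N) \<Longrightarrow> x $ i = 0 \<Longrightarrow> f i x < c"
    and f1: "\<And>i x. x \<in> cbox 0 (vec N) \<Longrightarrow> x $ i = N \<Longrightarrow> f i x > c"
  obtains x where "x \<in> cbox 0 (vec N)" "\<And>i. f i x = c"
proof -
  let ?S = "cbox (0 :: real^'n) (vec N)"
  define g where "g = (\<lambda>x :: real^'n. \<chi> i. max 0 (min N (x $ i + c - f i x)))"
  have "(0 :: real^'n) \<in> ?S"
    using N by (simp add: mem_box_cart)
  then have "?S \<noteq> {}" by blast
  moreover have "continuous_on ?S g"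
    unfolding g_def by (intro continuous_intros f)
  moreover have "g \<in> ?S \<rightarrow> ?S"
    using N by (auto simp: g_def mem_box_cart)
  ultimately obtain x where x: "x \<in> ?S" "g x = x"
    using brouwer[of ?S g] by auto
  have "f i x = c" for i
  proof -
    have eq: "x $ i = max 0 (min N (x $ i + c - f i x))"
      by (subst x(2)[symmetric]) (simp add: g_def)
    have "x $ i \<noteq> 0" "x $ i \<noteq> N"
      using eq f0[OF x(1)] f1[OF x(1)] N by force+
    moreover have "0 \<le> x $ i" "x $ i \<le> N"
      using x(1) by (auto simp: mem_box_cart)
    ultimately show ?thesis
      using eq by (auto simp: max_def min_def split: if_splits)
  qed
  then show ?thesis using that x by blast
qed

text \<open>As no connected part of \<open>K i\<close> joins the two faces in direction i, some
  function separates these faces and avoids the value 1/2 on \<open>K i\<close>. A common point of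
  the levels 1/2 exists by Poincare-Miranda and lies in no \<open>K i\<close>.\<close>

lemma cube_not_covered_by_dim_many_narrow_sets:
  fixes K :: "'n::finite \<Rightarrow> (real^'n) set" and N :: real
  assumes N: "N > 0" and K: "\<And>i. closed (K i)" and cover: "cbox 0 (vec N) \<subseteq> (\<Union>i. K i)"
    and conn: "\<And>i C v w. connected C \<Longrightarrow> C \<subseteq> K i \<Longrightarrow> v \<in> C \<Longrightarrow> w \<in> C \<Longrightarrow> \<bar>v $ i - w $ i\<bar> < N"
  shows False
proof -
  let ?S = "cbox (0 :: real^'n) (vec N)"
  have "\<exists>f. continuous_on UNIV f \<and> (\<forall>x\<in>?S. x $ i = 0 \<longrightarrow> f x < (1/2 :: real)) \<and>
          (\<forall>x\<in>?S. x $ i = N \<longrightarrow> f x > 1/2) \<and> (\<forall>x\<in>K i \<inter> ?S. f x \<noteq> 1/2)" for i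
  proof -
    define A B where "A = {x :: real^'n. x $ i = 0}" and "B = {x :: real^'n. x $ i = N}"
    have AB: "closed A" "closed B"
      unfolding A_def B_def by (intro closed_Collect_eq continuous_intros)+
    have "C \<inter> A = {} \<or> C \<inter> B = {}" if "connected C" "C \<subseteq> K i \<inter> ?S" for C
      using conn[of C i] that N by (force simp: A_def B_def)
    then obtain P Q where PQ: "compact P" "compact Q" "P \<union> Q = K i \<inter> ?S" "P \<inter> Q = {}"
      "K i \<inter> ?S \<inter> A \<subseteq> P" "K i \<inter> ?S \<inter> B \<subseteq> Q"
      using compact_clopen_separation[of "K i \<inter> ?S" A B] AB K
      by (metis closed_Int_compact compact_cbox)
    \<comment> \<open>The full faces are added so that the Urysohn function is 0 and 1 on all of
      them, not only on their part inside \<open>K i\<close>.\<close>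
    have "closed (P \<union> ?S \<inter> A)" "closed (Q \<union> ?S \<inter> B)"
      using PQ AB by (auto intro: compact_imp_closed)
    moreover have "(P \<union> ?S \<inter> A) \<inter> (Q \<union> ?S \<inter> B) = {}"
      using PQ N by (auto simp: A_def B_def)
    ultimately obtain f where "continuous_on UNIV f" "\<And>x. x \<in> P \<union> ?S \<inter> A \<Longrightarrow> f x = 0"
        "\<And>x. x \<in> Q \<union> ?S \<inter> B \<Longrightarrow> f x = (1::real)"
      using Urysohn[of "P \<union> ?S \<inter> A" "Q \<union> ?S \<inter> B" "0::real" 1] by metis
    moreover have "\<forall>x\<in>K i \<inter> ?S. f x \<noteq> 1/2"
    proof
      fix x assume "x \<in> K i \<inter> ?S"
      then have "x \<in> P \<or> x \<in> Q" using PQ(3) by blast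
      then show "f x \<noteq> 1/2"
        using calculation by fastforce
    qed
    ultimately show ?thesis
      by (intro exI[of _ f]) (auto simp: A_def B_def)
  qed
  then obtain f where f: "\<And>i. continuous_on UNIV (f i)"
    "\<And>i x. x \<in> ?S \<Longrightarrow> x $ i = 0 \<Longrightarrow> f i x < (1/2 :: real)"
    "\<And>i x. x \<in> ?S \<Longrightarrow> x $ i = N \<Longrightarrow> f i x > 1/2"
    "\<And>i x. x \<in> K i \<Longrightarrow> x \<in> ?S \<Longrightarrow> f i x \<noteq> 1/2"
    by (metis IntI)
  obtain x where "x \<in> ?S" "\<And>i. f i x = 1/2"
    using poincare_miranda[OF N, of f "1/2"] f continuous_on_subset[OF f(1) subset_UNIV] by metis
  then show False
    using cover f(4) by blast
qed

section \<open>The lower bound\<close>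

lemma homotopic_with_canon_iff:
  "homotopic_with_canon (\<lambda>_. True) S T f g \<longleftrightarrow>
     (\<exists>h. continuous_on ({0..1::real} \<times> S) h \<and> h \<in> {0..1} \<times> S \<rightarrow> T \<and>
          (\<forall>x\<in>S. h (0, x) = f x) \<and> (\<forall>x\<in>S. h (1, x) = g x))"
  by (subst homotopic_with) simp_all

text \<open>Divided by \<open>f\<close>, the homotopy starts at the constant 1 and lifts through the
  exponential with initial value 0, whatever the topology of \<open>S\<close>.\<close>

lemma homotopic_punctured_plane_imp_exp:
  fixes f g :: "'c::real_normed_vector \<Rightarrow> complex"
  assumes "homotopic_with_canon (\<lambda>_. True) S (- {0}) f g"
  obtains D where "continuous_on S D" "\<And>x. x \<in> S \<Longrightarrow> g x = f x * exp (D x)"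
proof -
  obtain h where h: "continuous_on ({0..1::real} \<times> S) h" "h \<in> {0..1} \<times> S \<rightarrow> - {0}"
    "\<And>x. x \<in> S \<Longrightarrow> h (0, x) = f x" "\<And>x. x \<in> S \<Longrightarrow> h (1, x) = g x"
    using assms unfolding homotopic_with_canon_iff by blast
  have f: "continuous_on S f"
    using homotopic_with_imp_continuous[OF assms] by blast
  have nz: "f x \<noteq> 0" if "x \<in> S" for x
    using h(2,3) that by (force simp: Pi_iff)
  have "continuous_on ({0..1::real} \<times> S) (\<lambda>y. h y / f (snd y))"
    using nz by (intro continuous_intros h(1) continuous_on_compose2[OF f]) auto
  then have "homotopic_with_canon (\<lambda>_. True) S (- {0}) (\<lambda>x. 1) (\<lambda>x. g x / f x)"
    unfolding homotopic_with_canon_iff using h nz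
    by (intro exI[of _ "\<lambda>y. h y / f (snd y)"]) (auto simp: Pi_iff)
  from covering_space_lift_homotopic_function[OF covering_space_exp_punctured_plane continuous_on_const _ _ this, of 0]
  obtain D where D: "continuous_on S D" "\<And>x. x \<in> S \<Longrightarrow> exp (D x) = g x / f x"
    by auto
  show ?thesis
    using that[OF D(1)] D(2) nz by simp
qed

text \<open>The cross ratio with infinity as fourth point: the position of \<open>c\<close> after
  the affine map that sends \<open>a\<close> to 0 and \<open>b\<close> to 1.\<close>

definition cross_ratio :: "complex \<times> complex \<times> complex \<Rightarrow> complex" where
  "cross_ratio = (\<lambda>(a, b, c). (c - a) / (b - a))"

lemma continuous_on_cross_ratio: "continuous_on distinct_triples cross_ratio"
  unfolding cross_ratio_def case_prod_beta
  by (intro continuous_intros) (auto simp: distinct_triples_def)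

lemma cross_ratio_neq: "x \<in> distinct_triples \<Longrightarrow> cross_ratio x \<noteq> 0 \<and> cross_ratio x \<noteq> 1"
  by (cases x) (auto simp: distinct_triples_def cross_ratio_def)

text \<open>The homotopy lifts to ordered triples, and the cross ratio along it, which avoids 0 and
  1, lifts to a square root avoiding 0, 1 and -1. Hence \<open>b - a\<close>, \<open>w\<close> and
  \<open>(w - 1) / (w + 1)\<close> never vanish on the way, and their values at the two ends differ
  by exponentials of continuous functions on all of \<open>S\<close>.\<close>

lemma config_homotopy_logarithms:
  fixes z\<^sub>0 :: "'c::real_normed_vector \<Rightarrow> complex \<times> complex \<times> complex"
  assumes hom: "homotopic_with_canon (\<lambda>_. True) S separable_cubics (vieta \<circ> z\<^sub>0) f"
    and z0: "continuous_on S z\<^sub>0" "z\<^sub>0 \<in> S \<rightarrow> distinct_triples"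
    and w0: "continuous_on S w\<^sub>0" "\<And>x. x \<in> S \<Longrightarrow> w\<^sub>0 x ^ 2 = cross_ratio (z\<^sub>0 x)"
  obtains z\<^sub>1 w\<^sub>1 D\<^sub>L D\<^sub>M D\<^sub>B where
    "continuous_on S z\<^sub>1" "z\<^sub>1 \<in> S \<rightarrow> distinct_triples" "\<And>x. x \<in> S \<Longrightarrow> vieta (z\<^sub>1 x) = f x"
    "continuous_on S w\<^sub>1" "\<And>x. x \<in> S \<Longrightarrow> w\<^sub>1 x ^ 2 = cross_ratio (z\<^sub>1 x)"
    "continuous_on S D\<^sub>L" "\<And>x. x \<in> S \<Longrightarrow>
       fst (snd (z\<^sub>1 x)) - fst (z\<^sub>1 x) = (fst (snd (z\<^sub>0 x)) - fst (z\<^sub>0 x)) * exp (D\<^sub>L x)"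
    "continuous_on S D\<^sub>M" "\<And>x. x \<in> S \<Longrightarrow> w\<^sub>1 x = w\<^sub>0 x * exp (D\<^sub>M x)"
    "continuous_on S D\<^sub>B" "\<And>x. x \<in> S \<Longrightarrow>
       (w\<^sub>1 x - 1) / (w\<^sub>1 x + 1) = (w\<^sub>0 x - 1) / (w\<^sub>0 x + 1) * exp (D\<^sub>B x)"
proof -
  obtain h where h: "continuous_on ({0..1::real} \<times> S) h" "h \<in> {0..1} \<times> S \<rightarrow> separable_cubics"
    "\<And>x. x \<in> S \<Longrightarrow> h (0, x) = vieta (z\<^sub>0 x)" "\<And>x. x \<in> S \<Longrightarrow> h (1, x) = f x"
    using hom unfolding homotopic_with_canon_iff o_def by blast
  obtain k where k: "continuous_on ({0..1::real} \<times> S) k" "k \<in> {0..1} \<times> S \<rightarrow> distinct_triples"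
    "\<And>x. x \<in> S \<Longrightarrow> k (0, x) = z\<^sub>0 x" "\<And>y. y \<in> {0..1} \<times> S \<Longrightarrow> h y = vieta (k y)"
    using covering_space_lift_homotopy[OF covering_space_vieta h(1,2,3) z0] by blast
  define z1 where "z1 = (\<lambda>x. k (1, x))"
  have homz: "homotopic_with_canon (\<lambda>_. True) S distinct_triples z\<^sub>0 z1"
    unfolding homotopic_with_canon_iff z1_def using k by blast
  then have z1: "continuous_on S z1" "z1 \<in> S \<rightarrow> distinct_triples"
    using homotopic_with_imp_continuous homotopic_with_imp_funspace2 by blast+
  have vz1: "vieta (z1 x) = f x" if "x \<in> S" for x
    using k(4)[of "(1, x)"] h(4) that by (simp add: z1_def)
  have "homotopic_with_canon (\<lambda>_. True) S (- {0})
      ((\<lambda>z. fst (snd z) - fst z) \<circ> z\<^sub>0) ((\<lambda>z. fst (snd z) - fst z) \<circ> z1)"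
    by (rule homotopic_with_compose_continuous_left[OF homz])
      (auto intro!: continuous_intros simp: distinct_triples_def)
  from homotopic_punctured_plane_imp_exp[OF this] obtain DL where DL: "continuous_on S DL" "\<And>x. x \<in> S \<Longrightarrow>
       fst (snd (z1 x)) - fst (z1 x) = (fst (snd (z\<^sub>0 x)) - fst (z\<^sub>0 x)) * exp (DL x)"
    unfolding o_def by blast
  have "continuous_on ({0..1::real} \<times> S) (\<lambda>y. cross_ratio (k y))"
    using continuous_on_compose2[OF continuous_on_cross_ratio k(1)] k(2) by blast
  moreover have "(\<lambda>y. cross_ratio (k y)) \<in> {0..1} \<times> S \<rightarrow> - {0}"
    using k(2) cross_ratio_neq by blast
  moreover have "w\<^sub>0 \<in> S \<rightarrow> - {0}"
    using w0(2) z0(2) cross_ratio_neq by fastforce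
  moreover have "cross_ratio (k (0, x)) = w\<^sub>0 x ^ 2" if "x \<in> S" for x
    using w0(2) k(3) that by simp
  ultimately obtain l where l: "continuous_on ({0..1::real} \<times> S) l" "l \<in> {0..1} \<times> S \<rightarrow> - {0}"
    "\<And>x. x \<in> S \<Longrightarrow> l (0, x) = w\<^sub>0 x" "\<And>y. y \<in> {0..1} \<times> S \<Longrightarrow> cross_ratio (k y) = l y ^ 2"
    using covering_space_lift_homotopy[OF covering_space_square_punctured_plane,
        of S "\<lambda>y. cross_ratio (k y)" w\<^sub>0] w0(1) by blast
  define w1 where "w1 = (\<lambda>x. l (1, x))"
  have "l y \<noteq> 1 \<and> l y \<noteq> - 1" if "y \<in> {0..1} \<times> S" for y
    using l(4)[OF that] cross_ratio_neq[OF funcset_mem[OF k(2) that]] by auto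
  then have homw: "homotopic_with_canon (\<lambda>_. True) S (- {0, 1, -1}) w\<^sub>0 w1"
    unfolding homotopic_with_canon_iff w1_def using l(1-3) by (intro exI[of _ l]) auto
  have w1: "continuous_on S w1"
    using homotopic_with_imp_continuous[OF homw] by blast
  have w1sq: "w1 x ^ 2 = cross_ratio (z1 x)" if "x \<in> S" for x
    using l(4)[of "(1, x)"] that by (simp add: w1_def z1_def)
  have "homotopic_with_canon (\<lambda>_. True) S (- {0}) w\<^sub>0 w1"
    by (rule homotopic_with_subset_right[OF homw]) simp
  from homotopic_punctured_plane_imp_exp[OF this] obtain DM where DM: "continuous_on S DM" "\<And>x. x \<in> S \<Longrightarrow> w1 x = w\<^sub>0 x * exp (DM x)"
    by blast
  have "homotopic_with_canon (\<lambda>_. True) S (- {0})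
      ((\<lambda>w. (w - 1) / (w + 1)) \<circ> w\<^sub>0) ((\<lambda>w. (w - 1) / (w + 1)) \<circ> w1)"
    by (rule homotopic_with_compose_continuous_left[OF homw])
      (auto intro!: continuous_intros simp: add_eq_0_iff2)
  from homotopic_punctured_plane_imp_exp[OF this] obtain DB where DB: "continuous_on S DB" "\<And>x. x \<in> S \<Longrightarrow>
       (w1 x - 1) / (w1 x + 1) = (w\<^sub>0 x - 1) / (w\<^sub>0 x + 1) * exp (DB x)"
    unfolding o_def by blast
  show ?thesis
    using that[OF z1 vz1 w1 w1sq DL DM DB] .
qed

section \<open>Oscillation of logarithms along connected sets\<close>

lemma exp_constant_imp_constant:
  fixes D :: "'a::topological_space \<Rightarrow> complex"
  assumes "connected C" "continuous_on C D" "\<And>x. x \<in> C \<Longrightarrow> exp (D x) = c" "x \<in> C" "y \<in> C"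
  shows "D x = D y"
proof -
  have "\<exists>e>0. \<forall>y. y \<in> C \<and> D y \<noteq> D x \<longrightarrow> e \<le> norm (D y - D x)" if "x \<in> C" for x
  \<comment> \<open>Logarithms of the same number differ by multiples of
    \<open>2 * pi * \<i>\<close>, so distinct values are at least \<open>2 * pi\<close>
    apart.\<close>
  proof (intro exI[of _ "2 * pi"] conjI allI impI)
    fix y assume y: "y \<in> C \<and> D y \<noteq> D x"
    then have "exp (D y) = exp (D x)" using assms(3) that by metis
    then obtain n :: int where n: "D y = D x + of_int (2 * n) * of_real pi * \<i>"
      by (auto simp: exp_eq)
    then have "n \<noteq> 0" using y by auto
    then have "1 \<le> \<bar>real_of_int n\<bar>" by linarith
    then have "2 * pi * 1 \<le> 2 * pi * \<bar>real_of_int n\<bar>"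
      by (intro mult_left_mono) auto
    then show "2 * pi \<le> norm (D y - D x)"
      by (simp add: n norm_mult)
  qed simp
  then have "D constant_on C"
    using continuous_discrete_range_constant assms(1,2) by blast
  then show ?thesis
    using assms(4,5) by (auto simp: constant_on_def)
qed

lemma Re_pos_imp_nonzero: "Re z > 0 \<Longrightarrow> z \<noteq> 0"
  by auto

lemma not_nonpos_Reals_if_Re_pos: "Re z > 0 \<Longrightarrow> z \<notin> \<real>\<^sub>\<le>\<^sub>0"
  by (simp add: complex_nonpos_Reals_iff)

lemma abs_Im_Ln_diff_le: "z \<noteq> 0 \<Longrightarrow> w \<noteq> 0 \<Longrightarrow> \<bar>Im (Ln z) - Im (Ln w)\<bar> \<le> 2 * pi"
  using mpi_less_Im_Ln[of z] mpi_less_Im_Ln[of w] Im_Ln_le_pi[of z] Im_Ln_le_pi[of w] by linarith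

text \<open>The principal logarithm of \<open>E\<close> is continuous since \<open>E\<close> stays
  in the right half plane, and \<open>D\<close> differs from it by a constant because
  \<open>k\<close> is fixed. Imaginary parts of \<open>Ln\<close> vary by at most
  \<open>2 * pi\<close>.\<close>

lemma Im_oscillation_le:
  fixes D :: "'a::topological_space \<Rightarrow> complex"
  assumes C: "connected C" and D: "continuous_on C D" and E: "continuous_on C E"
    and pos: "\<And>x. x \<in> C \<Longrightarrow> Re (E x) > 0"
    and exp: "\<And>x. x \<in> C \<Longrightarrow> exp (D x) = k * E x" and xy: "x \<in> C" "y \<in> C"
  shows "\<bar>Im (D x) - Im (D y)\<bar> \<le> 2 * pi"
proof -
  have nz: "E x \<noteq> 0" if "x \<in> C" for x using pos[OF that] by auto
  have "continuous_on C (\<lambda>x. D x - Ln (E x))"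
    by (intro continuous_intros D E not_nonpos_Reals_if_Re_pos pos)
  then have "D x - Ln (E x) = D y - Ln (E y)"
    using exp nz xy by (intro exp_constant_imp_constant[OF C, where c = k]) (auto simp: exp_diff)
  then have "D x - D y = Ln (E x) - Ln (E y)"
    by (simp add: algebra_simps)
  then have "Im (D x) - Im (D y) = Im (Ln (E x)) - Im (Ln (E y))"
    by (metis minus_complex.simps(2))
  then show ?thesis
    using abs_Im_Ln_diff_le nz xy by simp
qed

text \<open>The Cayley transform maps the unit disc to the right half plane; the next lemma is the
  analogue for the exterior.\<close>

lemma Re_moebius_pos:
  assumes "norm w < 1"
  shows "Re ((1 - w) / (1 + w)) > 0"
proof -
  have "(Re w)\<^sup>2 + (Im w)\<^sup>2 < 1"
    using assms power_strict_mono[of "norm w" 1 2] by (simp add: cmod_power2)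
  then show ?thesis
    unfolding Re_complex_div_gt_0 by (simp add: algebra_simps power2_eq_square)
qed

lemma Re_moebius_pos':
  assumes "norm w > 1"
  shows "Re ((w - 1) / (w + 1)) > 0"
proof -
  have "1 < (Re w)\<^sup>2 + (Im w)\<^sup>2"
    using assms power_strict_mono[of 1 "norm w" 2] by (simp add: cmod_power2)
  then show ?thesis
    unfolding Re_complex_div_gt_0 by (simp add: algebra_simps power2_eq_square)
qed

lemma abs_diff_le_of_sum:
  fixes g :: real
  assumes "\<bar>g\<bar> \<le> 2 * p" "\<bar>l\<bar> \<le> 2 * p" "\<bar>m\<bar> \<le> 2 * p" "g = 2 * n + 2 * l + 4 * m - 2 * t"
  shows "\<bar>n - t\<bar> \<le> 8 * p"
  using assms by linarith

text \<open>The three alternatives correspond to the label of the far point 5.\<close>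

lemma strands_oscillation:
  fixes z :: "'a::topological_space \<Rightarrow> complex \<times> complex \<times> complex"
    and L M N :: "'a \<Rightarrow> complex" and t :: "'a \<Rightarrow> real"
  assumes C: "connected C" and t: "continuous_on C t" and z: "continuous_on C z"
    and L: "continuous_on C L" and M: "continuous_on C M" and N: "continuous_on C N"
    and strands: "\<And>v. v \<in> C \<Longrightarrow>
      \<exists>g\<in>triple_perms. z v = g (exp (2 * pi * t v * \<i>), - exp (2 * pi * t v * \<i>), 5)"
    and expL: "\<And>v. v \<in> C \<Longrightarrow> exp (L v) = fst (snd (z v)) - fst (z v)"
    and expM: "\<And>v. v \<in> C \<Longrightarrow> exp (M v) ^ 2 = cross_ratio (z v)"
    and expN: "\<And>v. v \<in> C \<Longrightarrow> exp (N v) = (exp (M v) - 1) / (exp (M v) + 1)"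
    and vw: "v \<in> C" "w \<in> C"
  defines "\<Delta> \<equiv> \<lambda>F :: 'a \<Rightarrow> complex. Im (F v) - Im (F w)" and "\<tau> \<equiv> 2 * pi * (t v - t w)"
  shows "\<bar>\<Delta> L - \<tau>\<bar> \<le> 8 * pi \<and> \<bar>2 * \<Delta> M + \<Delta> L\<bar> \<le> 8 * pi \<and> \<bar>\<Delta> N\<bar> \<le> 8 * pi \<or>
         \<bar>\<Delta> L\<bar> \<le> 8 * pi \<and> \<bar>2 * \<Delta> M + \<Delta> L - \<tau>\<bar> \<le> 8 * pi \<and> \<bar>\<Delta> N\<bar> \<le> 8 * pi \<or>
         \<bar>\<Delta> L\<bar> \<le> 8 * pi \<and> \<bar>2 * \<Delta> M + \<Delta> L\<bar> \<le> 8 * pi \<and> \<bar>\<bar>\<Delta> N\<bar> - \<bar>\<tau>\<bar>\<bar> \<le> 8 * pi"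
proof -
  define a b c where "a = (\<lambda>v. fst (z v))" and "b = (\<lambda>v. fst (snd (z v)))" and "c = (\<lambda>v. snd (snd (z v)))"
  define r where "r = (\<lambda>v. exp (2 * pi * t v * \<i>))"
  have cont: "continuous_on C a" "continuous_on C b" "continuous_on C c"
    unfolding a_def b_def c_def by (intro continuous_intros z)+
  have abc: "(a x, b x, c x) \<in> {(r x, - r x, 5), (- r x, r x, 5), (r x, 5, - r x), (- r x, 5, r x),
      (5, r x, - r x), (5, - r x, r x)}" if "x \<in> C" for x
    using strands[OF that] by (auto simp: triple_perms_def a_def b_def c_def r_def)
  have r1: "norm (r x) = 1" for x
    by (simp add: r_def)
  have r0: "r x \<noteq> 0" for x using r1[of x] by auto
  \<comment> \<open>The near points are \<open>r x\<close> and \<open>- r x\<close> in unknown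
    order, so only squares are determined; every logarithm that follows their rotation is
    doubled.\<close>
  have re: "exp (2 * (D - 2 * pi * t x * \<i>)) = exp D ^ 2 / r x ^ 2" for D x
    by (simp only: exp_double exp_diff power_divide r_def)
  have E3: "exp (2 * M x + L x) = c x - a x" if "x \<in> C" for x
    using expM[OF that] expL[OF that] abc[OF that] r0[of x]
    by (auto simp: exp_add exp_double cross_ratio_def a_def b_def c_def split: prod.splits)
  have E1: "exp (L x) = b x - a x" if "x \<in> C" for x
    using expL[OF that] by (simp add: a_def b_def)
  have E2: "exp (M x) ^ 2 = (c x - a x) / (b x - a x)" if "x \<in> C" for x
    using expM[OF that] by (simp add: a_def b_def c_def cross_ratio_def case_prod_beta)
  have pos5: "Re (5 - u) > 0" if "norm u = 1" for u
    using complex_Re_le_cmod[of u] that by simp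
  \<comment> \<open>A continuous norm with values in \<open>{1, 5}\<close> is constant on a
    connected set, so the far point keeps its label on \<open>C\<close>.\<close>
  have const: "norm (f x) = norm (f y)"
    if f: "continuous_on C f" "\<And>x. x \<in> C \<Longrightarrow> norm (f x) \<in> {1, 5}" and xy: "x \<in> C" "y \<in> C"
    for f :: "'a \<Rightarrow> complex" and x y
  proof -
    have "(\<lambda>x. norm (f x)) ` C \<subseteq> {1, 5}" using f(2) by auto
    then have "finite ((\<lambda>x. norm (f x)) ` C)"
      using finite_subset by blast
    then have "(\<lambda>x. norm (f x)) constant_on C"
      using f(1) by (intro continuous_finite_range_constant[OF C] continuous_intros)
    then show ?thesis
      using xy by (auto simp: constant_on_def)
  qed
  have n15: "norm (a x) \<in> {1, 5}" "norm (b x) \<in> {1, 5}" "norm (c x) \<in> {1, 5}" if "x \<in> C" for x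
    using abc[OF that] r1[of x] by auto
  have ct: "continuous_on C (\<lambda>x. complex_of_real (t x))"
    by (intro continuous_intros t)
  consider "norm (c v) = 5" | "norm (b v) = 5" | "norm (a v) = 5"
    using abc[OF vw(1)] by auto
  then show ?thesis
  proof cases
    case 1
    then have n5: "norm (c x) = 5" if "x \<in> C" for x
      using const[OF cont(3) n15(3) that vw(1)] by simp
    then have far: "c x = 5" "b x = - a x" "a x ^ 2 = r x ^ 2" "norm (a x) = 1" if "x \<in> C" for x
      using n5[OF that] abc[OF that] r1[of x] by auto
    have "\<bar>Im (2 * (L v - 2 * pi * t v * \<i>)) - Im (2 * (L w - 2 * pi * t w * \<i>))\<bar> \<le> 2 * pi"
    proof (rule Im_oscillation_le[OF C _ _ _ _ vw])
      show "exp (2 * (L x - 2 * pi * t x * \<i>)) = 4 * 1" if "x \<in> C" for x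
        unfolding re using E1[OF that] far(2)[OF that] far(3)[OF that] r0[of x]
        by (simp add: power_mult_distrib)
    qed (auto intro!: continuous_intros L ct)
    then have "\<bar>\<Delta> L - \<tau>\<bar> \<le> 8 * pi"
      by (simp add: \<Delta>_def \<tau>_def algebra_simps)
    moreover have "\<bar>Im (2 * M v + L v) - Im (2 * M w + L w)\<bar> \<le> 2 * pi"
    proof (rule Im_oscillation_le[OF C _ _ _ _ vw])
      show "exp (2 * M x + L x) = 1 * (5 - a x)" if "x \<in> C" for x
        using E3[OF that] far[OF that] by simp
      show "Re (5 - a x) > 0" if "x \<in> C" for x
        using pos5 far(4)[OF that] by blast
    qed (intro continuous_intros L M cont)+
    then have "\<bar>2 * \<Delta> M + \<Delta> L\<bar> \<le> 8 * pi"
      by (simp add: \<Delta>_def algebra_simps)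
    moreover have "\<bar>Im (N v) - Im (N w)\<bar> \<le> 2 * pi"
    proof (rule Im_oscillation_le[OF C N _ _ _ vw])
      \<comment> \<open>The square is \<open>(5 - a x) / (- 2 * a x)\<close>, of norm at least 4 /
        2. Outside the unit disc the Moebius image \<open>exp (N x)\<close> has positive real
        part.\<close>
      have "norm (exp (M x)) > 1" if "x \<in> C" for x
      proof -
        have "norm (5 - a x) \<ge> 4"
          using norm_triangle_ineq2[of 5 "a x"] far[OF that] by simp
        then have "norm (exp (M x) ^ 2) > 1 ^ 2"
          using far[OF that] by (simp add: E2[OF that] norm_divide norm_mult)
        then show ?thesis
          unfolding norm_power by (rule power_less_imp_less_base) (rule norm_ge_zero)
      qed
      then show pos: "Re ((exp (M x) - 1) / (exp (M x) + 1)) > 0" if "x \<in> C" for x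
        using that Re_moebius_pos' by blast
      show "exp (N x) = 1 * ((exp (M x) - 1) / (exp (M x) + 1))" if "x \<in> C" for x
        using expN[OF that] by simp
      have "exp (M x) + 1 \<noteq> 0" if "x \<in> C" for x
        using pos[OF that] by (metis div_by_0 less_irrefl zero_complex.simps(1))
      then show "continuous_on C (\<lambda>x. (exp (M x) - 1) / (exp (M x) + 1))"
        by (intro continuous_intros M) auto
    qed
    then have "\<bar>\<Delta> N\<bar> \<le> 8 * pi"
      by (simp add: \<Delta>_def)
    ultimately show ?thesis by blast
  next
    case 2
    then have n5: "norm (b x) = 5" if "x \<in> C" for x
      using const[OF cont(2) n15(2) that vw(1)] by simp
    then have far: "b x = 5" "c x = - a x" "a x ^ 2 = r x ^ 2" "norm (a x) = 1" if "x \<in> C" for x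
      using n5[OF that] abc[OF that] r1[of x] by auto
    have "\<bar>Im (L v) - Im (L w)\<bar> \<le> 2 * pi"
    proof (rule Im_oscillation_le[OF C L _ _ _ vw])
      show "exp (L x) = 1 * (5 - a x)" if "x \<in> C" for x
        using E1[OF that] far[OF that] by simp
      show "Re (5 - a x) > 0" if "x \<in> C" for x
        using pos5 far(4)[OF that] by blast
    qed (intro continuous_intros cont)+
    then have "\<bar>\<Delta> L\<bar> \<le> 8 * pi"
      by (simp add: \<Delta>_def)
    moreover have "\<bar>Im (2 * (2 * M v + L v - 2 * pi * t v * \<i>)) -
        Im (2 * (2 * M w + L w - 2 * pi * t w * \<i>))\<bar> \<le> 2 * pi"
    proof (rule Im_oscillation_le[OF C _ _ _ _ vw])
      show "exp (2 * (2 * M x + L x - 2 * pi * t x * \<i>)) = 4 * 1" if "x \<in> C" for x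
        unfolding re using E3[OF that] far(2)[OF that] far(3)[OF that] r0[of x]
        by (simp add: power_mult_distrib)
    qed (auto intro!: continuous_intros L M ct)
    then have "\<bar>2 * \<Delta> M + \<Delta> L - \<tau>\<bar> \<le> 8 * pi"
      by (simp add: \<Delta>_def \<tau>_def algebra_simps)
    moreover have "\<bar>Im (N v) - Im (N w)\<bar> \<le> 2 * pi"
    proof (rule Im_oscillation_le[OF C N _ _ _ vw])
      \<comment> \<open>The square is \<open>- 2 * a x / (5 - a x)\<close>, of norm at most 2 /
        4.\<close>
      have "norm (exp (M x)) < 1" if "x \<in> C" for x
      proof -
        have "norm (5 - a x) \<ge> 4"
          using norm_triangle_ineq2[of 5 "a x"] far[OF that] by simp
        then have "norm (exp (M x) ^ 2) < 1 ^ 2"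
          using far[OF that] by (simp add: E2[OF that] norm_divide norm_mult divide_less_eq)
        then show ?thesis
          unfolding norm_power by (rule power_less_imp_less_base) simp
      qed
      then show pos: "Re ((1 - exp (M x)) / (1 + exp (M x))) > 0" if "x \<in> C" for x
        using that Re_moebius_pos by blast
      show "exp (N x) = - 1 * ((1 - exp (M x)) / (1 + exp (M x)))" if "x \<in> C" for x
        using expN[OF that] by (simp add: add.commute minus_divide_left)
      have "1 + exp (M x) \<noteq> 0" if "x \<in> C" for x
        using pos[OF that] by (metis div_by_0 less_irrefl zero_complex.simps(1))
      then show "continuous_on C (\<lambda>x. (1 - exp (M x)) / (1 + exp (M x)))"
        by (intro continuous_intros M) auto
    qed
    then have "\<bar>\<Delta> N\<bar> \<le> 8 * pi"
      by (simp add: \<Delta>_def)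
    ultimately show ?thesis by blast
  next
    case 3
    then have n5: "norm (a x) = 5" if "x \<in> C" for x
      using const[OF cont(1) n15(1) that vw(1)] by simp
    then have far: "a x = 5" "c x = - b x" "b x ^ 2 = r x ^ 2" "norm (b x) = 1" if "x \<in> C" for x
      using n5[OF that] abc[OF that] r1[of x] by auto
    have pos_b: "Re (5 - b x) > 0" "Re (5 + b x) > 0" if "x \<in> C" for x
      using pos5[of "b x"] pos5[of "- b x"] far[OF that] by auto
    have "\<bar>Im (L v) - Im (L w)\<bar> \<le> 2 * pi"
    proof (rule Im_oscillation_le[OF C L _ _ _ vw])
      show "exp (L x) = - 1 * (5 - b x)" if "x \<in> C" for x
        using E1[OF that] far[OF that] by simp
    qed (intro continuous_intros cont pos_b; assumption)+
    then have dL: "\<bar>\<Delta> L\<bar> \<le> 8 * pi"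
      by (simp add: \<Delta>_def)
    have "\<bar>Im (2 * M v + L v) - Im (2 * M w + L w)\<bar> \<le> 2 * pi"
    proof (rule Im_oscillation_le[OF C _ _ _ _ vw])
      show "exp (2 * M x + L x) = - 1 * (5 + b x)" if "x \<in> C" for x
        using E3[OF that] far[OF that] by simp
    qed (intro continuous_intros L M cont pos_b; assumption)+
    then have dM: "\<bar>2 * \<Delta> M + \<Delta> L\<bar> \<le> 8 * pi"
      by (simp add: \<Delta>_def algebra_simps)
    have nz: "5 - b x \<noteq> 0" if "x \<in> C" for x
      using pos_b[OF that] by force
    have sq: "exp (M x) ^ 2 = (5 + b x) / (5 - b x)" if "x \<in> C" for x
    proof -
      have "- b x - 5 = - (5 + b x)" "b x - 5 = - (5 - b x)" by simp_all
      then show ?thesis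
        unfolding E2[OF that] far(1,2)[OF that] by (simp only: minus_divide_divide)
    qed
    have sq1: "(exp (M x) - 1) * (exp (M x) + 1) = 2 * b x / (5 - b x)" if "x \<in> C" for x
    proof -
      have "(exp (M x) - 1) * (exp (M x) + 1) = exp (M x) ^ 2 - 1"
        by (simp add: algebra_simps power2_eq_square)
      then show ?thesis
        using nz[OF that] by (simp add: sq[OF that] field_simps)
    qed
    \<comment> \<open>For \<open>b x\<close> on the unit circle \<open>(5 + b x) / (5 - b x)\<close>
      has positive real part. So its square root never meets the imaginary axis and stays on one
      side of it along \<open>C\<close>.\<close>
    have "Re (exp (M x) ^ 2) > 0" if "x \<in> C" for x
    proof -
      have "(Re (b x))\<^sup>2 + (Im (b x))\<^sup>2 = 1"
        using far(4)[OF that] cmod_power2[of "b x"] by simp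
      then show ?thesis
        unfolding sq[OF that] Re_complex_div_gt_0 by (simp add: algebra_simps power2_eq_square)
    qed
    then have Re0: "Re (exp (M x)) \<noteq> 0" if "x \<in> C" for x
      using that by (fastforce simp: power2_eq_square)
    have contM: "continuous_on C (\<lambda>x. Re (exp (M x)))"
      by (intro continuous_intros M)
    consider "\<And>x. x \<in> C \<Longrightarrow> Re (exp (M x)) > 0" | "\<And>x. x \<in> C \<Longrightarrow> Re (exp (M x)) < 0"
    proof -
      have "connected ((\<lambda>x. Re (exp (M x))) ` C)"
        using C contM connected_continuous_image by blast
      moreover have "0 \<notin> (\<lambda>x. Re (exp (M x))) ` C"
        using Re0 by force
      ultimately have "(\<forall>y\<in>(\<lambda>x. Re (exp (M x))) ` C. y > 0) \<or> (\<forall>y\<in>(\<lambda>x. Re (exp (M x))) ` C. y < 0)"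
        by (meson connectedD_interval not_le)
      then show ?thesis using that by blast
    qed
    then show ?thesis
    proof cases
      case 1
      \<comment> \<open>On this side only \<open>exp (M x) - 1\<close> can wind around 0.
        Multiplying \<open>exp (N x)\<close> by \<open>5 - b x\<close> and
        \<open>(exp (M x) + 1)^2\<close> leaves \<open>2 * b x\<close>, whose square is
        \<open>4 * r x ^ 2\<close>; the additional logarithms have bounded imaginary part.\<close>
      define G where "G = (\<lambda>x. 2 * (N x + Ln (5 - b x) + 2 * Ln (exp (M x) + 1) - 2 * pi * t x * \<i>))"
      have p1: "Re (exp (M x) + 1) > 0" if "x \<in> C" for x using 1[OF that] by simp
      then have nz1: "exp (M x) + 1 \<noteq> 0" if "x \<in> C" for x
        using that Re_pos_imp_nonzero by blast
      have "\<bar>Im (G v) - Im (G w)\<bar> \<le> 2 * pi"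
      proof (rule Im_oscillation_le[OF C _ _ _ _ vw])
        show "exp (G x) = 4 * 1" if "x \<in> C" for x
        proof -
          have "exp (N x + Ln (5 - b x) + 2 * Ln (exp (M x) + 1)) =
              (exp (M x) - 1) / (exp (M x) + 1) * (5 - b x) * (exp (M x) + 1) ^ 2"
            using nz[OF that] nz1[OF that] expN[OF that] by (simp add: exp_add exp_double)
          also have "\<dots> = ((exp (M x) - 1) * (exp (M x) + 1)) * (5 - b x)"
            using nz1[OF that] by (simp add: power2_eq_square)
          also have "\<dots> = 2 * b x"
            using nz[OF that] by (simp add: sq1[OF that])
          finally show ?thesis
            unfolding G_def re using far(3)[OF that] r0[of x] by (simp add: power_mult_distrib)
        qed
        show "continuous_on C G"
          unfolding G_def using p1 pos_b
          by (intro continuous_intros N cont M ct t not_nonpos_Reals_if_Re_pos) auto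
      qed auto
      moreover have "\<bar>Im (Ln (5 - b v)) - Im (Ln (5 - b w))\<bar> \<le> 2 * pi"
        "\<bar>Im (Ln (exp (M v) + 1)) - Im (Ln (exp (M w) + 1))\<bar> \<le> 2 * pi"
        using abs_Im_Ln_diff_le nz nz1 vw by blast+
      moreover have "Im (G v) - Im (G w) = 2 * \<Delta> N + 2 * (Im (Ln (5 - b v)) - Im (Ln (5 - b w))) +
          4 * (Im (Ln (exp (M v) + 1)) - Im (Ln (exp (M w) + 1))) - 2 * \<tau>"
        by (simp add: G_def \<Delta>_def \<tau>_def algebra_simps)
      ultimately have "\<bar>\<Delta> N - \<tau>\<bar> \<le> 8 * pi"
        by (rule abs_diff_le_of_sum)
      then have "\<bar>\<bar>\<Delta> N\<bar> - \<bar>\<tau>\<bar>\<bar> \<le> 8 * pi"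
        using abs_triangle_ineq3[of "\<Delta> N" "\<tau>"] by simp
      then show ?thesis using dL dM by blast
    next
      case 2
      \<comment> \<open>Now \<open>exp (M x) + 1\<close> winds instead, so \<open>N\<close> turns
        the other way; hence the absolute values in the third alternative.\<close>
      define G where "G = (\<lambda>x. 2 * (- N x + Ln (5 - b x) + 2 * Ln (1 - exp (M x)) - 2 * pi * t x * \<i>))"
      have p1: "Re (1 - exp (M x)) > 0" if "x \<in> C" for x using 2[OF that] by simp
      then have nz1: "1 - exp (M x) \<noteq> 0" if "x \<in> C" for x
        using that Re_pos_imp_nonzero by blast
      have "\<bar>Im (G v) - Im (G w)\<bar> \<le> 2 * pi"
      proof (rule Im_oscillation_le[OF C _ _ _ _ vw])
        show "exp (G x) = 4 * 1" if "x \<in> C" for x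
        proof -
          have "exp (- N x + Ln (5 - b x) + 2 * Ln (1 - exp (M x))) =
              (exp (M x) + 1) / (exp (M x) - 1) * (5 - b x) * (exp (M x) - 1) ^ 2"
            using nz[OF that] nz1[OF that] expN[OF that]
            by (simp add: exp_add exp_diff exp_double exp_minus power2_commute)
          also have "\<dots> = ((exp (M x) - 1) * (exp (M x) + 1)) * (5 - b x)"
            using nz1[OF that] by (simp add: power2_eq_square)
          also have "\<dots> = 2 * b x"
            using nz[OF that] by (simp add: sq1[OF that])
          finally show ?thesis
            unfolding G_def re using far(3)[OF that] r0[of x] by (simp add: power_mult_distrib)
        qed
        show "continuous_on C G"
          unfolding G_def using p1 pos_b
          by (intro continuous_intros N cont M ct t not_nonpos_Reals_if_Re_pos) auto
      qed auto
      moreover have "\<bar>Im (Ln (5 - b v)) - Im (Ln (5 - b w))\<bar> \<le> 2 * pi"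
        "\<bar>Im (Ln (1 - exp (M v))) - Im (Ln (1 - exp (M w)))\<bar> \<le> 2 * pi"
        using abs_Im_Ln_diff_le nz nz1 vw by blast+
      moreover have "Im (G v) - Im (G w) = 2 * (- \<Delta> N) + 2 * (Im (Ln (5 - b v)) - Im (Ln (5 - b w))) +
          4 * (Im (Ln (1 - exp (M v))) - Im (Ln (1 - exp (M w)))) - 2 * \<tau>"
        by (simp add: G_def \<Delta>_def \<tau>_def algebra_simps)
      ultimately have "\<bar>- \<Delta> N - \<tau>\<bar> \<le> 8 * pi"
        by (rule abs_diff_le_of_sum)
      then have "\<bar>\<bar>\<Delta> N\<bar> - \<bar>\<tau>\<bar>\<bar> \<le> 8 * pi"
        using abs_triangle_ineq3[of "- \<Delta> N" "\<tau>"] by simp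
      then show ?thesis using dL dM by blast
    qed
  qed
qed

section \<open>The test torus\<close>

definition torus3 :: "(complex \<times> complex \<times> complex) set" where
  "torus3 = sphere 0 1 \<times> sphere 0 1 \<times> sphere 0 1"

definition torus_exp :: "real^3 \<Rightarrow> complex \<times> complex \<times> complex" where
  "torus_exp v = (exp (2 * pi * v $ 1 * \<i>), exp (2 * pi * v $ 2 * \<i>), exp (2 * pi * v $ 3 * \<i>))"

text \<open>
  In \<open>strands_A\<close> the square root \<open>w = 1/2 + \<beta>\<close> of the cross ratio runs round a circle that encloses
  \<open>0\<close> and \<open>1\<close> but not \<open>- 1\<close>, so that \<open>w\<close> and \<open>(w - 1) / (w + 1)\<close> both have winding number 1.
\<close>

definition strands_A :: "complex \<times> complex \<times> complex \<Rightarrow> complex \<times> complex \<times> complex" where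
  "strands_A = (\<lambda>(\<alpha>, \<beta>, \<gamma>). (0, \<alpha>, \<alpha> * (1/2 + \<beta>) ^ 2))"

text \<open>The point 5 has distance at least 4 from the unit circle, while the twisting points are
  2 apart. This keeps the norm of the cross ratio away from 1 when 5 is the second or third
  point.\<close>

definition strands_B :: "complex \<times> complex \<times> complex \<Rightarrow> complex \<times> complex \<times> complex" where
  "strands_B = (\<lambda>(\<alpha>, \<beta>, \<gamma>). (\<gamma>, - \<gamma>, 5))"

lemma half_plus_neq:
  fixes \<beta> :: complex
  assumes "norm \<beta> = 1"
  shows "1/2 + \<beta> \<noteq> 0" "1/2 + \<beta> \<noteq> 1" "1/2 + \<beta> \<noteq> - 1"
proof -
  have "norm \<beta> \<noteq> norm (- (1/2) :: complex)" "norm \<beta> \<noteq> norm (1/2 :: complex)"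
    "norm \<beta> \<noteq> norm (- (3/2) :: complex)"
    unfolding assms norm_minus_cancel norm_divide by simp_all
  then have "\<beta> \<noteq> - (1/2)" "\<beta> \<noteq> 1/2" "\<beta> \<noteq> - (3/2)"
    by blast+
  then show "1/2 + \<beta> \<noteq> 0" "1/2 + \<beta> \<noteq> 1" "1/2 + \<beta> \<noteq> - 1"
    unfolding add.commute[of "1/2" \<beta>] eq_diff_eq[symmetric] by simp_all
qed

lemma strands_A_in: "x \<in> torus3 \<Longrightarrow> strands_A x \<in> distinct_triples"
proof (cases x)
  case (fields \<alpha> \<beta> \<gamma>)
  assume "x \<in> torus3"
  then have ab: "\<alpha> \<noteq> 0" "norm \<beta> = 1" by (auto simp: torus3_def fields)
  have "(1/2 + \<beta>) ^ 2 \<noteq> 1"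
    using half_plus_neq[OF ab(2)] power2_eq_1_iff by blast
  then show ?thesis
    using ab half_plus_neq[OF ab(2)] by (simp add: strands_A_def distinct_triples_def fields)
qed

lemma strands_B_in: "x \<in> torus3 \<Longrightarrow> strands_B x \<in> distinct_triples"
proof (cases x)
  case (fields \<alpha> \<beta> \<gamma>)
  assume "x \<in> torus3"
  then have "norm \<gamma> = 1" by (simp add: torus3_def fields)
  then have "\<gamma> \<noteq> 0" "\<gamma> \<noteq> 5" "- \<gamma> \<noteq> 5"
    using norm_minus_cancel[of \<gamma>] by force+
  then show ?thesis
    by (simp add: strands_B_def distinct_triples_def fields)
qed

lemma continuous_on_strands: "continuous_on S strands_A" "continuous_on S strands_B"
  unfolding strands_A_def strands_B_def case_prod_beta by (intro continuous_intros)+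

lemma torus_exp_in: "torus_exp v \<in> torus3"
  by (simp add: torus_exp_def torus3_def)

lemma continuous_on_torus_exp: "continuous_on S torus_exp"
  unfolding torus_exp_def by (intro continuous_intros)

text \<open>Quantitative form of the independence of the winding numbers: up to \<open>e\<close>,
  \<open>l\<close> is \<open>x\<close> while \<open>m\<close> and \<open>n\<close> are both
  \<open>y\<close>. Each alternative bounds two of \<open>l\<close>, \<open>2 * m + l\<close>,
  \<open>n\<close>; these bound \<open>x\<close> and \<open>y\<close>, and the remaining one then
  bounds \<open>t\<close>.\<close>

lemma oscillation_bounds:
  fixes l m n x y t p e :: real
  assumes lmn: "\<bar>l - x\<bar> \<le> e" "\<bar>m - y\<bar> \<le> e" "\<bar>n - y\<bar> \<le> e"
    and cases: "\<bar>l - t\<bar> \<le> p \<and> \<bar>2 * m + l\<bar> \<le> p \<and> \<bar>n\<bar> \<le> p \<or>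
           \<bar>l\<bar> \<le> p \<and> \<bar>2 * m + l - t\<bar> \<le> p \<and> \<bar>n\<bar> \<le> p \<or>
           \<bar>l\<bar> \<le> p \<and> \<bar>2 * m + l\<bar> \<le> p \<and> \<bar>\<bar>n\<bar> - \<bar>t\<bar>\<bar> \<le> p"
    and pe: "p \<le> e"
  shows "\<bar>x\<bar> \<le> 8 * e \<and> \<bar>y\<bar> \<le> 8 * e \<and> \<bar>t\<bar> \<le> 8 * e"
  using cases
proof (elim disjE conjE)
  assume *: "\<bar>l - t\<bar> \<le> p" "\<bar>2 * m + l\<bar> \<le> p" "\<bar>n\<bar> \<le> p"
  have y: "\<bar>y\<bar> \<le> 2 * e" using *(3) pe lmn(3) by linarith
  have m: "\<bar>m\<bar> \<le> 3 * e" using y lmn(2) by linarith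
  have l: "\<bar>l\<bar> \<le> 7 * e" using m *(2) pe by linarith
  have x: "\<bar>x\<bar> \<le> 8 * e" using l lmn(1) by linarith
  have t: "\<bar>t\<bar> \<le> 8 * e" using l *(1) pe by linarith
  show ?thesis using x y t by linarith
next
  assume *: "\<bar>l\<bar> \<le> p" "\<bar>2 * m + l - t\<bar> \<le> p" "\<bar>n\<bar> \<le> p"
  have y: "\<bar>y\<bar> \<le> 2 * e" using *(3) pe lmn(3) by linarith
  have m: "\<bar>m\<bar> \<le> 3 * e" using y lmn(2) by linarith
  have x: "\<bar>x\<bar> \<le> 2 * e" using *(1) pe lmn(1) by linarith
  have t: "\<bar>t\<bar> \<le> 8 * e" using m *(1,2) pe by linarith
  show ?thesis using x y t by linarith
next
  assume *: "\<bar>l\<bar> \<le> p" "\<bar>2 * m + l\<bar> \<le> p" "\<bar>\<bar>n\<bar> - \<bar>t\<bar>\<bar> \<le> p"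
  have m: "\<bar>m\<bar> \<le> e" using *(1,2) pe by linarith
  have y: "\<bar>y\<bar> \<le> 2 * e" using m lmn(2) by linarith
  have n: "\<bar>n\<bar> \<le> 3 * e" using y lmn(3) by linarith
  have x: "\<bar>x\<bar> \<le> 2 * e" using *(1) pe lmn(1) by linarith
  have t: "\<bar>t\<bar> \<le> 4 * e" using n *(3) pe by linarith
  show ?thesis using x y t by linarith
qed

text \<open>On \<open>real^3\<close> the logarithms at the end of the homotopy have two
  descriptions: those of \<open>strands_A\<close>, linear in the first two coordinates up to bounded
  terms, with corrections that are bounded on the compact \<open>K\<close>; and those of a
  relabelled \<open>strands_B\<close>, governed by the third coordinate. Comparing them bounds all
  coordinates.\<close>

lemma torus_section_oscillation:
  assumes hom: "homotopic_with_canon (\<lambda>_. True) W separable_cubics (vieta \<circ> strands_A) (vieta \<circ> strands_B)"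
    and W: "W \<subseteq> torus3" and K: "compact K" "K \<subseteq> W"
  obtains R where "\<And>C v w j. connected C \<Longrightarrow> torus_exp ` C \<subseteq> K \<Longrightarrow> v \<in> C \<Longrightarrow> w \<in> C \<Longrightarrow>
      \<bar>v $ j - w $ j\<bar> \<le> R"
proof -
  define w0 :: "complex \<times> complex \<times> complex \<Rightarrow> complex" where "w0 = (\<lambda>x. 1/2 + fst (snd x))"
  have w0: "continuous_on W w0"
    unfolding w0_def by (intro continuous_intros)
  have w0sq: "w0 x ^ 2 = cross_ratio (strands_A x)" if "x \<in> W" for x
    using that W by (cases x) (auto simp: w0_def cross_ratio_def strands_A_def torus3_def)
  have A: "strands_A \<in> W \<rightarrow> distinct_triples"
    using W strands_A_in by auto
  obtain z1 w1 DL DM DB where z1: "continuous_on W z1" "z1 \<in> W \<rightarrow> distinct_triples"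
      "\<And>x. x \<in> W \<Longrightarrow> vieta (z1 x) = (vieta \<circ> strands_B) x"
    and w1: "continuous_on W w1" "\<And>x. x \<in> W \<Longrightarrow> w1 x ^ 2 = cross_ratio (z1 x)"
    and DL: "continuous_on W DL" "\<And>x. x \<in> W \<Longrightarrow>
       fst (snd (z1 x)) - fst (z1 x) = (fst (snd (strands_A x)) - fst (strands_A x)) * exp (DL x)"
    and DM: "continuous_on W DM" "\<And>x. x \<in> W \<Longrightarrow> w1 x = w0 x * exp (DM x)"
    and DB: "continuous_on W DB" "\<And>x. x \<in> W \<Longrightarrow>
       (w1 x - 1) / (w1 x + 1) = (w0 x - 1) / (w0 x + 1) * exp (DB x)"
    by (rule config_homotopy_logarithms[OF hom continuous_on_strands(1) A w0 w0sq], assumption, rule that)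
  have bdd: "\<exists>B. \<forall>x\<in>K. norm (D x) \<le> B" if "continuous_on W D" for D :: "complex \<times> complex \<times> complex \<Rightarrow> complex"
    using compact_imp_bounded[OF compact_continuous_image[OF continuous_on_subset[OF that K(2)] K(1)]]
    by (auto simp: bounded_iff)
  obtain BL BM BB where B: "\<And>x. x \<in> K \<Longrightarrow> norm (DL x) \<le> BL" "\<And>x. x \<in> K \<Longrightarrow> norm (DM x) \<le> BM"
      "\<And>x. x \<in> K \<Longrightarrow> norm (DB x) \<le> BB"
    using bdd[OF DL(1)] bdd[OF DM(1)] bdd[OF DB(1)] by blast
  have B0: "0 \<le> BL \<and> 0 \<le> BM \<and> 0 \<le> BB" if "x \<in> K" for x
    using B[OF that] norm_ge_zero order_trans by blast
  \<comment> \<open>Two values of each correction enter, and up to two principal logarithms varying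
    by \<open>2 * pi\<close> each; \<open>8 * pi\<close> also dominates the bound for the other
    description. The \<open>max 0\<close> takes care of an empty \<open>K\<close>.\<close>
  define e where "e = 2 * max 0 BL + 2 * max 0 BM + 2 * max 0 BB + 8 * pi"
  define \<beta> where "\<beta> = (\<lambda>v :: real^3. exp (2 * pi * v $ 2 * \<i>))"
  have \<beta>1: "norm (\<beta> v) = 1" for v by (simp add: \<beta>_def)
  then have \<beta>0: "\<beta> v \<noteq> 0" for v by (metis norm_zero zero_neq_one)
  have c\<beta>: "continuous_on C \<beta>" for C
    unfolding \<beta>_def by (intro continuous_intros)
  \<comment> \<open>Explicit logarithms for \<open>strands_A\<close>, from
    \<open>1/2 + \<beta> = \<beta> * (1 + 1 / (2 * \<beta>))\<close> and
    \<open>\<beta> - 1/2 = \<beta> * (1 - 1 / (2 * \<beta>))\<close>. All factors other than the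
    rotating exponentials lie in the right half plane, so \<open>Ln\<close> of them is
    continuous.\<close>
  define L M N where "L = (\<lambda>v :: real^3. 2 * pi * v $ 1 * \<i> + DL (torus_exp v))"
    and "M = (\<lambda>v :: real^3. 2 * pi * v $ 2 * \<i> + Ln (1 + 1 / (2 * \<beta> v)) + DM (torus_exp v))"
    and "N = (\<lambda>v :: real^3. 2 * pi * v $ 2 * \<i> + (Ln (1 - 1 / (2 * \<beta> v)) - Ln (3/2 + \<beta> v)) + DB (torus_exp v))"
  have pos: "Re (1 + 1 / (2 * \<beta> v)) > 0" "Re (1 - 1 / (2 * \<beta> v)) > 0" "Re (3/2 + \<beta> v) > 0" for v
  proof -
    have "norm (1 / (2 * \<beta> v)) = 1/2"
      by (simp add: norm_divide norm_mult \<beta>1)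
    then show "Re (1 + 1 / (2 * \<beta> v)) > 0" "Re (1 - 1 / (2 * \<beta> v)) > 0"
      using abs_Re_le_cmod[of "1 / (2 * \<beta> v)"] unfolding plus_complex.simps minus_complex.simps one_complex.simps
      by linarith+
    show "Re (3/2 + \<beta> v) > 0"
      using abs_Re_le_cmod[of "\<beta> v"] \<beta>1[of v] by simp
  qed
  note nz = pos[THEN Re_pos_imp_nonzero]
  have \<beta>_exp: "exp (2 * pi * v $ 2 * \<i>) = \<beta> v" "w0 (torus_exp v) = 1/2 + \<beta> v" for v
    by (simp_all add: \<beta>_def w0_def torus_exp_def)
  have expL: "exp (L v) = fst (snd (z1 (torus_exp v))) - fst (z1 (torus_exp v))" if "torus_exp v \<in> W" for v
    unfolding DL(2)[OF that] by (simp add: L_def exp_add torus_exp_def strands_A_def)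
  have expM: "exp (M v) = w1 (torus_exp v)" if "torus_exp v \<in> W" for v
    unfolding DM(2)[OF that] M_def exp_add \<beta>_exp using nz(1)[of v] \<beta>0[of v] by (simp add: field_simps)
  have expN: "exp (N v) = (w1 (torus_exp v) - 1) / (w1 (torus_exp v) + 1)" if "torus_exp v \<in> W" for v
  proof -
    have "exp (N v) = \<beta> v * ((1 - 1 / (2 * \<beta> v)) / (3/2 + \<beta> v)) * exp (DB (torus_exp v))"
      unfolding N_def exp_add exp_diff \<beta>_exp using nz(2,3)[of v] by simp
    also have "\<beta> v * ((1 - 1 / (2 * \<beta> v)) / (3/2 + \<beta> v)) = (\<beta> v - 1/2) / (3/2 + \<beta> v)"
    proof -
      have "\<beta> v * (1 - 1 / (2 * \<beta> v)) = \<beta> v - 1/2"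
        using \<beta>0[of v] by (simp add: right_diff_distrib)
      then show ?thesis by (simp only: times_divide_eq_right)
    qed
    also have "\<dots> = (w0 (torus_exp v) - 1) / (w0 (torus_exp v) + 1)"
      unfolding \<beta>_exp by (simp add: algebra_simps)
    finally show ?thesis
      unfolding DB(2)[OF that] .
  qed
  have "\<bar>v $ j - w $ j\<bar> \<le> 8 * e"
    if C: "connected C" and CK: "torus_exp ` C \<subseteq> K" and vw: "v \<in> C" "w \<in> C" for C v w j
  proof -
    have CW: "torus_exp ` C \<subseteq> W" using CK K by blast
    have comp: "continuous_on C (\<lambda>v. D (torus_exp v))" if "continuous_on W D"
      for D :: "complex \<times> complex \<times> complex \<Rightarrow> 'z::topological_space"
      using continuous_on_compose2[OF that continuous_on_torus_exp CW] .
    have contL: "continuous_on C L"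
      unfolding L_def by (intro continuous_intros comp DL)
    have contM: "continuous_on C M"
      unfolding M_def by (intro continuous_intros comp DM c\<beta> not_nonpos_Reals_if_Re_pos pos) (simp add: \<beta>0)
    have contN: "continuous_on C N"
      unfolding N_def by (intro continuous_intros comp DB c\<beta> not_nonpos_Reals_if_Re_pos pos) (simp add: \<beta>0)
    have strands: "\<exists>g\<in>triple_perms. z1 (torus_exp v) =
        g (exp (2 * pi * v $ 3 * \<i>), - exp (2 * pi * v $ 3 * \<i>), 5)" if "v \<in> C" for v
    proof -
      have W: "torus_exp v \<in> W" using CW that by blast
      then have "vieta (strands_B (torus_exp v)) = vieta (z1 (torus_exp v))"
        using z1(3) by simp
      then show ?thesis
        using vieta_eq_iff[OF strands_B_in[OF torus_exp_in] funcset_mem[OF z1(2) W], of v]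
        by (simp add: strands_B_def torus_exp_def)
    qed
    have osc: "\<bar>(Im (L v) - Im (L w)) - 2 * pi * (v $ 1 - w $ 1)\<bar> \<le> e"
      "\<bar>(Im (M v) - Im (M w)) - 2 * pi * (v $ 2 - w $ 2)\<bar> \<le> e"
      "\<bar>(Im (N v) - Im (N w)) - 2 * pi * (v $ 2 - w $ 2)\<bar> \<le> e"
    proof -
      have inK: "torus_exp v \<in> K" "torus_exp w \<in> K" using CK vw by auto
      have D: "\<bar>Im (DL (torus_exp v))\<bar> \<le> BL" "\<bar>Im (DL (torus_exp w))\<bar> \<le> BL"
          "\<bar>Im (DM (torus_exp v))\<bar> \<le> BM" "\<bar>Im (DM (torus_exp w))\<bar> \<le> BM"
          "\<bar>Im (DB (torus_exp v))\<bar> \<le> BB" "\<bar>Im (DB (torus_exp w))\<bar> \<le> BB"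
        using B inK abs_Im_le_cmod order_trans by blast+
      have e: "e = 2 * BL + 2 * BM + 2 * BB + 8 * pi" and B': "0 \<le> BL" "0 \<le> BM" "0 \<le> BB"
        using B0[OF inK(1)] by (auto simp: e_def)
      have Ln: "\<bar>Im (Ln (1 + 1 / (2 * \<beta> v))) - Im (Ln (1 + 1 / (2 * \<beta> w)))\<bar> \<le> 2 * pi"
        "\<bar>Im (Ln (1 - 1 / (2 * \<beta> v))) - Im (Ln (1 - 1 / (2 * \<beta> w)))\<bar> \<le> 2 * pi"
        "\<bar>Im (Ln (3/2 + \<beta> v)) - Im (Ln (3/2 + \<beta> w))\<bar> \<le> 2 * pi"
        using abs_Im_Ln_diff_le nz by blast+
      have "Im (L v) - Im (L w) - 2 * pi * (v $ 1 - w $ 1) =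
          Im (DL (torus_exp v)) - Im (DL (torus_exp w))"
        by (simp add: L_def algebra_simps)
      then show "\<bar>(Im (L v) - Im (L w)) - 2 * pi * (v $ 1 - w $ 1)\<bar> \<le> e"
        using D(1,2) B' pi_ge_zero unfolding e by linarith
      have "Im (M v) - Im (M w) - 2 * pi * (v $ 2 - w $ 2) =
          (Im (Ln (1 + 1 / (2 * \<beta> v))) - Im (Ln (1 + 1 / (2 * \<beta> w)))) +
          (Im (DM (torus_exp v)) - Im (DM (torus_exp w)))"
        by (simp add: M_def algebra_simps)
      then show "\<bar>(Im (M v) - Im (M w)) - 2 * pi * (v $ 2 - w $ 2)\<bar> \<le> e"
        using D(3,4) Ln(1) B' pi_ge_zero unfolding e by linarith
      have "Im (N v) - Im (N w) - 2 * pi * (v $ 2 - w $ 2) =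
          (Im (Ln (1 - 1 / (2 * \<beta> v))) - Im (Ln (1 - 1 / (2 * \<beta> w)))) -
          (Im (Ln (3/2 + \<beta> v)) - Im (Ln (3/2 + \<beta> w))) +
          (Im (DB (torus_exp v)) - Im (DB (torus_exp w)))"
        by (simp add: N_def algebra_simps)
      then show "\<bar>(Im (N v) - Im (N w)) - 2 * pi * (v $ 2 - w $ 2)\<bar> \<le> e"
        using D(5,6) Ln(2,3) B' pi_ge_zero unfolding e by linarith
    qed
    have e8: "8 * pi \<le> e"
      by (simp add: e_def)
    have "continuous_on C (\<lambda>v. v $ 3)" by (intro continuous_intros)
    from strands_oscillation[OF C this comp[OF z1(1)] contL contM contN strands _ _ _ vw]
    have disj: "\<bar>(Im (L v) - Im (L w)) - 2 * pi * (v $ 3 - w $ 3)\<bar> \<le> 8 * pi \<and>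
        \<bar>2 * (Im (M v) - Im (M w)) + (Im (L v) - Im (L w))\<bar> \<le> 8 * pi \<and> \<bar>Im (N v) - Im (N w)\<bar> \<le> 8 * pi \<or>
        \<bar>Im (L v) - Im (L w)\<bar> \<le> 8 * pi \<and>
        \<bar>2 * (Im (M v) - Im (M w)) + (Im (L v) - Im (L w)) - 2 * pi * (v $ 3 - w $ 3)\<bar> \<le> 8 * pi \<and>
        \<bar>Im (N v) - Im (N w)\<bar> \<le> 8 * pi \<or>
        \<bar>Im (L v) - Im (L w)\<bar> \<le> 8 * pi \<and> \<bar>2 * (Im (M v) - Im (M w)) + (Im (L v) - Im (L w))\<bar> \<le> 8 * pi \<and>
        \<bar>\<bar>Im (N v) - Im (N w)\<bar> - \<bar>2 * pi * (v $ 3 - w $ 3)\<bar>\<bar> \<le> 8 * pi"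
      using expL expM expN w1(2) CW by (auto simp: image_subset_iff)
    have *: "\<bar>2 * pi * (v $ 1 - w $ 1)\<bar> \<le> 8 * e \<and> \<bar>2 * pi * (v $ 2 - w $ 2)\<bar> \<le> 8 * e \<and>
        \<bar>2 * pi * (v $ 3 - w $ 3)\<bar> \<le> 8 * e"
      by (rule oscillation_bounds[OF osc disj e8])
    have "\<bar>v $ j - w $ j\<bar> \<le> \<bar>2 * pi * (v $ j - w $ j)\<bar>"
      using pi_gt3 by (simp add: abs_mult mult_le_cancel_right1)
    also have "\<dots> \<le> 8 * e"
      using * exhaust_3[of j] by auto
    finally show ?thesis .
  qed
  then show ?thesis by (rule that)
qed

text \<open>Compact pieces are needed because the logarithmic corrections are bounded only on
  compact sets. \<open>K i\<close> keeps the points of \<open>T\<close> at distance at least a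
  quarter of a Lebesgue number from \<open>T - W i\<close>.\<close>

lemma compact_cover_shrinking:
  fixes T :: "'a::real_normed_vector set" and W :: "'i::finite \<Rightarrow> 'a set"
  assumes T: "compact T" and W: "\<And>i. openin (top_of_set T) (W i)" and cover: "T \<subseteq> (\<Union>i. W i)"
  obtains K where "\<And>i. compact (K i)" "\<And>i. K i \<subseteq> W i" "T \<subseteq> (\<Union>i. K i)"
proof -
  have "\<forall>i. \<exists>Q. open Q \<and> W i = T \<inter> Q"
    using W by (simp add: openin_open)
  then obtain Q where Q: "\<And>i. open (Q i)" "\<And>i. W i = T \<inter> Q i"
    by metis
  have "T \<subseteq> \<Union>(range Q)" "range Q \<noteq> {}" "\<And>B. B \<in> range Q \<Longrightarrow> open B"
    using cover Q by auto
  then obtain \<delta> where \<delta>: "\<delta> > 0" "\<And>A. A \<subseteq> T \<Longrightarrow> diameter A < \<delta> \<Longrightarrow> \<exists>B\<in>range Q. A \<subseteq> B"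
    using Lebesgue_number_lemma[OF T, of "range Q"] by metis
  define K where "K = (\<lambda>i. T - (\<Union>y\<in>T - W i. ball y (\<delta>/4)))"
  show ?thesis
  proof
    show "compact (K i)" for i
      unfolding K_def by (intro compact_diff T open_UN) auto
    show "K i \<subseteq> W i" for i
      using \<delta>(1) by (force simp: K_def)
    show "T \<subseteq> (\<Union>i. K i)"
    proof
      fix x assume x: "x \<in> T"
      have "diameter (T \<inter> cball x (\<delta>/4)) \<le> 2 * (\<delta>/4)"
      proof (rule diameter_le)
        fix y z assume "y \<in> T \<inter> cball x (\<delta>/4)" "z \<in> T \<inter> cball x (\<delta>/4)"
        then show "norm (y - z) \<le> 2 * (\<delta>/4)"
          using dist_triangle3[of y z x] by (simp add: dist_norm[symmetric])
      qed (use x \<delta>(1) in auto)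
      also have "\<dots> < \<delta>"
        using \<delta>(1) by simp
      finally obtain i where i: "T \<inter> cball x (\<delta>/4) \<subseteq> Q i"
        using \<delta>(2)[of "T \<inter> cball x (\<delta>/4)"] by auto
      then have "x \<in> K i"
        using x by (force simp: K_def Q(2) dist_commute)
      then show "x \<in> (\<Union>i. K i)" by blast
    qed
  qed
qed

text \<open>The type \<open>3\<close> indexes both the sets and the coordinates of
  \<open>real^3\<close>, so that each set is assigned one direction of the cube.\<close>

lemma no_three_path_sections:
  fixes U :: "3 \<Rightarrow> ((complex \<times> complex \<times> complex) \<times> (complex \<times> complex \<times> complex)) set"
  assumes U: "\<And>i. openin (top_of_set (separable_cubics \<times> separable_cubics)) (U i)"
    and hom: "\<And>i. homotopic_with_canon (\<lambda>_. True) (U i) separable_cubics fst snd"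
    and cover: "separable_cubics \<times> separable_cubics \<subseteq> (\<Union>i. U i)"
  shows False
proof -
  define \<phi> where "\<phi> = (\<lambda>x. (vieta (strands_A x), vieta (strands_B x)))"
  have \<phi>: "continuous_on torus3 \<phi>"
    unfolding \<phi>_def
    by (intro continuous_on_Pair continuous_on_compose2[OF continuous_on_vieta] continuous_on_strands) auto
  have \<phi>_im: "\<phi> \<in> torus3 \<rightarrow> separable_cubics \<times> separable_cubics"
    by (simp add: \<phi>_def Pi_iff vieta_in_separable_cubics_iff strands_A_in strands_B_in)
  define W where "W = (\<lambda>i. torus3 \<inter> \<phi> -` U i)"
  have "compact torus3"
    unfolding torus3_def by (intro compact_Times compact_sphere)
  moreover have "openin (top_of_set torus3) (W i)" for i
    unfolding W_def using continuous_openin_preimage[OF \<phi> \<phi>_im U] .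
  moreover have "torus3 \<subseteq> (\<Union>i. W i)"
  proof
    fix x assume x: "x \<in> torus3"
    then obtain i where "\<phi> x \<in> U i"
      using cover \<phi>_im by blast
    then show "x \<in> (\<Union>i. W i)"
      using x by (auto simp: W_def)
  qed
  ultimately obtain K where K: "\<And>i. compact (K i)" "\<And>i. K i \<subseteq> W i" "torus3 \<subseteq> (\<Union>i. K i)"
    using compact_cover_shrinking by metis
  have "homotopic_with_canon (\<lambda>_. True) (W i) separable_cubics (fst \<circ> \<phi>) (snd \<circ> \<phi>)" for i
    by (rule homotopic_with_compose_continuous_right[OF hom[of i]])
      (auto simp: W_def intro: continuous_on_subset[OF \<phi>])
  then have "homotopic_with_canon (\<lambda>_. True) (W i) separable_cubics (vieta \<circ> strands_A) (vieta \<circ> strands_B)" for i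
    by (simp add: \<phi>_def o_def)
  then have "\<exists>R. \<forall>C v w j. connected C \<longrightarrow> torus_exp ` C \<subseteq> K i \<longrightarrow> v \<in> C \<longrightarrow> w \<in> C \<longrightarrow> \<bar>v $ j - w $ j\<bar> \<le> R" for i
    using torus_section_oscillation[of "W i" "K i"] K(1,2) by (metis W_def inf_le1)
  then obtain R where R: "\<And>i C v w j. connected C \<Longrightarrow> torus_exp ` C \<subseteq> K i \<Longrightarrow> v \<in> C \<Longrightarrow> w \<in> C \<Longrightarrow>
      \<bar>v $ j - w $ j\<bar> \<le> R i"
    by metis
  \<comment> \<open>One cube must exceed all three oscillation bounds; the added 1 makes this strict
    and \<open>N\<close> positive.\<close>
  define N where "N = (\<Sum>i\<in>UNIV. \<bar>R i\<bar>) + 1"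
  have RN: "R i < N" for i
    using member_le_sum[of i UNIV "\<lambda>i. \<bar>R i\<bar>"] by (simp add: N_def)
  have "N > 0"
    by (simp add: N_def sum_nonneg add_nonneg_pos)
  then show False
  proof (rule cube_not_covered_by_dim_many_narrow_sets[where K = "\<lambda>i. torus_exp -` K i"])
    show "closed (torus_exp -` K i)" for i
      using K(1) continuous_on_torus_exp by (intro closed_vimage compact_imp_closed) auto
    show "cbox 0 (vec N) \<subseteq> (\<Union>i. torus_exp -` K i)"
      using K(3) torus_exp_in by blast
    show "\<bar>v $ i - w $ i\<bar> < N"
      if "connected C" "C \<subseteq> torus_exp -` K i" "v \<in> C" "w \<in> C" for i C v w
      using R[of C i v w i] RN[of i] that by (fastforce simp: image_subset_iff_subset_vimage)
  qed
qed

lemma TC_separable_cubics_ge: "3 \<le> TC (top_of_set separable_cubics)"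
  unfolding TC_def
proof (rule Inf_greatest, safe)
  fix k and U :: "nat \<Rightarrow> ((complex \<times> complex \<times> complex) \<times> (complex \<times> complex \<times> complex)) set"
  let ?X = "top_of_set separable_cubics"
  assume U: "\<forall>i\<le>k. openin (prod_topology ?X ?X) (U i) \<and> has_path_section ?X (U i)"
    and cover: "(\<Union>i\<le>k. U i) = topspace (prod_topology ?X ?X)"
  show "3 \<le> enat k"
  proof (rule ccontr)
    assume "\<not> 3 \<le> enat k"
    then have k: "k \<le> 2"
      by (simp add: numeral_eq_enat)
    \<comment> \<open>The elements of the type \<open>3\<close> are 1, 2 and 3; they enumerate
      \<open>0..k\<close>, and \<open>min\<close> repeats the last set when there are fewer than
      three.\<close>
    define f :: "3 \<Rightarrow> nat" where "f = (\<lambda>i. min k (if i = 1 then 0 else if i = 2 then 1 else 2))"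
    have fk: "f i \<le> k" for i by (simp add: f_def)
    have onto: "\<exists>i. j = f i" if "j \<le> k" for j
    proof -
      have "j = 0 \<or> j = 1 \<or> j = 2" using that k by linarith
      then show ?thesis
        using that by (auto simp: f_def intro: exI[of _ 1] exI[of _ 2] exI[of _ 3])
    qed
    show False
    proof (rule no_three_path_sections[of "\<lambda>i. U (f i)"])
      fix i
      have op: "openin (prod_topology ?X ?X) (U (f i))" and sec: "has_path_section ?X (U (f i))"
        using U fk by blast+
      show "openin (top_of_set (separable_cubics \<times> separable_cubics)) (U (f i))"
        using op by simp
      from openin_imp_subset[OF this] have sub: "U (f i) \<subseteq> separable_cubics \<times> separable_cubics" .
      have "subtopology (prod_topology ?X ?X) (U (f i)) = top_of_set (U (f i))"
        using sub by (simp add: subtopology_subtopology inf_absorb2)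
      then show "homotopic_with_canon (\<lambda>_. True) (U (f i)) separable_cubics fst snd"
        using sec has_path_section_iff_homotopic[of "U (f i)" ?X] sub by simp
    next
      show "separable_cubics \<times> separable_cubics \<subseteq> (\<Union>i. U (f i))"
      proof
        fix z assume "z \<in> separable_cubics \<times> separable_cubics"
        then obtain j where "j \<le> k" "z \<in> U j"
          using cover by auto
        then show "z \<in> (\<Union>i. U (f i))"
          using onto by blast
      qed
    qed
  qed
qed

section \<open>The upper bound\<close>

text \<open>Strata of equal level are separated, so comparing distances gives them disjoint open
  neighbourhoods. These are clopen in their union, and hence the homotopies of one level
  glue.\<close>

lemma open_cover_of_strata:
  fixes \<sigma> :: "'j \<Rightarrow> 'a::euclidean_space set" and f g :: "'a \<Rightarrow> 'b::topological_space" and Z :: "'a set"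
  assumes J: "finite J" and lev: "\<And>j. j \<in> J \<Longrightarrow> lev j \<le> k" and cover: "Z = (\<Union>j\<in>J. \<sigma> j)"
    and plan: "\<And>j. j \<in> J \<Longrightarrow> \<exists>D. openin (top_of_set Z) D \<and> \<sigma> j \<subseteq> D \<and> homotopic_with_canon (\<lambda>_. True) D S f g"
    and sep: "\<And>i j. i \<in> J \<Longrightarrow> j \<in> J \<Longrightarrow> i \<noteq> j \<Longrightarrow> lev i = lev j \<Longrightarrow> \<sigma> i \<inter> closure (\<sigma> j) = {}"
  obtains U :: "nat \<Rightarrow> 'a set" where "\<And>i. openin (top_of_set Z) (U i)"
    "\<And>i. homotopic_with_canon (\<lambda>_. True) (U i) S f g" "(\<Union>i\<le>k. U i) = Z"
proof -
  obtain D where D: "\<And>j. j \<in> J \<Longrightarrow> openin (top_of_set Z) (D j)" "\<And>j. j \<in> J \<Longrightarrow> \<sigma> j \<subseteq> D j"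
    "\<And>j. j \<in> J \<Longrightarrow> homotopic_with_canon (\<lambda>_. True) (D j) S f g"
    using plan by metis
  \<comment> \<open>Empty strata are dropped because \<open>infdist\<close> to the empty set is 0,
    which would spoil the comparison of distances.\<close>
  define R where "R = (\<lambda>i. {j \<in> J. lev j = i \<and> \<sigma> j \<noteq> {}})"
  define Q where "Q = (\<lambda>i. D i \<inter> (\<Inter>j\<in>R (lev i) - {i}. {z. infdist z (\<sigma> i) < infdist z (\<sigma> j)}))"
  have fin: "finite (R i)" for i
    using J by (simp add: R_def)
  have opQ: "openin (top_of_set Z) (Q i)" if "i \<in> J" for i
  proof -
    have "open (\<Inter>j\<in>R (lev i) - {i}. {z. infdist z (\<sigma> i) < infdist z (\<sigma> j)})"
      using fin by (intro open_INT ballI open_Collect_less continuous_intros) auto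
    then show ?thesis
      unfolding Q_def using D(1)[OF that] by (intro openin_Int_open)
  qed
  have \<sigma>Q: "\<sigma> i \<subseteq> Q i" if "i \<in> J" for i
  proof
    fix z assume z: "z \<in> \<sigma> i"
    have "infdist z (\<sigma> i) < infdist z (\<sigma> j)" if j: "j \<in> R (lev i) - {i}" for j
    proof -
      have "z \<notin> closure (\<sigma> j)"
        using sep[of i j] j z \<open>i \<in> J\<close> by (auto simp: R_def)
      then have "infdist z (\<sigma> j) \<noteq> 0"
        using j in_closure_iff_infdist_zero[of "\<sigma> j" z] by (auto simp: R_def)
      then show ?thesis
        using z infdist_nonneg[of z "\<sigma> j"] by simp
    qed
    then show "z \<in> Q i"
      using D(2)[OF that] z by (auto simp: Q_def)
  qed
  have disj: "Q i \<inter> Q j = {}" if "i \<in> R n" "j \<in> R n" "i \<noteq> j" for i j n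
  proof (rule ccontr)
    assume "Q i \<inter> Q j \<noteq> {}"
    then obtain z where z: "z \<in> Q i" "z \<in> Q j" by blast
    have "j \<in> R (lev i) - {i}" "i \<in> R (lev j) - {j}"
      using that by (auto simp: R_def)
    then have "infdist z (\<sigma> i) < infdist z (\<sigma> j)" "infdist z (\<sigma> j) < infdist z (\<sigma> i)"
      using z unfolding Q_def by blast+
    then show False by simp
  qed
  define U where "U = (\<lambda>n. \<Union>(Q ` R n))"
  have RJ: "R n \<subseteq> J" for n by (auto simp: R_def)
  have opU: "openin (top_of_set Z) (U n)" for n
    unfolding U_def using opQ RJ by (intro openin_Union) blast
  show ?thesis
  proof (rule that)
    show "openin (top_of_set Z) (U n)" for n by (rule opU)
    show "homotopic_with_canon (\<lambda>_. True) (U n) S f g" for n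
      unfolding U_def
    proof (rule homotopic_on_clopen_Union)
      have op: "openin (top_of_set (\<Union>(Q ` R n))) (Q i)" if "i \<in> R n" for i
        using opQ[of i] RJ opU[of n] that unfolding U_def
        by (meson UN_upper openin_imp_subset openin_subset_trans subsetD)
      fix V assume "V \<in> Q ` R n"
      then obtain i where i: "i \<in> R n" "V = Q i" by blast
      show "openin (top_of_set (\<Union>(Q ` R n))) V"
        using op i by simp
      have "V = \<Union>(Q ` R n) - \<Union>(Q ` (R n - {i}))"
        using disj[OF i(1)] i by blast
      moreover have "openin (top_of_set (\<Union>(Q ` R n))) (\<Union>(Q ` (R n - {i})))"
        using op by (intro openin_Union) blast
      ultimately show "closedin (top_of_set (\<Union>(Q ` R n))) V"
        by (metis closedin_diff closedin_topspace topspace_euclidean_subtopology)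
      show "homotopic_with_canon (\<lambda>_. True) V S f g"
        using D(3)[of i] RJ i by (auto simp: Q_def intro: homotopic_with_subset_left)
    qed
    show "(\<Union>i\<le>k. U i) = Z"
    proof
      show "(\<Union>i\<le>k. U i) \<subseteq> Z"
        using opU openin_imp_subset by blast
      show "Z \<subseteq> (\<Union>i\<le>k. U i)"
      proof
        fix z assume "z \<in> Z"
        then obtain j where j: "j \<in> J" "z \<in> \<sigma> j" using cover by blast
        then have "j \<in> R (lev j)" by (auto simp: R_def)
        then show "z \<in> (\<Union>i\<le>k. U i)"
          using \<sigma>Q[OF j(1)] j lev[OF j(1)] unfolding U_def by blast
      qed
    qed
  qed
qed

section \<open>Shares of the discriminant and the circle action\<close>

definition cubic_disc :: "complex \<times> complex \<times> complex \<Rightarrow> complex" where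
  "cubic_disc = (\<lambda>(m, p, q). p ^ 3 + q ^ 2)"

text \<open>The shares are invariant under the rotation and add up to 1, so either of them is a
  coordinate on the orbit space; \<open>share_p\<close> vanishes on the exceptional orbits
  \<open>p = 0\<close>, and \<open>share_q\<close> on \<open>q = 0\<close>.\<close>

definition share_p :: "complex \<times> complex \<times> complex \<Rightarrow> complex" where
  "share_p x = fst (snd x) ^ 3 / cubic_disc x"

definition share_q :: "complex \<times> complex \<times> complex \<Rightarrow> complex" where
  "share_q x = snd (snd x) ^ 2 / cubic_disc x"

text \<open>The factors are chosen such that \<open>norm_p x ^ 3 = cubic_disc x = norm_q x ^ 2\<close>.\<close>

definition norm_p :: "complex \<times> complex \<times> complex \<Rightarrow> complex" where
  "norm_p x = fst (snd x) * exp (- Ln (share_p x) / 3)"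

definition norm_q :: "complex \<times> complex \<times> complex \<Rightarrow> complex" where
  "norm_q x = snd (snd x) * exp (- Ln (share_q x) / 2)"

definition rotate_cubic :: "complex \<Rightarrow> complex \<times> complex \<times> complex \<Rightarrow> complex \<times> complex \<times> complex" where
  "rotate_cubic w = (\<lambda>(m, p, q). (m, w ^ 2 * p, w ^ 3 * q))"

lemma separable_cubics_iff: "x \<in> separable_cubics \<longleftrightarrow> cubic_disc x \<noteq> 0"
  by (auto simp: separable_cubics_def cubic_disc_def)

lemma share_sum: "x \<in> separable_cubics \<Longrightarrow> share_p x + share_q x = 1"
  by (auto simp: share_p_def share_q_def separable_cubics_iff cubic_disc_def add_divide_distrib[symmetric]
      split: prod.splits)

lemma share_mult:
  assumes "x \<in> separable_cubics"
  shows "fst (snd x) ^ 3 = cubic_disc x * share_p x" "snd (snd x) ^ 2 = cubic_disc x * share_q x"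
  using assms by (simp_all add: share_p_def share_q_def separable_cubics_iff)

lemma exp_third_cube: "exp (z / 3) ^ 3 = exp (z :: complex)"
  using exp_divide_power_eq[of 3 z] by simp

lemma exp_half_square: "exp (z / 2) ^ 2 = exp (z :: complex)"
  using exp_divide_power_eq[of 2 z] by simp

lemma norm_p_cube:
  assumes "x \<in> separable_cubics" "share_p x \<noteq> 0"
  shows "norm_p x ^ 3 = cubic_disc x"
proof -
  have "exp (- Ln (share_p x) / 3) ^ 3 = inverse (share_p x)"
    unfolding exp_third_cube using assms(2) by (simp add: exp_minus)
  then show ?thesis
    unfolding norm_p_def power_mult_distrib using assms(2) share_mult(1)[OF assms(1)] by simp
qed

lemma norm_q_square:
  assumes "x \<in> separable_cubics" "share_q x \<noteq> 0"
  shows "norm_q x ^ 2 = cubic_disc x"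
proof -
  have "exp (- Ln (share_q x) / 2) ^ 2 = inverse (share_q x)"
    unfolding exp_half_square using assms(2) by (simp add: exp_minus)
  then show ?thesis
    unfolding norm_q_def power_mult_distrib using assms(2) share_mult(2)[OF assms(1)] by simp
qed

lemma continuous_on_cubic_disc [continuous_intros]:
  "continuous_on S f \<Longrightarrow> continuous_on S (\<lambda>x. cubic_disc (f x))"
  unfolding cubic_disc_def case_prod_beta by (intro continuous_intros)

lemma continuous_on_share:
  "continuous_on separable_cubics share_p" "continuous_on separable_cubics share_q"
  unfolding share_p_def share_q_def by (intro continuous_intros; simp add: separable_cubics_iff)+

lemma continuous_on_norm_p: "continuous_on (separable_cubics \<inter> {x. Re (share_p x) > 0}) norm_p"
  unfolding norm_p_def
  by (intro continuous_intros continuous_on_subset[OF continuous_on_share(1)])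
    (auto simp: complex_nonpos_Reals_iff)

lemma continuous_on_norm_q: "continuous_on (separable_cubics \<inter> {x. Re (share_q x) > 0}) norm_q"
  unfolding norm_q_def
  by (intro continuous_intros continuous_on_subset[OF continuous_on_share(2)])
    (auto simp: complex_nonpos_Reals_iff)

lemma openin_share_pos:
  "openin (top_of_set separable_cubics) (separable_cubics \<inter> {x. Re (share_p x) > 0})"
  "openin (top_of_set separable_cubics) (separable_cubics \<inter> {x. Re (share_q x) > 0})"
proof -
  have "open {z. Re z > 0}" by (simp add: open_halfspace_Re_gt)
  then show "openin (top_of_set separable_cubics) (separable_cubics \<inter> {x. Re (share_p x) > 0})"
    "openin (top_of_set separable_cubics) (separable_cubics \<inter> {x. Re (share_q x) > 0})"
    using continuous_openin_preimage_gen[OF continuous_on_share(1)]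
      continuous_openin_preimage_gen[OF continuous_on_share(2)] by (force simp: vimage_def)+
qed

lemma cubic_disc_rotate: "cubic_disc (rotate_cubic w x) = w ^ 6 * cubic_disc x"
  by (cases x) (simp add: cubic_disc_def rotate_cubic_def power_mult_distrib power_mult[symmetric] distrib_left)

lemma rotate_cubic_in: "w \<noteq> 0 \<Longrightarrow> rotate_cubic w x \<in> separable_cubics \<longleftrightarrow> x \<in> separable_cubics"
  by (simp add: separable_cubics_iff cubic_disc_rotate)

lemma share_rotate:
  assumes "w \<noteq> 0"
  shows "share_p (rotate_cubic w x) = share_p x" "share_q (rotate_cubic w x) = share_q x"
  using assms unfolding share_p_def share_q_def cubic_disc_rotate
  by (cases x; simp add: rotate_cubic_def power_mult_distrib power_mult[symmetric])+

section \<open>Deformation to normal forms\<close>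

lemma homotopic_linear_cubics:
  fixes m :: "'c::real_normed_vector \<Rightarrow> complex"
  assumes cont: "continuous_on W m" "continuous_on W p" "continuous_on W q"
      "continuous_on W m'" "continuous_on W p'" "continuous_on W q'"
    and nz: "\<And>x t. x \<in> W \<Longrightarrow> 0 \<le> t \<Longrightarrow> t \<le> 1 \<Longrightarrow>
      ((1 - t) *\<^sub>R p x + t *\<^sub>R p' x) ^ 3 + ((1 - t) *\<^sub>R q x + t *\<^sub>R q' x) ^ 2 \<noteq> 0"
  shows "homotopic_with_canon (\<lambda>_. True) W separable_cubics (\<lambda>x. (m x, p x, q x)) (\<lambda>x. (m' x, p' x, q' x))"
  using nz
  by (intro homotopic_with_linear continuous_on_Pair cont)
    (auto simp: closed_segment_def separable_cubics_def)

text \<open>If \<open>Re u\<close> is negative, shrinking \<open>u\<close> can only increase the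
  real part of the sum, which starts at 1.\<close>

lemma Re_scaled_share_pos:
  fixes u v :: complex
  assumes "u + v = 1" "Re v > 0" "0 \<le> s" "s \<le> 1"
  shows "Re (s *\<^sub>R u + v) > 0"
proof (cases "Re u \<ge> 0")
  case False
  have "Re u + Re v = 1"
    using assms(1) by (metis one_complex.simps(1) plus_complex.simps(1))
  moreover have "Re u \<le> s * Re u"
    using False assms(4) mult_right_mono_neg[of s 1 "Re u"] by simp
  ultimately show ?thesis by simp
qed (use assms in \<open>simp add: add_nonneg_pos\<close>)

text \<open>Move the mean to 0, shrink \<open>p\<close>, then rescale \<open>q\<close>. Shrinking
  only scales the share of \<open>p\<close>, so the sum of both shares keeps positive real part and
  the discriminant does not vanish.\<close>

lemma homotopic_to_norm_q:
  "homotopic_with_canon (\<lambda>_. True) (separable_cubics \<inter> {x. Re (share_q x) > 0}) separable_cubics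
     id (\<lambda>x. (0, 0, norm_q x))" (is "homotopic_with_canon _ ?W _ _ _")
proof -
  have "homotopic_with_canon (\<lambda>_. True) ?W separable_cubics
      (\<lambda>x. (fst x, fst (snd x), snd (snd x))) (\<lambda>x. (0, fst (snd x), snd (snd x)))"
  proof (rule homotopic_linear_cubics)
    fix x and t :: real assume "x \<in> ?W"
    then show "((1 - t) *\<^sub>R fst (snd x) + t *\<^sub>R fst (snd x)) ^ 3 +
        ((1 - t) *\<^sub>R snd (snd x) + t *\<^sub>R snd (snd x)) ^ 2 \<noteq> 0"
      by (cases x) (simp add: separable_cubics_def scaleR_left_distrib[symmetric])
  qed (intro continuous_intros)+
  moreover have "homotopic_with_canon (\<lambda>_. True) ?W separable_cubics
      (\<lambda>x. (0, fst (snd x), snd (snd x))) (\<lambda>x. (0, 0, snd (snd x)))"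
  proof (rule homotopic_linear_cubics)
    fix x and t :: real assume x: "x \<in> ?W" and t: "0 \<le> t" "t \<le> 1"
    have "((1 - t) *\<^sub>R fst (snd x) + t *\<^sub>R 0) ^ 3 + ((1 - t) *\<^sub>R snd (snd x) + t *\<^sub>R snd (snd x)) ^ 2 =
        (1 - t) ^ 3 *\<^sub>R (fst (snd x) ^ 3) + snd (snd x) ^ 2"
      by (simp add: scaleR_left_distrib[symmetric] scaleR_power)
    also have "\<dots> = cubic_disc x * ((1 - t) ^ 3 *\<^sub>R share_p x + share_q x)"
      using x share_mult[of x] by (simp add: algebra_simps)
    also have "\<dots> \<noteq> 0"
    proof -
      have "Re ((1 - t) ^ 3 *\<^sub>R share_p x + share_q x) > 0"
        using x t share_sum by (intro Re_scaled_share_pos) (auto intro: power_le_one)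
      then show ?thesis
        using x Re_pos_imp_nonzero by (auto simp only: separable_cubics_iff mult_eq_0_iff Int_iff)
    qed
    finally show "((1 - t) *\<^sub>R fst (snd x) + t *\<^sub>R 0) ^ 3 +
        ((1 - t) *\<^sub>R snd (snd x) + t *\<^sub>R snd (snd x)) ^ 2 \<noteq> 0" .
  qed (intro continuous_intros)+
  moreover have "homotopic_with_canon (\<lambda>_. True) ?W separable_cubics
      (\<lambda>x. (0, 0, snd (snd x))) (\<lambda>x. (0, 0, norm_q x))"
    unfolding homotopic_with_canon_iff
  proof (intro exI conjI ballI)
    have "continuous_on ({0..1} \<times> ?W) (\<lambda>y. share_q (snd y))"
      by (rule continuous_on_compose2[OF continuous_on_share(2)]) (auto intro: continuous_intros)
    then show "continuous_on ({0..1} \<times> ?W) (\<lambda>(t, x). (0, 0, snd (snd x) * exp (- complex_of_real t * Ln (share_q x) / 2)))"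
      unfolding case_prod_beta by (intro continuous_intros) (auto simp: complex_nonpos_Reals_iff)
    have "snd (snd x) \<noteq> 0" if "x \<in> ?W" for x
      using that by (auto simp: share_q_def)
    then show "(\<lambda>(t, x). (0, 0, snd (snd x) * exp (- complex_of_real t * Ln (share_q x) / 2))) \<in> {0..1} \<times> ?W \<rightarrow> separable_cubics"
      by (auto simp: separable_cubics_def)
  qed (auto simp: norm_q_def)
  ultimately show ?thesis
    by (simp add: id_def) (blast intro: homotopic_with_trans)
qed

lemma homotopic_to_norm_p:
  "homotopic_with_canon (\<lambda>_. True) (separable_cubics \<inter> {x. Re (share_p x) > 0}) separable_cubics
     id (\<lambda>x. (0, norm_p x, 0))" (is "homotopic_with_canon _ ?W _ _ _")
proof -
  have "homotopic_with_canon (\<lambda>_. True) ?W separable_cubics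
      (\<lambda>x. (fst x, fst (snd x), snd (snd x))) (\<lambda>x. (0, fst (snd x), snd (snd x)))"
  proof (rule homotopic_linear_cubics)
    fix x and t :: real assume "x \<in> ?W"
    then show "((1 - t) *\<^sub>R fst (snd x) + t *\<^sub>R fst (snd x)) ^ 3 +
        ((1 - t) *\<^sub>R snd (snd x) + t *\<^sub>R snd (snd x)) ^ 2 \<noteq> 0"
      by (cases x) (simp add: separable_cubics_def scaleR_left_distrib[symmetric])
  qed (intro continuous_intros)+
  moreover have "homotopic_with_canon (\<lambda>_. True) ?W separable_cubics
      (\<lambda>x. (0, fst (snd x), snd (snd x))) (\<lambda>x. (0, fst (snd x), 0))"
  proof (rule homotopic_linear_cubics)
    fix x and t :: real assume x: "x \<in> ?W" and t: "0 \<le> t" "t \<le> 1"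
    have "((1 - t) *\<^sub>R fst (snd x) + t *\<^sub>R fst (snd x)) ^ 3 + ((1 - t) *\<^sub>R snd (snd x) + t *\<^sub>R 0) ^ 2 =
        fst (snd x) ^ 3 + (1 - t) ^ 2 *\<^sub>R (snd (snd x) ^ 2)"
      by (simp add: scaleR_left_distrib[symmetric] scaleR_power)
    also have "\<dots> = cubic_disc x * ((1 - t) ^ 2 *\<^sub>R share_q x + share_p x)"
      using x share_mult[of x] by (simp add: algebra_simps)
    also have "\<dots> \<noteq> 0"
    proof -
      have "Re ((1 - t) ^ 2 *\<^sub>R share_q x + share_p x) > 0"
        using x t share_sum by (intro Re_scaled_share_pos) (auto intro: power_le_one simp: add.commute)
      then show ?thesis
        using x Re_pos_imp_nonzero by (auto simp only: separable_cubics_iff mult_eq_0_iff Int_iff)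
    qed
    finally show "((1 - t) *\<^sub>R fst (snd x) + t *\<^sub>R fst (snd x)) ^ 3 +
        ((1 - t) *\<^sub>R snd (snd x) + t *\<^sub>R 0) ^ 2 \<noteq> 0" .
  qed (intro continuous_intros)+
  moreover have "homotopic_with_canon (\<lambda>_. True) ?W separable_cubics
      (\<lambda>x. (0, fst (snd x), 0)) (\<lambda>x. (0, norm_p x, 0))"
    unfolding homotopic_with_canon_iff
  proof (intro exI conjI ballI)
    have "continuous_on ({0..1} \<times> ?W) (\<lambda>y. share_p (snd y))"
      by (rule continuous_on_compose2[OF continuous_on_share(1)]) (auto intro: continuous_intros)
    then show "continuous_on ({0..1} \<times> ?W) (\<lambda>(t, x). (0, fst (snd x) * exp (- complex_of_real t * Ln (share_p x) / 3), 0))"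
      unfolding case_prod_beta by (intro continuous_intros) (auto simp: complex_nonpos_Reals_iff)
    have "fst (snd x) \<noteq> 0" if "x \<in> ?W" for x
      using that by (auto simp: share_p_def)
    then show "(\<lambda>(t, x). (0, fst (snd x) * exp (- complex_of_real t * Ln (share_p x) / 3), 0)) \<in> {0..1} \<times> ?W \<rightarrow> separable_cubics"
      by (auto simp: separable_cubics_def)
  qed (auto simp: norm_p_def)
  ultimately show ?thesis
    by (simp add: id_def) (blast intro: homotopic_with_trans)
qed

text \<open>A power with exponent between 0 and 1 shrinks the argument, which is already below
  \<open>pi / 2\<close>.\<close>

lemma Re_exp_Ln_power_pos:
  assumes "Re z > 0" "0 \<le> s" "s \<le> (1::real)"
  shows "Re (exp (s * Ln z)) > 0"
proof -
  have "\<bar>Im (Ln z)\<bar> < pi / 2"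
    using assms(1) Re_pos_imp_nonzero Re_Ln_pos_lt by blast
  then have "\<bar>s * Im (Ln z)\<bar> < pi / 2"
    using assms(2,3) mult_right_mono[of s 1 "\<bar>Im (Ln z)\<bar>"] by (simp add: abs_mult)
  then have "cos (s * Im (Ln z)) > 0"
    by (intro cos_gt_zero_pi) linarith+
  then show ?thesis
    by (simp add: Re_exp)
qed

text \<open>At time \<open>t\<close> the shares are replaced by their powers with exponent
  \<open>1 - t\<close>. Both stay in the right half plane, so their sum and with it the new
  discriminant are nonzero.\<close>

lemma homotopic_to_norm_both:
  "homotopic_with_canon (\<lambda>_. True) (separable_cubics \<inter> {x. Re (share_p x) > 0 \<and> Re (share_q x) > 0})
     separable_cubics id (\<lambda>x. (0, norm_p x, norm_q x))" (is "homotopic_with_canon _ ?W _ _ _")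
  unfolding homotopic_with_canon_iff
proof (intro exI conjI ballI)
  let ?h = "\<lambda>(t :: real, x). (complex_of_real (1 - t) * fst x, fst (snd x) * exp (- complex_of_real t * Ln (share_p x) / 3),
    snd (snd x) * exp (- complex_of_real t * Ln (share_q x) / 2))"
  have "continuous_on ({0..1} \<times> ?W) (\<lambda>y. share_p (snd y))" "continuous_on ({0..1} \<times> ?W) (\<lambda>y. share_q (snd y))"
    by (rule continuous_on_compose2[OF continuous_on_share(1)] continuous_on_compose2[OF continuous_on_share(2)];
        auto intro: continuous_intros)+
  then show "continuous_on ({0..1} \<times> ?W) ?h"
    unfolding case_prod_beta by (intro continuous_intros) (auto simp: complex_nonpos_Reals_iff)
  have "?h (t, x) \<in> separable_cubics" if t: "0 \<le> t" "t \<le> 1" and x: "x \<in> ?W" for t x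
  proof -
    have nz: "share_p x \<noteq> 0" "share_q x \<noteq> 0" using x by auto
    have "(fst (snd x) * exp (- complex_of_real t * Ln (share_p x) / 3)) ^ 3 =
        cubic_disc x * (share_p x * exp (- complex_of_real t * Ln (share_p x)))"
      unfolding power_mult_distrib exp_third_cube using x share_mult(1)[of x] by simp
    also have "share_p x * exp (- complex_of_real t * Ln (share_p x)) = exp (complex_of_real (1 - t) * Ln (share_p x))"
      using nz by (simp add: left_diff_distrib exp_diff exp_minus field_simps)
    finally have 1: "(fst (snd x) * exp (- complex_of_real t * Ln (share_p x) / 3)) ^ 3 =
        cubic_disc x * exp (complex_of_real (1 - t) * Ln (share_p x))" .
    have "(snd (snd x) * exp (- complex_of_real t * Ln (share_q x) / 2)) ^ 2 =
        cubic_disc x * (share_q x * exp (- complex_of_real t * Ln (share_q x)))"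
      unfolding power_mult_distrib exp_half_square using x share_mult(2)[of x] by simp
    also have "share_q x * exp (- complex_of_real t * Ln (share_q x)) = exp (complex_of_real (1 - t) * Ln (share_q x))"
      using nz by (simp add: left_diff_distrib exp_diff exp_minus field_simps)
    finally have 2: "(snd (snd x) * exp (- complex_of_real t * Ln (share_q x) / 2)) ^ 2 =
        cubic_disc x * exp (complex_of_real (1 - t) * Ln (share_q x))" .
    have "Re (exp (complex_of_real (1 - t) * Ln (share_p x)) + exp (complex_of_real (1 - t) * Ln (share_q x))) > 0"
      using Re_exp_Ln_power_pos[of "share_p x" "1 - t"] Re_exp_Ln_power_pos[of "share_q x" "1 - t"] t x
      unfolding plus_complex.simps by auto
    then have "cubic_disc x * (exp (complex_of_real (1 - t) * Ln (share_p x)) + exp (complex_of_real (1 - t) * Ln (share_q x))) \<noteq> 0"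
      using x Re_pos_imp_nonzero by (auto simp: separable_cubics_iff)
    then have "(fst (snd x) * exp (- complex_of_real t * Ln (share_p x) / 3)) ^ 3 +
        (snd (snd x) * exp (- complex_of_real t * Ln (share_q x) / 2)) ^ 2 \<noteq> 0"
      unfolding 1 2 distrib_left .
    then show ?thesis
      by (simp add: separable_cubics_def)
  qed
  then show "?h \<in> {0..1} \<times> ?W \<rightarrow> separable_cubics"
    by auto
qed (auto simp: norm_p_def norm_q_def)

abbreviation cubics_p :: "(complex \<times> complex \<times> complex) set" where
  "cubics_p \<equiv> separable_cubics \<inter> {x. Re (share_p x) > 0}"

abbreviation cubics_q :: "(complex \<times> complex \<times> complex) set" where
  "cubics_q \<equiv> separable_cubics \<inter> {x. Re (share_q x) > 0}"

abbreviation cubics_pq :: "(complex \<times> complex \<times> complex) set" where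
  "cubics_pq \<equiv> separable_cubics \<inter> {x. Re (share_p x) > 0 \<and> Re (share_q x) > 0}"

text \<open>The normalized pair satisfies \<open>p^3 = q^2\<close>, a cusp parametrized by
  \<open>(u^2, u^3)\<close> with \<open>u = q / p\<close>. Thus \<open>norm_u\<close> is the
  rotation and scaling that takes \<open>(1, 1)\<close> to the normalized pair.\<close>

definition norm_u :: "complex \<times> complex \<times> complex \<Rightarrow> complex" where
  "norm_u x = norm_q x / norm_p x"

lemma norm_p_cube': "x \<in> cubics_p \<Longrightarrow> norm_p x ^ 3 = cubic_disc x"
  by (rule norm_p_cube) auto

lemma norm_q_square': "x \<in> cubics_q \<Longrightarrow> norm_q x ^ 2 = cubic_disc x"
  by (rule norm_q_square) auto

lemma norm_p_nonzero: "x \<in> cubics_p \<Longrightarrow> norm_p x \<noteq> 0"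
  using norm_p_cube'[of x] by (auto simp: separable_cubics_iff)

lemma norm_q_nonzero: "x \<in> cubics_q \<Longrightarrow> norm_q x \<noteq> 0"
  using norm_q_square'[of x] by (auto simp: separable_cubics_iff)

lemma norm_u_powers:
  assumes "x \<in> cubics_pq"
  shows "norm_u x ^ 2 = norm_p x" "norm_u x ^ 3 = norm_q x" "norm_u x ^ 6 = cubic_disc x" "norm_u x \<noteq> 0"
proof -
  have p: "norm_p x ^ 3 = cubic_disc x" and q: "norm_q x ^ 2 = cubic_disc x"
    and nz: "norm_p x \<noteq> 0" "norm_q x \<noteq> 0"
    using assms norm_p_cube' norm_q_square' norm_p_nonzero norm_q_nonzero by blast+
  have "norm_u x ^ 2 = norm_p x ^ 3 / norm_p x ^ 2"
    by (simp add: norm_u_def power_divide p q)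
  also have "\<dots> = norm_p x"
    using nz by (simp add: power3_eq_cube power2_eq_square)
  finally show 2: "norm_u x ^ 2 = norm_p x" .
  have "norm_u x ^ 3 = norm_q x * norm_q x ^ 2 / norm_p x ^ 3"
    by (simp add: norm_u_def power_divide power3_eq_cube power2_eq_square)
  also have "\<dots> = norm_q x"
    using assms by (simp add: p q separable_cubics_iff)
  finally show "norm_u x ^ 3 = norm_q x" .
  have "norm_u x ^ 6 = (norm_u x ^ 2) ^ 3"
    by (simp add: power_mult[symmetric])
  then show "norm_u x ^ 6 = cubic_disc x"
    by (simp add: 2 p)
  show "norm_u x \<noteq> 0"
    using nz by (simp add: norm_u_def)
qed

section \<open>Homotopies from segments between normal forms\<close>

lemma segment_nonzero:
  fixes a b :: complex
  assumes "b / a \<notin> \<real>\<^sub>\<le>\<^sub>0" "0 \<le> t" "t \<le> 1"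
  shows "(1 - t) *\<^sub>R a + t *\<^sub>R b \<noteq> 0"
proof
  assume eq: "(1 - t) *\<^sub>R a + t *\<^sub>R b = 0"
  have "a \<noteq> 0" using assms(1) by auto
  then have "t \<noteq> 0" using eq by auto
  have "t *\<^sub>R b = - ((1 - t) *\<^sub>R a)"
    using eq by (simp add: eq_neg_iff_add_eq_0 add.commute)
  then have "t *\<^sub>R (b / a) = - of_real (1 - t)"
    using \<open>a \<noteq> 0\<close> by (simp add: scaleR_conv_of_real field_simps)
  then have "b / a = of_real (- (1 - t) / t)"
    using \<open>t \<noteq> 0\<close> by (simp add: scaleR_conv_of_real field_simps)
  moreover have "- (1 - t) / t \<le> 0"
    using assms(2,3) by (simp add: divide_nonpos_nonneg)
  ultimately show False
    using assms(1) by (metis nonpos_Reals_of_real_iff)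
qed

lemma homotopic_in_cubics_q:
  fixes f g :: "'c::real_normed_vector \<Rightarrow> complex \<times> complex \<times> complex"
  assumes f: "continuous_on W f" "f \<in> W \<rightarrow> cubics_q" and g: "continuous_on W g" "g \<in> W \<rightarrow> cubics_q"
    and nonpos: "\<And>x. x \<in> W \<Longrightarrow> norm_q (g x) / norm_q (f x) \<notin> \<real>\<^sub>\<le>\<^sub>0"
  shows "homotopic_with_canon (\<lambda>_. True) W separable_cubics f g"
proof -
  have 1: "homotopic_with_canon (\<lambda>_. True) W separable_cubics k (\<lambda>x. (0, 0, norm_q (k x)))"
    if "continuous_on W k" "k \<in> W \<rightarrow> cubics_q" for k
    using homotopic_with_compose_continuous_right[OF homotopic_to_norm_q that] by (simp add: o_def)
  have "homotopic_with_canon (\<lambda>_. True) W separable_cubics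
      (\<lambda>x. (0, 0, norm_q (f x))) (\<lambda>x. (0, 0, norm_q (g x)))"
  proof (rule homotopic_linear_cubics)
    show "continuous_on W (\<lambda>x. norm_q (f x))" "continuous_on W (\<lambda>x. norm_q (g x))"
      using continuous_on_compose2[OF continuous_on_norm_q] f g by blast+
  qed (use segment_nonzero[OF nonpos] in auto)
  then show ?thesis
    using 1[OF f] 1[OF g] homotopic_with_trans homotopic_with_symD by blast
qed

lemma homotopic_in_cubics_p:
  fixes f g :: "'c::real_normed_vector \<Rightarrow> complex \<times> complex \<times> complex"
  assumes f: "continuous_on W f" "f \<in> W \<rightarrow> cubics_p" and g: "continuous_on W g" "g \<in> W \<rightarrow> cubics_p"
    and nonpos: "\<And>x. x \<in> W \<Longrightarrow> norm_p (g x) / norm_p (f x) \<notin> \<real>\<^sub>\<le>\<^sub>0"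
  shows "homotopic_with_canon (\<lambda>_. True) W separable_cubics f g"
proof -
  have 1: "homotopic_with_canon (\<lambda>_. True) W separable_cubics k (\<lambda>x. (0, norm_p (k x), 0))"
    if "continuous_on W k" "k \<in> W \<rightarrow> cubics_p" for k
    using homotopic_with_compose_continuous_right[OF homotopic_to_norm_p that] by (simp add: o_def)
  have "homotopic_with_canon (\<lambda>_. True) W separable_cubics
      (\<lambda>x. (0, norm_p (f x), 0)) (\<lambda>x. (0, norm_p (g x), 0))"
  proof (rule homotopic_linear_cubics)
    show "continuous_on W (\<lambda>x. norm_p (f x))" "continuous_on W (\<lambda>x. norm_p (g x))"
      using continuous_on_compose2[OF continuous_on_norm_p] f g by blast+
  qed (use segment_nonzero[OF nonpos] in auto)
  then show ?thesis
    using 1[OF f] 1[OF g] homotopic_with_trans homotopic_with_symD by blast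
qed

lemma continuous_on_norm_u: "continuous_on cubics_pq norm_u"
  unfolding norm_u_def using norm_p_nonzero
  by (intro continuous_intros continuous_on_subset[OF continuous_on_norm_p]
      continuous_on_subset[OF continuous_on_norm_q]) auto

text \<open>The segment is drawn in the parameter \<open>u\<close> of the cusp and not in
  \<open>(p, q)\<close>: along \<open>(u^2, u^3)\<close> the discriminant is \<open>2 * u^6\<close>,
  so \<open>u \<noteq> 0\<close> suffices.\<close>

lemma homotopic_in_cubics_pq:
  fixes f g :: "'c::real_normed_vector \<Rightarrow> complex \<times> complex \<times> complex"
  assumes f: "continuous_on W f" "f \<in> W \<rightarrow> cubics_pq" and g: "continuous_on W g" "g \<in> W \<rightarrow> cubics_pq"
    and nonpos: "\<And>x. x \<in> W \<Longrightarrow> norm_u (g x) / norm_u (f x) \<notin> \<real>\<^sub>\<le>\<^sub>0"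
  shows "homotopic_with_canon (\<lambda>_. True) W separable_cubics f g"
proof -
  have 1: "homotopic_with_canon (\<lambda>_. True) W separable_cubics k (\<lambda>x. (0, norm_p (k x), norm_q (k x)))"
    if "continuous_on W k" "k \<in> W \<rightarrow> cubics_pq" for k
    using homotopic_with_compose_continuous_right[OF homotopic_to_norm_both that] by (simp add: o_def)
  have 2: "homotopic_with_canon (\<lambda>_. True) W separable_cubics k (\<lambda>x. (0, norm_u (k x) ^ 2, norm_u (k x) ^ 3))"
    if "continuous_on W k" "k \<in> W \<rightarrow> cubics_pq" for k
    using norm_u_powers that(2) by (intro homotopic_with_eq[OF 1[OF that]]) (auto simp: Pi_iff)
  have "homotopic_with_canon (\<lambda>_. True) W (- {0}) (\<lambda>x. norm_u (f x)) (\<lambda>x. norm_u (g x))"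
  proof (rule homotopic_with_linear)
    show "continuous_on W (\<lambda>x. norm_u (f x))" "continuous_on W (\<lambda>x. norm_u (g x))"
      using continuous_on_compose2[OF continuous_on_norm_u] f g by blast+
    show "closed_segment (norm_u (f x)) (norm_u (g x)) \<subseteq> - {0}" if "x \<in> W" for x
      using segment_nonzero[OF nonpos[OF that]] by (force simp: closed_segment_def)
  qed
  from homotopic_with_compose_continuous_left[OF this, of "\<lambda>u. (0, u ^ 2, u ^ 3)" separable_cubics]
  have "homotopic_with_canon (\<lambda>_. True) W separable_cubics
      (\<lambda>x. (0, norm_u (f x) ^ 2, norm_u (f x) ^ 3)) (\<lambda>x. (0, norm_u (g x) ^ 2, norm_u (g x) ^ 3))"
    by (simp add: o_def Pi_iff separable_cubics_def continuous_intros power_mult[symmetric])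
  then show ?thesis
    using 2[OF f] 2[OF g] homotopic_with_trans homotopic_with_symD by blast
qed

text \<open>For equal discriminants, \<open>u = norm_q (f x) / norm_p (g x)\<close> would satisfy
  \<open>u^3 = norm_q (f x)\<close> and \<open>u^2 = norm_p (g x)\<close>. In general both equations
  fail by the quotient of the discriminants or its inverse, so segments correct them. Between
  \<open>(0, u^3)\<close> and \<open>(u^2, 0)\<close> the path runs through the generic orbit point
  \<open>(u^2, u^3)\<close>.\<close>

lemma homotopic_cubics_q_to_cubics_p:
  fixes f g :: "'c::real_normed_vector \<Rightarrow> complex \<times> complex \<times> complex"
  assumes f: "continuous_on W f" "f \<in> W \<rightarrow> cubics_q" and g: "continuous_on W g" "g \<in> W \<rightarrow> cubics_p"
    and nonpos: "\<And>x. x \<in> W \<Longrightarrow> cubic_disc (f x) / cubic_disc (g x) \<notin> \<real>\<^sub>\<le>\<^sub>0"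
  shows "homotopic_with_canon (\<lambda>_. True) W separable_cubics f g"
proof -
  define u where "u = (\<lambda>x. norm_q (f x) / norm_p (g x))"
  have cont: "continuous_on W (\<lambda>x. norm_q (f x))" "continuous_on W (\<lambda>x. norm_p (g x))"
    using continuous_on_compose2[OF continuous_on_norm_q] continuous_on_compose2[OF continuous_on_norm_p] f g
    by blast+
  have nz: "norm_q (f x) \<noteq> 0" "norm_p (g x) \<noteq> 0" "u x \<noteq> 0" if "x \<in> W" for x
    using norm_q_nonzero[of "f x"] norm_p_nonzero[of "g x"] f(2) g(2) that by (auto simp: u_def Pi_iff)
  have contu: "continuous_on W u"
    unfolding u_def by (intro continuous_intros cont ballI nz(2))
  have u3: "u x ^ 3 / norm_q (f x) = cubic_disc (f x) / cubic_disc (g x)"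
    and u2: "norm_p (g x) / u x ^ 2 = inverse (cubic_disc (f x) / cubic_disc (g x))" if "x \<in> W" for x
  proof -
    have q: "norm_q (f x) ^ 2 = cubic_disc (f x)" and p: "norm_p (g x) ^ 3 = cubic_disc (g x)"
      using norm_q_square'[of "f x"] norm_p_cube'[of "g x"] f(2) g(2) that by (auto simp: Pi_iff)
    show "u x ^ 3 / norm_q (f x) = cubic_disc (f x) / cubic_disc (g x)"
      unfolding p[symmetric] q[symmetric] using nz[OF that]
      by (simp add: u_def power_divide power3_eq_cube power2_eq_square)
    show "norm_p (g x) / u x ^ 2 = inverse (cubic_disc (f x) / cubic_disc (g x))"
      unfolding p[symmetric] q[symmetric] using nz[OF that]
      by (simp add: u_def power_divide power3_eq_cube power2_eq_square)
  qed
  have "homotopic_with_canon (\<lambda>_. True) W separable_cubics f (\<lambda>x. (0, 0, norm_q (f x)))"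
    using homotopic_with_compose_continuous_right[OF homotopic_to_norm_q f] by (simp add: o_def)
  moreover have "homotopic_with_canon (\<lambda>_. True) W separable_cubics (\<lambda>x. (0, 0, norm_q (f x))) (\<lambda>x. (0, 0, u x ^ 3))"
  proof (rule homotopic_linear_cubics)
    fix x and t :: real assume "x \<in> W" "0 \<le> t" "t \<le> 1"
    then show "((1 - t) *\<^sub>R 0 + t *\<^sub>R 0) ^ 3 + ((1 - t) *\<^sub>R norm_q (f x) + t *\<^sub>R u x ^ 3) ^ 2 \<noteq> 0"
      using segment_nonzero[of "u x ^ 3" "norm_q (f x)" t] nonpos u3 by simp
  qed (intro continuous_intros cont contu)+
  moreover have "homotopic_with_canon (\<lambda>_. True) W separable_cubics (\<lambda>x. (0, 0, u x ^ 3)) (\<lambda>x. (0, u x ^ 2, u x ^ 3))"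
  proof (rule homotopic_linear_cubics)
    fix x and t :: real assume x: "x \<in> W" and t: "0 \<le> t" "t \<le> 1"
    \<comment> \<open>Both summands are nonnegative real multiples of \<open>u x ^ 6\<close>, so
      they cannot cancel.\<close>
    have "((1 - t) *\<^sub>R 0 + t *\<^sub>R u x ^ 2) ^ 3 + ((1 - t) *\<^sub>R u x ^ 3 + t *\<^sub>R u x ^ 3) ^ 2 =
        of_real (t ^ 3 + 1) * u x ^ 6"
      unfolding scaleR_left_distrib[symmetric]
      by (simp add: scaleR_conv_of_real power_mult_distrib power_mult[symmetric] distrib_right)
    also have "\<dots> \<noteq> 0"
      using t nz[OF x] add_nonneg_pos[of "t ^ 3" 1] by (simp del: of_real_add)
    finally show "((1 - t) *\<^sub>R 0 + t *\<^sub>R u x ^ 2) ^ 3 + ((1 - t) *\<^sub>R u x ^ 3 + t *\<^sub>R u x ^ 3) ^ 2 \<noteq> 0" .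
  qed (intro continuous_intros contu)+
  moreover have "homotopic_with_canon (\<lambda>_. True) W separable_cubics (\<lambda>x. (0, u x ^ 2, u x ^ 3)) (\<lambda>x. (0, u x ^ 2, 0))"
  proof (rule homotopic_linear_cubics)
    fix x and t :: real assume x: "x \<in> W" and t: "0 \<le> t" "t \<le> 1"
    have "((1 - t) *\<^sub>R u x ^ 2 + t *\<^sub>R u x ^ 2) ^ 3 + ((1 - t) *\<^sub>R u x ^ 3 + t *\<^sub>R 0) ^ 2 =
        of_real ((1 - t) ^ 2 + 1) * u x ^ 6"
      unfolding scaleR_left_distrib[symmetric]
      by (simp add: scaleR_conv_of_real power_mult_distrib power_mult[symmetric] distrib_right)
    also have "\<dots> \<noteq> 0"
      using nz[OF x] add_nonneg_pos[of "(1 - t) ^ 2" 1] by (simp del: of_real_add)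
    finally show "((1 - t) *\<^sub>R u x ^ 2 + t *\<^sub>R u x ^ 2) ^ 3 + ((1 - t) *\<^sub>R u x ^ 3 + t *\<^sub>R 0) ^ 2 \<noteq> 0" .
  qed (intro continuous_intros contu)+
  moreover have "homotopic_with_canon (\<lambda>_. True) W separable_cubics (\<lambda>x. (0, u x ^ 2, 0)) (\<lambda>x. (0, norm_p (g x), 0))"
  proof (rule homotopic_linear_cubics)
    fix x and t :: real assume x: "x \<in> W" and t: "0 \<le> t" "t \<le> 1"
    have "norm_p (g x) / u x ^ 2 \<notin> \<real>\<^sub>\<le>\<^sub>0"
      unfolding u2[OF x] using nonpos[OF x] by (simp only: nonpos_Reals_inverse_iff not_False_eq_True)
    then show "((1 - t) *\<^sub>R u x ^ 2 + t *\<^sub>R norm_p (g x)) ^ 3 + ((1 - t) *\<^sub>R 0 + t *\<^sub>R 0) ^ 2 \<noteq> 0"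
      using segment_nonzero t by simp
  qed (intro continuous_intros cont contu)+
  moreover have "homotopic_with_canon (\<lambda>_. True) W separable_cubics (\<lambda>x. (0, norm_p (g x), 0)) g"
    using homotopic_with_compose_continuous_right[OF homotopic_to_norm_p g]
    by (simp add: o_def homotopic_with_sym)
  ultimately show ?thesis
    by (meson homotopic_with_trans)
qed

section \<open>Rotation of the first point\<close>

lemma continuous_on_rotate_cubic: "continuous_on A (rotate_cubic w)"
  unfolding rotate_cubic_def case_prod_beta by (intro continuous_intros)

lemma homotopic_rotate_cubic:
  "homotopic_with_canon (\<lambda>_. True) separable_cubics separable_cubics id (rotate_cubic (exp (complex_of_real s * \<i>)))"
  unfolding homotopic_with_canon_iff
proof (intro exI conjI ballI)
  let ?h = "\<lambda>(t :: real, x). rotate_cubic (exp (complex_of_real (t * s) * \<i>)) x"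
  show "continuous_on ({0..1} \<times> separable_cubics) ?h"
    unfolding rotate_cubic_def case_prod_beta by (intro continuous_intros)
  show "?h \<in> {0..1} \<times> separable_cubics \<rightarrow> separable_cubics"
    by (auto simp: rotate_cubic_in)
qed (auto simp: rotate_cubic_def)

text \<open>A planner that is defined where \<open>F\<close> avoids the nonpositive reals is applied
  after rotating the first point; the rotation itself is undone by a homotopy to the identity. The
  open set \<open>D\<close> comes from the open conditions on the rotated pair.\<close>

lemma rotated_path_section:
  assumes N: "openin (top_of_set separable_cubics) N\<^sub>1" "openin (top_of_set separable_cubics) N\<^sub>2"
    and F: "continuous_on (N\<^sub>1 \<times> N\<^sub>2) F"
    and hom: "homotopic_with_canon (\<lambda>_. True) (N\<^sub>1 \<times> N\<^sub>2 \<inter> F -` (- \<real>\<^sub>\<le>\<^sub>0)) separable_cubics fst snd"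
    and \<sigma>: "\<sigma> \<subseteq> separable_cubics \<times> separable_cubics"
    and cond: "\<And>z. z \<in> \<sigma> \<Longrightarrow> rotate_cubic (exp (complex_of_real s * \<i>)) (fst z) \<in> N\<^sub>1 \<and> snd z \<in> N\<^sub>2 \<and>
        F (rotate_cubic (exp (complex_of_real s * \<i>)) (fst z), snd z) \<notin> (\<real>\<^sub>\<le>\<^sub>0 :: complex set)"
  shows "\<exists>D. openin (top_of_set (separable_cubics \<times> separable_cubics)) D \<and> \<sigma> \<subseteq> D \<and>
      homotopic_with_canon (\<lambda>_. True) D separable_cubics fst snd"
proof -
  let ?S = separable_cubics and ?r = "rotate_cubic (exp (complex_of_real s * \<i>))"
  define V where "V = N\<^sub>1 \<times> N\<^sub>2 \<inter> F -` (- \<real>\<^sub>\<le>\<^sub>0)"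
  define \<Phi> where "\<Phi> = (\<lambda>z. (?r (fst z), snd z :: complex \<times> complex \<times> complex))"
  define D where "D = (?S \<times> ?S) \<inter> \<Phi> -` V"
  have "openin (top_of_set (N\<^sub>1 \<times> N\<^sub>2)) V"
    unfolding V_def using F by (intro continuous_openin_preimage_gen open_Compl) auto
  then have V: "openin (top_of_set (?S \<times> ?S)) V"
    using openin_Times[OF N] openin_trans by blast
  have \<Phi>: "continuous_on (?S \<times> ?S) \<Phi>"
    unfolding \<Phi>_def
    by (intro continuous_intros continuous_on_compose2[OF continuous_on_rotate_cubic[of UNIV]]) auto
  have \<Phi>_im: "\<Phi> \<in> ?S \<times> ?S \<rightarrow> ?S \<times> ?S"
    by (auto simp: \<Phi>_def rotate_cubic_in)
  have "openin (top_of_set (?S \<times> ?S)) D"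
    unfolding D_def by (rule continuous_openin_preimage[OF \<Phi> \<Phi>_im V])
  moreover have "\<sigma> \<subseteq> D"
    using \<sigma> cond by (auto simp: D_def V_def \<Phi>_def)
  moreover have "homotopic_with_canon (\<lambda>_. True) D ?S fst snd"
  proof -
    have "homotopic_with_canon (\<lambda>_. True) D ?S (fst \<circ> \<Phi>) (snd \<circ> \<Phi>)"
      by (rule homotopic_with_compose_continuous_right[OF hom])
        (auto simp: D_def V_def intro: continuous_on_subset[OF \<Phi>])
    then have "homotopic_with_canon (\<lambda>_. True) D ?S (\<lambda>z. ?r (fst z)) snd"
      by (simp add: \<Phi>_def o_def)
    moreover have "homotopic_with_canon (\<lambda>_. True) D ?S (id \<circ> fst) (?r \<circ> fst)"
      by (rule homotopic_with_compose_continuous_right[OF homotopic_rotate_cubic])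
        (auto simp: D_def intro: continuous_intros)
    ultimately show ?thesis
      by (simp add: o_def) (blast intro: homotopic_with_trans)
  qed
  ultimately show ?thesis by blast
qed

section \<open>Strata and their motion planners\<close>

definition cubic_region :: "complex \<times> complex \<times> complex \<Rightarrow> nat" where
  "cubic_region x = (if Re (share_p x) \<le> 0 then 1 else if Re (share_q x) \<le> 0 then 2 else 0)"

text \<open>Alignment is phrased with the closed set of nonnegative reals, to be a closed condition;
  for separable cubics the quotient is nonzero, so it amounts to positivity.\<close>

definition cubic_stratum :: "nat \<times> nat \<times> bool \<Rightarrow> ((complex \<times> complex \<times> complex) \<times> (complex \<times> complex \<times> complex)) set" where
  "cubic_stratum = (\<lambda>(a, b, c). {z \<in> separable_cubics \<times> separable_cubics.
     cubic_region (fst z) = a \<and> cubic_region (snd z) = b \<and>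
     (cubic_disc (snd z) / cubic_disc (fst z) \<in> \<real>\<^sub>\<ge>\<^sub>0) = c})"

definition stratum_level :: "nat \<times> nat \<times> bool \<Rightarrow> nat" where
  "stratum_level = (\<lambda>(a, b, c). of_bool (a \<noteq> 0) + of_bool (b \<noteq> 0) + of_bool c)"

lemma share_Re_sum: "x \<in> separable_cubics \<Longrightarrow> Re (share_p x) + Re (share_q x) = 1"
  using share_sum by (metis one_complex.simps(1) plus_complex.simps(1))

lemma cubic_region_imp:
  assumes "x \<in> separable_cubics"
  shows "cubic_region x = 0 \<Longrightarrow> x \<in> cubics_pq" "cubic_region x \<noteq> 2 \<Longrightarrow> x \<in> cubics_q"
    "cubic_region x \<noteq> 1 \<Longrightarrow> x \<in> cubics_p"
  using assms share_Re_sum[OF assms] by (auto simp: cubic_region_def split: if_splits)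

lemma closure_subset_of_closedin:
  "closedin (top_of_set Z) C \<Longrightarrow> A \<subseteq> C \<Longrightarrow> z \<in> closure A \<Longrightarrow> z \<in> Z \<Longrightarrow> z \<in> C"
  by (metis IntI closedin_closed closure_minimal le_inf_iff subsetD)

lemma closedin_cubic_region:
  "closedin (top_of_set separable_cubics) {x \<in> separable_cubics. cubic_region x = 1}"
  "closedin (top_of_set separable_cubics) {x \<in> separable_cubics. cubic_region x = 2}"
proof -
  have "{x \<in> separable_cubics. cubic_region x = 1} = separable_cubics \<inter> share_p -` {z. Re z \<le> 0}"
    "{x \<in> separable_cubics. cubic_region x = 2} = separable_cubics \<inter> share_q -` {z. Re z \<le> 0}"
    using share_Re_sum by (force simp: cubic_region_def)+
  then show "closedin (top_of_set separable_cubics) {x \<in> separable_cubics. cubic_region x = 1}"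
    "closedin (top_of_set separable_cubics) {x \<in> separable_cubics. cubic_region x = 2}"
    using continuous_closedin_preimage[OF continuous_on_share(1) closed_halfspace_Re_le]
      continuous_closedin_preimage[OF continuous_on_share(2) closed_halfspace_Re_le] by simp_all
qed

lemma cubic_stratum_closure:
  assumes z: "z \<in> closure (cubic_stratum (a, b, c))" "z \<in> separable_cubics \<times> separable_cubics"
  shows "a \<in> {1, 2} \<Longrightarrow> cubic_region (fst z) = a" "b \<in> {1, 2} \<Longrightarrow> cubic_region (snd z) = b"
    "c \<Longrightarrow> cubic_disc (snd z) / cubic_disc (fst z) \<in> \<real>\<^sub>\<ge>\<^sub>0"
proof -
  let ?Z = "separable_cubics \<times> separable_cubics"
  show "cubic_region (fst z) = a" if "a \<in> {1, 2}"
  proof -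
    have "closedin (top_of_set ?Z) ({x \<in> separable_cubics. cubic_region x = a} \<times> separable_cubics)"
      using that closedin_cubic_region by (intro closedin_Times) auto
    moreover have "cubic_stratum (a, b, c) \<subseteq> {x \<in> separable_cubics. cubic_region x = a} \<times> separable_cubics"
      by (auto simp: cubic_stratum_def)
    ultimately show ?thesis
      using closure_subset_of_closedin[OF _ _ z] by fastforce
  qed
  show "cubic_region (snd z) = b" if "b \<in> {1, 2}"
  proof -
    have "closedin (top_of_set ?Z) (separable_cubics \<times> {x \<in> separable_cubics. cubic_region x = b})"
      using that closedin_cubic_region by (intro closedin_Times) auto
    moreover have "cubic_stratum (a, b, c) \<subseteq> separable_cubics \<times> {x \<in> separable_cubics. cubic_region x = b}"
      by (auto simp: cubic_stratum_def)
    ultimately show ?thesis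
      using closure_subset_of_closedin[OF _ _ z] by fastforce
  qed
  show "cubic_disc (snd z) / cubic_disc (fst z) \<in> \<real>\<^sub>\<ge>\<^sub>0" if c
  proof -
    have "continuous_on ?Z (\<lambda>z. cubic_disc (snd z) / cubic_disc (fst z))"
      by (intro continuous_intros) (auto simp: separable_cubics_iff)
    then have "closedin (top_of_set ?Z) (?Z \<inter> (\<lambda>z. cubic_disc (snd z) / cubic_disc (fst z)) -` \<real>\<^sub>\<ge>\<^sub>0)"
      by (rule continuous_closedin_preimage) simp
    moreover have "cubic_stratum (a, b, c) \<subseteq> ?Z \<inter> (\<lambda>z. cubic_disc (snd z) / cubic_disc (fst z)) -` \<real>\<^sub>\<ge>\<^sub>0"
      using that by (auto simp: cubic_stratum_def)
    ultimately show ?thesis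
      using closure_subset_of_closedin[OF _ _ z] by blast
  qed
qed

text \<open>The regions 1 and 2 and alignment are closed conditions, so they persist in the closure,
  where further ones can only be added. Each of them contributes 1 to the level; equal levels
  therefore leave no room for a different stratum.\<close>

lemma cubic_strata_separated:
  assumes ne: "(a, b, c) \<noteq> (a', b', c')" and lev: "stratum_level (a, b, c) = stratum_level (a', b', c')"
    and ab: "a \<in> {0, 1, 2}" "b \<in> {0, 1, 2}" "a' \<in> {0, 1, 2}" "b' \<in> {0, 1, 2}"
  shows "cubic_stratum (a, b, c) \<inter> closure (cubic_stratum (a', b', c')) = {}"
proof (rule ccontr)
  assume "cubic_stratum (a, b, c) \<inter> closure (cubic_stratum (a', b', c')) \<noteq> {}"
  then obtain z where z: "z \<in> cubic_stratum (a, b, c)" "z \<in> closure (cubic_stratum (a', b', c'))" by blast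
  then have zZ: "z \<in> separable_cubics \<times> separable_cubics"
    by (auto simp: cubic_stratum_def)
  have "a' \<noteq> 0 \<longrightarrow> a = a'" "b' \<noteq> 0 \<longrightarrow> b = b'" "c' \<longrightarrow> c"
    using cubic_stratum_closure[OF z(2) zZ] z(1) ab by (auto simp: cubic_stratum_def)
  then show False
    using ne lev by (cases c'; auto simp: stratum_level_def of_bool_def split: if_splits)
qed

text \<open>The discriminant has weight 6 under the rotation, so the angle \<open>pi / 6\<close>
  reverses its sign.\<close>

definition \<omega> :: "bool \<Rightarrow> complex" where
  "\<omega> r = exp (complex_of_real (if r then pi / 6 else 0) * \<i>)"

lemma \<omega>_power: "\<omega> r ^ 6 = (if r then - 1 else 1)"
proof -
  have "exp (complex_of_real (pi / 6) * \<i>) ^ 6 = exp (6 * (complex_of_real (pi / 6) * \<i>))"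
    by (simp add: exp_of_nat_mult[symmetric])
  also have "6 * (complex_of_real (pi / 6) * \<i>) = pi * \<i>"
    by simp
  finally show ?thesis
    by (simp add: \<omega>_def)
qed

lemma \<omega>_nonzero: "\<omega> r \<noteq> 0"
  by (simp add: \<omega>_def)

lemma \<omega>_rotated_path_section:
  assumes "openin (top_of_set separable_cubics) N\<^sub>1" "openin (top_of_set separable_cubics) N\<^sub>2"
    and "continuous_on (N\<^sub>1 \<times> N\<^sub>2) F"
    and "homotopic_with_canon (\<lambda>_. True) (N\<^sub>1 \<times> N\<^sub>2 \<inter> F -` (- \<real>\<^sub>\<le>\<^sub>0)) separable_cubics fst snd"
    and "\<sigma> \<subseteq> separable_cubics \<times> separable_cubics"
    and "\<And>z. z \<in> \<sigma> \<Longrightarrow> rotate_cubic (\<omega> r) (fst z) \<in> N\<^sub>1 \<and> snd z \<in> N\<^sub>2 \<and>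
        F (rotate_cubic (\<omega> r) (fst z), snd z) \<notin> (\<real>\<^sub>\<le>\<^sub>0 :: complex set)"
  shows "\<exists>D. openin (top_of_set (separable_cubics \<times> separable_cubics)) D \<and> \<sigma> \<subseteq> D \<and>
      homotopic_with_canon (\<lambda>_. True) D separable_cubics fst snd"
  using rotated_path_section[OF assms(1-5)] assms(6) unfolding \<omega>_def by blast

lemma disc_ratio_aligned_iff:
  assumes z: "fst z \<in> separable_cubics" "snd z \<in> separable_cubics"
    and s: "cubic_disc (snd z) = of_real s * cubic_disc (rotate_cubic (\<omega> r) (fst z))"
  shows "cubic_disc (snd z) / cubic_disc (fst z) \<in> \<real>\<^sub>\<ge>\<^sub>0 \<longleftrightarrow> (if r then s < 0 else s > 0)"
proof -
  have nz: "cubic_disc (fst z) \<noteq> 0" "cubic_disc (snd z) \<noteq> 0"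
    using z by (auto simp: separable_cubics_iff)
  then have s0: "s \<noteq> 0" using s by auto
  have "cubic_disc (snd z) / cubic_disc (fst z) = of_real (if r then - s else s)"
    using nz(1) by (simp add: s cubic_disc_rotate \<omega>_power)
  then show ?thesis
    using s0 by (simp only: nonneg_Reals_of_real_iff) auto
qed

lemma nonpos_RealsE:
  assumes "z \<in> (\<real>\<^sub>\<le>\<^sub>0 :: complex set)"
  obtains k where "z = of_real k" "k \<le> 0"
  using assms by (metis nonpos_Reals_cases)

text \<open>In each case the planner fails only for a nonpositive real quotient k of normal forms,
  which fixes the sign of the quotient of the discriminants. The rotation is applied exactly when
  this sign would otherwise be compatible with \<open>c\<close>.\<close>

lemma cubic_stratum_path_section:
  assumes ab: "a \<in> {0, 1, 2}" "b \<in> {0, 1, 2}"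
  shows "\<exists>D. openin (top_of_set (separable_cubics \<times> separable_cubics)) D \<and> cubic_stratum (a, b, c) \<subseteq> D \<and>
      homotopic_with_canon (\<lambda>_. True) D separable_cubics fst snd" (is ?goal)
proof -
  let ?\<sigma> = "cubic_stratum (a, b, c)" and ?S = separable_cubics
  have \<sigma>: "?\<sigma> \<subseteq> ?S \<times> ?S"
    by (auto simp: cubic_stratum_def)
  have oppq: "openin (top_of_set ?S) cubics_pq"
    using openin_Int[OF openin_share_pos] by (simp add: Int_def conj_ac)
  have al: "cubic_disc (snd z) / cubic_disc (fst z) \<in> \<real>\<^sub>\<ge>\<^sub>0 \<longleftrightarrow> c" if "z \<in> ?\<sigma>" for z
    using that by (auto simp: cubic_stratum_def)
  have zS: "fst z \<in> ?S" "snd z \<in> ?S" if "z \<in> ?\<sigma>" for z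
    using that \<sigma> by auto
  have reg: "cubic_region (fst z) = a" "cubic_region (snd z) = b" if "z \<in> ?\<sigma>" for z
    using that by (auto simp: cubic_stratum_def)
  have rot: "rotate_cubic (\<omega> r) x \<in> cubics_p \<longleftrightarrow> x \<in> cubics_p"
    "rotate_cubic (\<omega> r) x \<in> cubics_q \<longleftrightarrow> x \<in> cubics_q"
    "rotate_cubic (\<omega> r) x \<in> cubics_pq \<longleftrightarrow> x \<in> cubics_pq" for r x
    using \<omega>_nonzero[of r] by (simp_all add: rotate_cubic_in share_rotate)
  note sec = \<omega>_rotated_path_section[OF _ _ _ _ \<sigma>]
  consider "a = 0" "b = 0" | "a \<noteq> 2" "b \<noteq> 2" "a = 1 \<or> b = 1" | "a \<noteq> 1" "b \<noteq> 1" "a = 2 \<or> b = 2"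
    | "a = 1" "b = 2" | "a = 2" "b = 1"
    using ab by auto
  then show ?goal
  proof cases
    case 1
    \<comment> \<open>Both points are generic: the discriminants differ by \<open>k^6\<close>, which
      is positive, so aligned pairs are rotated.\<close>
    show ?goal
    proof (rule sec[where N\<^sub>1 = cubics_pq and N\<^sub>2 = cubics_pq and F = "\<lambda>z. norm_u (snd z) / norm_u (fst z)" and r = c])
      show "continuous_on (cubics_pq \<times> cubics_pq) (\<lambda>z. norm_u (snd z) / norm_u (fst z))"
        using norm_u_powers(4)
        by (intro continuous_intros continuous_on_compose2[OF continuous_on_norm_u]) auto
      show "homotopic_with_canon (\<lambda>_. True) (cubics_pq \<times> cubics_pq \<inter>
          (\<lambda>z. norm_u (snd z) / norm_u (fst z)) -` (- \<real>\<^sub>\<le>\<^sub>0)) ?S fst snd"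
        by (rule homotopic_in_cubics_pq) (auto intro!: continuous_intros)
      fix z assume z: "z \<in> ?\<sigma>"
      let ?x = "rotate_cubic (\<omega> c) (fst z)"
      have x: "?x \<in> cubics_pq" and y: "snd z \<in> cubics_pq"
        unfolding rot using cubic_region_imp(1)[OF zS(1)[OF z]] cubic_region_imp(1)[OF zS(2)[OF z]] 1 reg[OF z] by simp_all
      moreover have "norm_u (snd z) / norm_u ?x \<notin> \<real>\<^sub>\<le>\<^sub>0"
      proof
        assume "norm_u (snd z) / norm_u ?x \<in> \<real>\<^sub>\<le>\<^sub>0"
        then obtain k where k: "norm_u (snd z) / norm_u ?x = of_real k" "k \<le> 0"
          by (rule nonpos_RealsE)
        then have "norm_u (snd z) = of_real k * norm_u ?x"
          using norm_u_powers(4)[OF x] by (simp add: field_simps)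
        then have eq: "cubic_disc (snd z) = of_real (k ^ 6) * cubic_disc ?x"
          by (simp add: norm_u_powers(3)[OF x, symmetric] norm_u_powers(3)[OF y, symmetric] power_mult_distrib)
        have "k \<noteq> 0"
          using k norm_u_powers(4)[OF x] norm_u_powers(4)[OF y] by auto
        then have pos: "k ^ 6 > 0"
          by (simp add: zero_less_power_eq)
        show False
          using disc_ratio_aligned_iff[OF zS[OF z] eq] al[OF z] pos by (cases c) simp_all
      qed
      ultimately show "?x \<in> cubics_pq \<and> snd z \<in> cubics_pq \<and>
          norm_u (snd (?x, snd z)) / norm_u (fst (?x, snd z)) \<notin> \<real>\<^sub>\<le>\<^sub>0"
        by simp
    qed (rule oppq)+
  next
    case 2
    \<comment> \<open>No point is near \<open>q = 0\<close>, so both lie in \<open>cubics_q\<close>: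
      the factor \<open>k^2\<close> is positive, and again aligned pairs are rotated.\<close>
    show ?goal
    proof (rule sec[where N\<^sub>1 = cubics_q and N\<^sub>2 = cubics_q and F = "\<lambda>z. norm_q (snd z) / norm_q (fst z)" and r = c])
      show "continuous_on (cubics_q \<times> cubics_q) (\<lambda>z. norm_q (snd z) / norm_q (fst z))"
        using norm_q_nonzero
        by (intro continuous_intros continuous_on_compose2[OF continuous_on_norm_q]) auto
      show "homotopic_with_canon (\<lambda>_. True) (cubics_q \<times> cubics_q \<inter>
          (\<lambda>z. norm_q (snd z) / norm_q (fst z)) -` (- \<real>\<^sub>\<le>\<^sub>0)) ?S fst snd"
        by (rule homotopic_in_cubics_q) (auto intro!: continuous_intros)
      fix z assume z: "z \<in> ?\<sigma>"
      let ?x = "rotate_cubic (\<omega> c) (fst z)"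
      have x: "?x \<in> cubics_q" and y: "snd z \<in> cubics_q"
        unfolding rot using cubic_region_imp(2)[OF zS(1)[OF z]] cubic_region_imp(2)[OF zS(2)[OF z]] 2 reg[OF z] by simp_all
      moreover have "norm_q (snd z) / norm_q ?x \<notin> \<real>\<^sub>\<le>\<^sub>0"
      proof
        assume "norm_q (snd z) / norm_q ?x \<in> \<real>\<^sub>\<le>\<^sub>0"
        then obtain k where k: "norm_q (snd z) / norm_q ?x = of_real k" "k \<le> 0"
          by (rule nonpos_RealsE)
        then have "norm_q (snd z) = of_real k * norm_q ?x"
          using norm_q_nonzero[OF x] by (simp add: field_simps)
        then have eq: "cubic_disc (snd z) = of_real (k ^ 2) * cubic_disc ?x"
          by (simp add: norm_q_square'[OF x, symmetric] norm_q_square'[OF y, symmetric] power_mult_distrib)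
        have "k \<noteq> 0"
          using k norm_q_nonzero[OF x] norm_q_nonzero[OF y] by auto
        then have pos: "k ^ 2 > 0" by simp
        show False
          using disc_ratio_aligned_iff[OF zS[OF z] eq] al[OF z] pos by (cases c) simp_all
      qed
      ultimately show "?x \<in> cubics_q \<and> snd z \<in> cubics_q \<and>
          norm_q (snd (?x, snd z)) / norm_q (fst (?x, snd z)) \<notin> \<real>\<^sub>\<le>\<^sub>0"
        by simp
    qed (rule openin_share_pos)+
  next
    case 3
    \<comment> \<open>No point is near \<open>p = 0\<close>: the factor \<open>k^3\<close> is
      negative, an odd power, so the pairs that are not aligned are rotated.\<close>
    show ?goal
    proof (rule sec[where N\<^sub>1 = cubics_p and N\<^sub>2 = cubics_p and F = "\<lambda>z. norm_p (snd z) / norm_p (fst z)" and r = "\<not> c"])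
      show "continuous_on (cubics_p \<times> cubics_p) (\<lambda>z. norm_p (snd z) / norm_p (fst z))"
        using norm_p_nonzero
        by (intro continuous_intros continuous_on_compose2[OF continuous_on_norm_p]) auto
      show "homotopic_with_canon (\<lambda>_. True) (cubics_p \<times> cubics_p \<inter>
          (\<lambda>z. norm_p (snd z) / norm_p (fst z)) -` (- \<real>\<^sub>\<le>\<^sub>0)) ?S fst snd"
        by (rule homotopic_in_cubics_p) (auto intro!: continuous_intros)
      fix z assume z: "z \<in> ?\<sigma>"
      let ?x = "rotate_cubic (\<omega> (\<not> c)) (fst z)"
      have x: "?x \<in> cubics_p" and y: "snd z \<in> cubics_p"
        unfolding rot using cubic_region_imp(3)[OF zS(1)[OF z]] cubic_region_imp(3)[OF zS(2)[OF z]] 3 reg[OF z] by simp_all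
      moreover have "norm_p (snd z) / norm_p ?x \<notin> \<real>\<^sub>\<le>\<^sub>0"
      proof
        assume "norm_p (snd z) / norm_p ?x \<in> \<real>\<^sub>\<le>\<^sub>0"
        then obtain k where k: "norm_p (snd z) / norm_p ?x = of_real k" "k \<le> 0"
          by (rule nonpos_RealsE)
        then have "norm_p (snd z) = of_real k * norm_p ?x"
          using norm_p_nonzero[OF x] by (simp add: field_simps)
        then have eq: "cubic_disc (snd z) = of_real (k ^ 3) * cubic_disc ?x"
          by (simp add: norm_p_cube'[OF x, symmetric] norm_p_cube'[OF y, symmetric] power_mult_distrib)
        have "k \<noteq> 0"
          using k norm_p_nonzero[OF x] norm_p_nonzero[OF y] by auto
        then have pos: "k ^ 3 < 0" using k(2) by (simp add: power_less_zero_eq)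
        show False
          using disc_ratio_aligned_iff[OF zS[OF z] eq] al[OF z] pos by (cases c) simp_all
      qed
      ultimately show "?x \<in> cubics_p \<and> snd z \<in> cubics_p \<and>
          norm_p (snd (?x, snd z)) / norm_p (fst (?x, snd z)) \<notin> \<real>\<^sub>\<le>\<^sub>0"
        by simp
    qed (rule openin_share_pos)+
  next
    case 4
    \<comment> \<open>The points are near different exceptional orbits: the failing quotient is that
      of the discriminants themselves, of exponent 1, so the parity is odd.\<close>
    show ?goal
    proof (rule sec[where N\<^sub>1 = cubics_q and N\<^sub>2 = cubics_p and F = "\<lambda>z. cubic_disc (fst z) / cubic_disc (snd z)" and r = "\<not> c"])
      show "continuous_on (cubics_q \<times> cubics_p) (\<lambda>z. cubic_disc (fst z) / cubic_disc (snd z))"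
        by (intro continuous_intros) (auto simp: separable_cubics_iff)
      show "homotopic_with_canon (\<lambda>_. True) (cubics_q \<times> cubics_p \<inter>
          (\<lambda>z. cubic_disc (fst z) / cubic_disc (snd z)) -` (- \<real>\<^sub>\<le>\<^sub>0)) ?S fst snd"
        by (rule homotopic_cubics_q_to_cubics_p) (auto intro!: continuous_intros)
      fix z assume z: "z \<in> ?\<sigma>"
      let ?x = "rotate_cubic (\<omega> (\<not> c)) (fst z)"
      have x: "?x \<in> cubics_q" and y: "snd z \<in> cubics_p"
        unfolding rot using cubic_region_imp(2)[OF zS(1)[OF z]] cubic_region_imp(3)[OF zS(2)[OF z]] 4 reg[OF z] by simp_all
      moreover have "cubic_disc ?x / cubic_disc (snd z) \<notin> \<real>\<^sub>\<le>\<^sub>0"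
      proof
        assume "cubic_disc ?x / cubic_disc (snd z) \<in> \<real>\<^sub>\<le>\<^sub>0"
        then obtain k where k: "cubic_disc ?x / cubic_disc (snd z) = of_real k" "k \<le> 0"
          by (rule nonpos_RealsE)
        have "k \<noteq> 0"
          using k x y by (auto simp: separable_cubics_iff)
        then have eq: "cubic_disc (snd z) = of_real (inverse k) * cubic_disc ?x" and neg: "inverse k < 0"
          using k x y by (auto simp: separable_cubics_iff field_simps)
        show False
          using disc_ratio_aligned_iff[OF zS[OF z] eq] al[OF z] neg by (cases c) simp_all
      qed
      ultimately show "?x \<in> cubics_q \<and> snd z \<in> cubics_p \<and>
          cubic_disc (fst (?x, snd z)) / cubic_disc (snd (?x, snd z)) \<notin> \<real>\<^sub>\<le>\<^sub>0"
        by simp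
    qed (rule openin_share_pos)+
  next
    case 5
    \<comment> \<open>The mirror image of the preceding case: the planner from
      \<open>cubics_q\<close> to \<open>cubics_p\<close> runs backwards.\<close>
    show ?goal
    proof (rule sec[where N\<^sub>1 = cubics_p and N\<^sub>2 = cubics_q and F = "\<lambda>z. cubic_disc (snd z) / cubic_disc (fst z)" and r = "\<not> c"])
      show "continuous_on (cubics_p \<times> cubics_q) (\<lambda>z. cubic_disc (snd z) / cubic_disc (fst z))"
        by (intro continuous_intros) (auto simp: separable_cubics_iff)
      have "homotopic_with_canon (\<lambda>_. True) (cubics_p \<times> cubics_q \<inter>
          (\<lambda>z. cubic_disc (snd z) / cubic_disc (fst z)) -` (- \<real>\<^sub>\<le>\<^sub>0)) ?S snd fst"
        by (rule homotopic_cubics_q_to_cubics_p) (auto intro!: continuous_intros)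
      then show "homotopic_with_canon (\<lambda>_. True) (cubics_p \<times> cubics_q \<inter>
          (\<lambda>z. cubic_disc (snd z) / cubic_disc (fst z)) -` (- \<real>\<^sub>\<le>\<^sub>0)) ?S fst snd"
        by (rule homotopic_with_symD)
      fix z assume z: "z \<in> ?\<sigma>"
      let ?x = "rotate_cubic (\<omega> (\<not> c)) (fst z)"
      have x: "?x \<in> cubics_p" and y: "snd z \<in> cubics_q"
        unfolding rot using cubic_region_imp(3)[OF zS(1)[OF z]] cubic_region_imp(2)[OF zS(2)[OF z]] 5 reg[OF z] by simp_all
      moreover have "cubic_disc (snd z) / cubic_disc ?x \<notin> \<real>\<^sub>\<le>\<^sub>0"
      proof
        assume "cubic_disc (snd z) / cubic_disc ?x \<in> \<real>\<^sub>\<le>\<^sub>0"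
        then obtain k where k: "cubic_disc (snd z) / cubic_disc ?x = of_real k" "k \<le> 0"
          by (rule nonpos_RealsE)
        have "k \<noteq> 0"
          using k x y by (auto simp: separable_cubics_iff)
        then have eq: "cubic_disc (snd z) = of_real k * cubic_disc ?x" and neg: "k < 0"
          using k x y by (auto simp: separable_cubics_iff field_simps)
        show False
          using disc_ratio_aligned_iff[OF zS[OF z] eq] al[OF z] neg by (cases c) simp_all
      qed
      ultimately show "?x \<in> cubics_p \<and> snd z \<in> cubics_q \<and>
          cubic_disc (snd (?x, snd z)) / cubic_disc (fst (?x, snd z)) \<notin> \<real>\<^sub>\<le>\<^sub>0"
        by simp
    qed (rule openin_share_pos)+
  qed
qed

lemma TC_separable_cubics_le: "TC (top_of_set separable_cubics) \<le> 3"
proof -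
  let ?X = "top_of_set separable_cubics" and ?Z = "separable_cubics \<times> separable_cubics"
  let ?J = "{0, 1, 2} \<times> {0, 1, 2} \<times> (UNIV :: bool set)"
  obtain U :: "nat \<Rightarrow> ((complex \<times> complex \<times> complex) \<times> (complex \<times> complex \<times> complex)) set"
    where U: "\<And>i. openin (top_of_set ?Z) (U i)"
      "\<And>i. homotopic_with_canon (\<lambda>_. True) (U i) separable_cubics fst snd" "(\<Union>i\<le>3. U i) = ?Z"
  proof (rule open_cover_of_strata[where J = ?J and \<sigma> = cubic_stratum and lev = stratum_level
        and k = 3 and Z = ?Z and f = fst and g = snd and S = separable_cubics])
    show "?Z = (\<Union>j\<in>?J. cubic_stratum j)"
    proof
      show "?Z \<subseteq> (\<Union>j\<in>?J. cubic_stratum j)"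
      proof
        fix z assume "z \<in> ?Z"
        then have "z \<in> cubic_stratum (cubic_region (fst z), cubic_region (snd z),
            cubic_disc (snd z) / cubic_disc (fst z) \<in> \<real>\<^sub>\<ge>\<^sub>0)"
          by (simp add: cubic_stratum_def)
        moreover have "(cubic_region (fst z), cubic_region (snd z),
            cubic_disc (snd z) / cubic_disc (fst z) \<in> \<real>\<^sub>\<ge>\<^sub>0) \<in> ?J"
          by (simp add: cubic_region_def)
        ultimately show "z \<in> (\<Union>j\<in>?J. cubic_stratum j)"
          by blast
      qed
      show "(\<Union>j\<in>?J. cubic_stratum j) \<subseteq> ?Z"
        unfolding cubic_stratum_def by blast
    qed
    show "stratum_level j \<le> 3" for j
      by (cases j) (simp add: stratum_level_def)
    show "\<exists>D. openin (top_of_set ?Z) D \<and> cubic_stratum j \<subseteq> D \<and>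
        homotopic_with_canon (\<lambda>_. True) D separable_cubics fst snd" if "j \<in> ?J" for j
    proof -
      obtain a b c where "j = (a, b, c)" by (metis prod_cases3)
      then show ?thesis
        using that cubic_stratum_path_section[of a b c] by simp
    qed
    show "cubic_stratum i \<inter> closure (cubic_stratum j) = {}"
      if "i \<in> ?J" "j \<in> ?J" "i \<noteq> j" "stratum_level i = stratum_level j" for i j
    proof -
      obtain a b c where i: "i = (a, b, c)" by (metis prod_cases3)
      obtain a' b' c' where j: "j = (a', b', c')" by (metis prod_cases3)
      show ?thesis
        using that cubic_strata_separated[of a b c a' b' c'] unfolding i j by simp
    qed
  qed auto
  have "openin (prod_topology ?X ?X) (U i) \<and> has_path_section ?X (U i)" for i
  proof
    show "openin (prod_topology ?X ?X) (U i)"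
      using U(1) by simp
    have sub: "U i \<subseteq> ?Z"
      using U(1) openin_imp_subset by blast
    then have "subtopology (prod_topology ?X ?X) (U i) = top_of_set (U i)"
      by (simp add: subtopology_subtopology inf_absorb2)
    then show "has_path_section ?X (U i)"
      using U(2) sub by (subst has_path_section_iff_homotopic) simp_all
  qed
  then have "enat 3 \<in> {enat k | k. \<exists>U :: nat \<Rightarrow> ((complex \<times> complex \<times> complex) \<times> (complex \<times> complex \<times> complex)) set.
       (\<forall>i\<le>k. openin (prod_topology ?X ?X) (U i) \<and> has_path_section ?X (U i)) \<and>
       (\<Union>i\<le>k. U i) = topspace (prod_topology ?X ?X)}"
    using U(3) by (intro CollectI exI[of _ 3] exI[of _ U] conjI) auto
  then have "TC ?X \<le> enat 3"
    unfolding TC_def by (rule Inf_lower)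
  then show ?thesis
    by (simp add: numeral_eq_enat)
qed

theorem theorem1p6:
  fixes D :: "'a topology"
  assumes "is_disc D"
  shows "TC (unordered_config D 3) = 3"
  unfolding TC_homeomorphic_space[OF unordered_config_3_homeomorphic[OF assms]]
  using TC_separable_cubics_le TC_separable_cubics_ge by (rule antisym)

end
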